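(* The geodesic circles of a fundamental geodesic-circle complex $(\mathsf g,\mathsf c)$ are uniquely determined by one-dimensional Cauchy data of star-shaped combinatorial type, i.e. by the geodesic circles attached to a star-shaped region which divides the triangular lattice $A_2^0$ into three sectors of 120 degrees. The circles of a fundamental geodesic-circle complex come in pairs related by reflection in the $x$-axis. If, for a fixed choice of the circles associated with the one-dimensional Cauchy data, the choice of the remaining circles is dictated by correlation then a fundamental geodesic-circle complex may be interpreted as a particular fundamental circle complex. In this sense, fundamental geodesic-circle complexes are governed by a reduction of the symmetric $M$-system.
   Context: $e_1,e_2,e_3$ is the standard basis of $\mathbb Z^3$; $A_2^k=\{n\in\mathbb Z^3:n_1+n_2+n_3=k\}$; a lower index on a lattice function denotes a unit shift in the corresponding direction. Oriented (Lie) circles: the points $[V]$, $V=(x,y,a,b,r)$, of the Lie quadric $\langle V,V\rangle=0$ in $\mathbb{RP}^4$, with $\langle V,V'\rangle=xx'+yy'-\tfrac12(ab'+a'b)-rr'$: $(x,y,1,x^2+y^2-r^2,r)$ is the circle of centre $(x,y)$ and signed radius $r$ (a point if $r=0$), $(v,w,0,2d,1)$ with $v^2+w^2=1$ an oriented line, $(0,0,0,1,0)$ the point at infinity. Two of them are in oriented contact iff $\langle V,V'\rangle=0$. Oriented geodesic circles ("geodesics") are the oriented circles and lines orthogonal to the $x$-axis, i.e. those represented by vectors with vanishing second component, such as $(x,0,1,x^2-r^2,r)$. Reflection in the $x$-axis changes the sign of the second component of $V$ and fixes every geodesic circle. A circle in oriented contact with three given geodesic circles is unique up to this reflection. Fundamental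 geodesic-circle complex: a pair of maps $\mathsf g$ from the even sublattice ($n_1+n_2+n_3$ even) of $\mathbb Z^3$ to oriented geodesic circles and $\mathsf c$ from the odd sublattice to oriented circles such that the geodesic circle and the circle attached to the endpoints of any edge of $\mathbb Z^3$ are incident, i.e. in oriented contact. One-dimensional Cauchy data: the star-shaped region is of the following form. For $w\in A_2^{-1}$, $u=w+e_1+e_2+e_3$ and $f_1=e_1-e_2$, $f_2=e_2-e_3$, $f_3=e_3-e_1$, let $\Sigma\subset A_2^0$ be the union of $\{w+e_3+if_1+jf_2\}$, $\{w+e_1+if_2+jf_3\}$, $\{w+e_2+if_3+jf_1\}$ with integers $i,j\ge0$, $\min(i,j)\le1$. The data are the geodesic circles $\mathsf g(\Sigma)$, subject only to the constraint that the three central circles $\mathsf c(u-e_k)$, $k=1,2,3$, are in oriented contact with a common additional geodesic circle $\mathsf g(u)$. The circles associated with the data are the circles $\mathsf c(v)$, $v\in A_2^1\cup A_2^{-1}$, all of whose three neighbours in $A_2^0$ lie in $\Sigma$. Lines and circles: with Plücker coordinates $\gamma^{\mu\nu}=\alpha^\mu\beta^\nu-\alpha^\nu\beta^\mu$ of the line in $\mathbb{RP}^3$ through points $\alpha,\beta$, the lines of the linear line complex $\mathcal L=\{\gamma^{03}=\gamma^{12}\}$ are the points $(\gamma^{01},\gamma^{23},\gamma^{02},\gamma^{13},\gamma^{03})$ of the quadric $2\gamma^{01}\gamma^{23}-2\gamma^{02}\gamma^{13}+2(\gamma^{03})^2=0$ of signature $(3,2)$; a fixed linear isometry identifies it with the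 Lie quadric, so that lines of $\mathcal L$ correspond to oriented circles and intersecting lines to circles in oriented contact. Fundamental circle complex: a map from $\mathbb Z^3$ to oriented circles such that the corresponding lines $\mathsf l$ of $\mathcal L$ satisfy: any neighbouring lines $\mathsf l,\mathsf l_l$ intersect, and the points of intersection $\mathsf p^l$ are such that, for any distinct $l,m,p$, the points $\mathsf p^l,\mathsf p^l_m,\mathsf p^l_{mp},\mathsf p^l_p$ are coplanar. Fundamental circle complexes are governed by the symmetric $M$-system, i.e. the system $M^{ik}_l=M^{ik}-M^{il}M^{lk}/M^{ll}$, $l\in\{1,2,3\}\setminus\{i,k\}$, for a real symmetric $5\times5$ matrix $\mathcal M=(M^{ik})$ on $\mathbb Z^3$: their (generic) lines have Plücker coordinates $(\gamma^{01},\gamma^{23},\gamma^{02},\gamma^{13},\gamma^{03},\gamma^{12})=(1,M^{44}M^{55}-(M^{45})^2,M^{44},M^{55},M^{45},M^{45})$. A reduction of the $M$-system corresponds to a particular subclass of its solutions. Correlated: a hexagon with vertices $x^1,\dots,x^6$ (indices mod 6) in general position in $\mathbb{RP}^3$ has a unique associated correlation $\kappa(x)=\{y:y^TBx=0\}$, $B=B^T$, with $\kappa(x^i)=\pi^{i+3}$, where $\pi^i$ is the plane through $x^{i-1},x^i,x^{i+1}$; the image of a line is the intersection of the images of its points. Two oriented circles at opposite vertices of an elementary cube of eight oriented circles which touch along edges are correlated if the corresponding lines are images of each other under the correlation associated with the hexagon formed by the lines corresponding to the remaining six circles. The choice of a circle is "dictated by correlation" as follows: for four geodesic circles and three circles which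 are incident along the edges of an elementary cube, the fourth circle is chosen (from the pair of circles related by reflection) to be the one which is correlated to the opposite geodesic circle.
   Formalization: Circles of an elementary cube are assumed to touch only along edges (general position), and the fixed choice of circles associated with the data must be correlated in the central cube, all four of whose circles belong to the data; otherwise the claims fail. *)

theory Defs
  imports "HOL-Analysis.Analysis"
begin

section \<open>The lattice\<close>

type_synonym site = "int^3"

definition unit_step :: "3 \<Rightarrow> site" where
  "unit_step k = axis k 1"

definition adjacent :: "site \<Rightarrow> site \<Rightarrow> bool" where
  "adjacent m n \<longleftrightarrow> (\<exists>k. n = m + unit_step k \<or> m = n + unit_step k)"

definition even_site :: "site \<Rightarrow> bool" where
  "even_site n \<longleftrightarrow> even (n $ 1 + n $ 2 + n $ 3)"

definition A2 :: "int \<Rightarrow> site set" where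
  "A2 k = {n. n $ 1 + n $ 2 + n $ 3 = k}"

definition f1 :: site where "f1 = unit_step 1 - unit_step 2"
definition f2 :: site where "f2 = unit_step 2 - unit_step 3"
definition f3 :: site where "f3 = unit_step 3 - unit_step 1"

definition star_region :: "site \<Rightarrow> site set" where
  "star_region w =
     {w + unit_step 3 + i *s f1 + j *s f2 | i j. 0 \<le> i \<and> 0 \<le> j \<and> min i j \<le> 1} \<union>
     {w + unit_step 1 + i *s f2 + j *s f3 | i j. 0 \<le> i \<and> 0 \<le> j \<and> min i j \<le> 1} \<union>
     {w + unit_step 2 + i *s f3 + j *s f1 | i j. 0 \<le> i \<and> 0 \<le> j \<and> min i j \<le> 1}"

definition data_circle_sites :: "site \<Rightarrow> site set" where
  "data_circle_sites w =
     {v \<in> A2 1 \<union> A2 (- 1). \<forall>n\<in>A2 0. adjacent v n \<longrightarrow> n \<in> star_region w}"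

text \<open>
  An elementary cube with a distinguished vertex \<open>n\<close> is given by \<open>n\<close> and its three edge
  vectors \<open>a 1\<close>, \<open>a 2\<close>, \<open>a 3\<close> at \<open>n\<close>; the vertex opposite to \<open>n\<close> is \<open>n + a 1 + a 2 + a 3\<close> and
  \<open>hexagon_site n a\<close> runs cyclically through the other six.
\<close>

definition cube_edges :: "(3 \<Rightarrow> site) \<Rightarrow> bool" where
  "cube_edges a \<longleftrightarrow> (\<forall>k. a k = unit_step k \<or> a k = - unit_step k)"

definition opposite_site :: "site \<Rightarrow> (3 \<Rightarrow> site) \<Rightarrow> site" where
  "opposite_site n a = n + a 1 + a 2 + a 3"

definition hexagon_site :: "site \<Rightarrow> (3 \<Rightarrow> site) \<Rightarrow> 6 \<Rightarrow> site" where
  "hexagon_site n a i =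
     (vector [n + a 1, n + a 1 + a 2, n + a 2, n + a 2 + a 3, n + a 3, n + a 3 + a 1] :: site^6) $ i"

section \<open>Oriented circles\<close>

text \<open>
  Circles are handled through homogeneous coordinates \<open>(x, y, a, b, r)\<close>, i.e. nonzero vectors;
  equality of circles is \<open>same_circle\<close>.
\<close>

definition lie_form :: "real^5 \<Rightarrow> real^5 \<Rightarrow> real" where
  "lie_form V W = V $ 1 * W $ 1 + V $ 2 * W $ 2 - (V $ 3 * W $ 4 + V $ 4 * W $ 3) / 2 - V $ 5 * W $ 5"

definition oriented_circle :: "real^5 \<Rightarrow> bool" where
  "oriented_circle V \<longleftrightarrow> V \<noteq> 0 \<and> lie_form V V = 0"

definition same_circle :: "real^5 \<Rightarrow> real^5 \<Rightarrow> bool" where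
  "same_circle V W \<longleftrightarrow> (\<exists>s. s \<noteq> 0 \<and> V = s *\<^sub>R W)"

definition contact :: "real^5 \<Rightarrow> real^5 \<Rightarrow> bool" where
  "contact V W \<longleftrightarrow> lie_form V W = 0"

definition geodesic_circle :: "real^5 \<Rightarrow> bool" where
  "geodesic_circle V \<longleftrightarrow> oriented_circle V \<and> V $ 2 = 0"

definition reflect :: "real^5 \<Rightarrow> real^5" where
  "reflect V = (\<chi> i. if i = 2 then - (V $ i) else V $ i)"

section \<open>Geodesic-circle complexes and their Cauchy data\<close>

text \<open>
  The maps are total, but only the values of \<open>g\<close> at even sites and of \<open>c\<close> at odd sites are relevant.
\<close>

definition geodesic_circle_complex :: "(site \<Rightarrow> real^5) \<Rightarrow> (site \<Rightarrow> real^5) \<Rightarrow> bool" where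
  "geodesic_circle_complex g c \<longleftrightarrow>
     (\<forall>n. even_site n \<longrightarrow> geodesic_circle (g n)) \<and>
     (\<forall>v. \<not> even_site v \<longrightarrow> oriented_circle (c v)) \<and>
     (\<forall>n v. even_site n \<and> \<not> even_site v \<and> adjacent n v \<longrightarrow> contact (g n) (c v))"

definition combine :: "(site \<Rightarrow> real^5) \<Rightarrow> (site \<Rightarrow> real^5) \<Rightarrow> site \<Rightarrow> real^5" where
  "combine g c n = (if even_site n then g n else c n)"

text \<open>
  The genericity assumption: two circles of an elementary cube touch only if they are joined by an
  edge.  In a geodesic-circle complex it depends on the geodesic circles only: it says that the four
  geodesic circles of an elementary cube are linearly independent and pairwise not in contact.
\<close>

definition generic :: "(site \<Rightarrow> real^5) \<Rightarrow> bool" where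
  "generic V \<longleftrightarrow> (\<forall>n a. cube_edges a \<longrightarrow>
     (\<forall>j k. j \<noteq> k \<longrightarrow> \<not> contact (V n) (V (n + a j + a k))) \<and>
     \<not> contact (V n) (V (opposite_site n a)))"

definition cauchy_data :: "site \<Rightarrow> (site \<Rightarrow> real^5) \<Rightarrow> bool" where
  "cauchy_data w d \<longleftrightarrow>
     (\<forall>n\<in>star_region w. geodesic_circle (d n)) \<and>
     (\<exists>(cc :: 3 \<Rightarrow> real^5) h.
        (\<forall>k. oriented_circle (cc k) \<and>
           (\<forall>n\<in>A2 0. adjacent (opposite_site w unit_step - unit_step k) n \<longrightarrow> contact (d n) (cc k))) \<and>
        geodesic_circle h \<and> (\<forall>k. \<not> same_circle h (d (w + unit_step k))) \<and>
        (\<forall>k. contact h (cc k)))"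

section \<open>Lines of the linear complex\<close>

definition plucker :: "real^4 \<Rightarrow> real^4 \<Rightarrow> 4 \<Rightarrow> 4 \<Rightarrow> real" where
  "plucker \<alpha> \<beta> \<mu> \<nu> = \<alpha> $ \<mu> * \<beta> $ \<nu> - \<alpha> $ \<nu> * \<beta> $ \<mu>"

definition complex_coords :: "real^4 \<Rightarrow> real^4 \<Rightarrow> real^5" where
  "complex_coords \<alpha> \<beta> =
     vector [plucker \<alpha> \<beta> 0 1, plucker \<alpha> \<beta> 2 3, plucker \<alpha> \<beta> 0 2, plucker \<alpha> \<beta> 1 3, plucker \<alpha> \<beta> 0 3]"

definition lie_plucker_isometry :: "(real^5 \<Rightarrow> real^5) \<Rightarrow> bool" where
  "lie_plucker_isometry \<Phi> \<longleftrightarrow> linear \<Phi> \<and>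
     (\<forall>V. 2 * (\<Phi> V $ 1) * (\<Phi> V $ 2) - 2 * (\<Phi> V $ 3) * (\<Phi> V $ 4) + 2 * (\<Phi> V $ 5)\<^sup>2 = lie_form V V)"

text \<open>
  Points of projective 3-space are nonzero vectors of \<open>real^4\<close>, lines are 2-dimensional subspaces.
  For an oriented circle \<open>V\<close> all admissible pairs \<open>\<alpha>\<close>, \<open>\<beta>\<close> below span the same subspace.
\<close>

definition line_of :: "(real^5 \<Rightarrow> real^5) \<Rightarrow> real^5 \<Rightarrow> (real^4) set" where
  "line_of \<Phi> V = \<Union> {span {\<alpha>, \<beta>} | \<alpha> \<beta>.
     plucker \<alpha> \<beta> 0 3 = plucker \<alpha> \<beta> 1 2 \<and> complex_coords \<alpha> \<beta> = \<Phi> V}"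

definition meets_in :: "(real^4) set \<Rightarrow> (real^4) set \<Rightarrow> real^4 \<Rightarrow> bool" where
  "meets_in L L' p \<longleftrightarrow> p \<noteq> 0 \<and> L \<inter> L' = span {p}"

definition coplanar_points :: "(real^4) set \<Rightarrow> bool" where
  "coplanar_points S \<longleftrightarrow> (\<exists>y. y \<noteq> 0 \<and> (\<forall>p\<in>S. y \<bullet> p = 0))"

definition fundamental_circle_complex :: "(real^5 \<Rightarrow> real^5) \<Rightarrow> (site \<Rightarrow> real^5) \<Rightarrow> bool" where
  "fundamental_circle_complex \<Phi> V \<longleftrightarrow>
     (\<forall>n. oriented_circle (V n)) \<and>
     (\<exists>p :: 3 \<Rightarrow> site \<Rightarrow> real^4.
        (\<forall>l n. meets_in (line_of \<Phi> (V n)) (line_of \<Phi> (V (n + unit_step l))) (p l n)) \<and>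
        (\<forall>l m q n. l \<noteq> m \<and> m \<noteq> q \<and> l \<noteq> q \<longrightarrow>
           coplanar_points {p l n, p l (n + unit_step m),
             p l (n + unit_step m + unit_step q), p l (n + unit_step q)}))"

section \<open>Correlated circles\<close>

definition polar_plane :: "real^4^4 \<Rightarrow> real^4 \<Rightarrow> (real^4) set" where
  "polar_plane B x = {y. y \<bullet> (B *v x) = 0}"

definition associated_correlation :: "(6 \<Rightarrow> real^4) \<Rightarrow> real^4^4 \<Rightarrow> bool" where
  "associated_correlation x B \<longleftrightarrow> transpose B = B \<and> invertible B \<and>
     (\<forall>i. polar_plane B (x i) = span {x (i + 3 - 1), x (i + 3), x (i + 3 + 1)})"

definition image_line :: "real^4^4 \<Rightarrow> (real^4) set \<Rightarrow> (real^4) set" where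
  "image_line B L = (\<Inter>x\<in>L. polar_plane B x)"

text \<open>
  \<open>H i\<close> is the circle whose line is the edge of the hexagon from \<open>x i\<close> to \<open>x (i + 1)\<close>.
\<close>

definition correlated :: "(real^5 \<Rightarrow> real^5) \<Rightarrow> real^5 \<Rightarrow> real^5 \<Rightarrow> (6 \<Rightarrow> real^5) \<Rightarrow> bool" where
  "correlated \<Phi> V W H \<longleftrightarrow>
     (\<exists>x B. (\<forall>i. meets_in (line_of \<Phi> (H (i - 1))) (line_of \<Phi> (H i)) (x i)) \<and>
        associated_correlation x B \<and>
        image_line B (line_of \<Phi> V) = line_of \<Phi> W \<and> image_line B (line_of \<Phi> W) = line_of \<Phi> V)"

definition correlated_in_cube ::
    "(real^5 \<Rightarrow> real^5) \<Rightarrow> (site \<Rightarrow> real^5) \<Rightarrow> site \<Rightarrow> (3 \<Rightarrow> site) \<Rightarrow> bool" where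
  "correlated_in_cube \<Phi> V n a \<longleftrightarrow>
     correlated \<Phi> (V n) (V (opposite_site n a)) (\<lambda>i. V (hexagon_site n a i))"

text \<open>
  The sites at which the circle is either associated with the Cauchy data or, in some elementary
  cube, correlated to the opposite geodesic circle after the other three circles of that cube have
  been chosen.
\<close>

inductive_set dictated_sites ::
    "(real^5 \<Rightarrow> real^5) \<Rightarrow> site \<Rightarrow> (site \<Rightarrow> real^5) \<Rightarrow> site set"
  for \<Phi> w V where
  data: "v \<in> data_circle_sites w \<Longrightarrow> v \<in> dictated_sites \<Phi> w V"
| step: "\<lbrakk> \<not> even_site v; cube_edges a;
    v + a 1 + a 2 \<in> dictated_sites \<Phi> w V;
    v + a 2 + a 3 \<in> dictated_sites \<Phi> w V;
    v + a 3 + a 1 \<in> dictated_sites \<Phi> w V;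
    correlated_in_cube \<Phi> V v a \<rbrakk> \<Longrightarrow> v \<in> dictated_sites \<Phi> w V"

definition correlation_extension ::
    "(real^5 \<Rightarrow> real^5) \<Rightarrow> site \<Rightarrow> (site \<Rightarrow> real^5) \<Rightarrow> (site \<Rightarrow> real^5) \<Rightarrow> (site \<Rightarrow> real^5) \<Rightarrow> bool" where
  "correlation_extension \<Phi> w g c0 c \<longleftrightarrow>
     geodesic_circle_complex g c \<and> (\<forall>v\<in>data_circle_sites w. same_circle (c v) (c0 v)) \<and>
     (\<forall>v. \<not> even_site v \<longrightarrow> v \<in> dictated_sites \<Phi> w (combine g c))"

section \<open>The symmetric M-system\<close>

definition symmetric_M_system :: "(site \<Rightarrow> real^5^5) \<Rightarrow> bool" where
  "symmetric_M_system M \<longleftrightarrow>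
     (\<forall>n. transpose (M n) = M n) \<and>
     (\<forall>n. \<forall>(l, e) \<in> {(1 :: 5, unit_step 1), (2, unit_step 2), (3, unit_step 3)}.
        M n $ l $ l \<noteq> 0 \<and>
        (\<forall>i k. i \<noteq> l \<and> k \<noteq> l \<longrightarrow>
           M (n + e) $ i $ k = M n $ i $ k - M n $ i $ l * M n $ l $ k / M n $ l $ l))"

definition M_line_coords :: "real^5^5 \<Rightarrow> real^5" where
  "M_line_coords M =
     vector [1, M $ 4 $ 4 * M $ 5 $ 5 - (M $ 4 $ 5)\<^sup>2, M $ 4 $ 4, M $ 5 $ 5, M $ 4 $ 5]"

definition governed_by ::
    "(real^5 \<Rightarrow> real^5) \<Rightarrow> (site \<Rightarrow> real^5^5) \<Rightarrow> (site \<Rightarrow> real^5) \<Rightarrow> bool" where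
  "governed_by \<Phi> M V \<longleftrightarrow> (\<forall>n. \<exists>s. s \<noteq> 0 \<and> \<Phi> (V n) = s *\<^sub>R M_line_coords (M n))"

text \<open>
  The reduction: the circles encoded by the matrices at even sites are geodesic circles.
\<close>

definition reduced_M_system :: "(real^5 \<Rightarrow> real^5) \<Rightarrow> (site \<Rightarrow> real^5^5) \<Rightarrow> bool" where
  "reduced_M_system \<Phi> M \<longleftrightarrow> symmetric_M_system M \<and>
     (\<forall>n V. even_site n \<and> \<Phi> V = M_line_coords (M n) \<longrightarrow> V $ 2 = 0)"

end

theory Submission
  imports Defs
begin

text \<open>
  Oriented circles are the isotropic lines of a symplectic form on \<open>real^4\<close>, and the reflection in the
  axis is induced by an involution of \<open>real^4\<close> with two-dimensional eigenspaces. A geodesic circle meets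
  either eigenspace in one point, and any other circle is the graph of a map between the eigenspaces,
  so that after a choice of vectors a complex becomes a function \<open>\<mu>\<close> on the edges of the lattice. The
  squares of \<open>\<mu>\<close> depend on the geodesic circles only; reflecting a circle changes the sign of \<open>\<mu>\<close> on
  the edges at that circle. On a single cube, correlation of opposite circles, symmetrically in all
  pairs, and coplanarity of the four intersection points on parallel edges both reduce to one
  multiplicative condition on \<open>\<mu>\<close>, which fixes the product of the four signs. Hence the choice of the
  circles is a linear problem for signs on the lattice, with the central cube as its only constraint.
  Three geodesic circles of a cube determine the circle which touches them up to reflection, and the
  two circles of a face determine one of its geodesic circles from the other; in this way the geodesic
  circles propagate from the star-shaped region.

  For the M-system, the intersection points on the edges in direction \<open>l\<close> are rescaled to vectors whose
  first two components are \<open>M $ l $ 4\<close> and \<open>M $ l $ 5\<close>. The required factors form a connection, and it is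
  coplanarity that makes this connection flat.
\<close>

text \<open>The common point of a circle \<open>v\<close> and a geodesic circle \<open>n\<close> is
  normalised to \<open>\<mu> v n *\<^sub>R p n + q n\<close>. Since the line of a circle is
  isotropic, the product of \<open>\<mu>\<close> over two edges at \<open>v\<close> is, up to sign,
  a ratio of values of the form on the geodesic circles; three such products give the squares, so
  only one sign per circle stays free. The two sides of \<open>twisted\<close> have equal squares
  and only one of them changes sign when the distinguished circle is reflected: exactly one of a
  circle and its reflection satisfies it. With the uniqueness of the correlation of a hexagon, this
  turns an implication into an equivalence. Uniqueness and existence rest on one remark: the edges
  of the hexagon are isotropic, so its planes are the null planes of its vertices, and a correlation
  composed with the null polarity is a linear map exchanging opposite vertices. It is written down
  as an explicit matrix in two parameters. In the M-system the block of indices 4, 5 changes by a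
  matrix of rank one along an edge; the diagonal entries are the reciprocals of the coefficients,
  and the off-diagonal ones are read off from the faces.\<close>

lemma forall_4': "(\<forall>i::4. P i) \<longleftrightarrow> P 0 \<and> P 1 \<and> P 2 \<and> P 3"
proof -
  \<comment> \<open>Plucker indices run from 0 to 3, the library enumerates this type as 1 to 4; the
    numeral 4 is 0 here.\<close>
  have four: "(4 :: 4) = 0" by simp
  show ?thesis unfolding forall_4 four by blast
qed

lemma sum_4': "sum f (UNIV :: 4 set) = f 0 + f 1 + f 2 + f 3"
proof -
  have four: "(4 :: 4) = 0" by simp
  show ?thesis unfolding sum_4 four by (simp add: ac_simps)
qed

lemma vec4_eq_iff: "x = y \<longleftrightarrow> x $ 0 = y $ 0 \<and> x $ 1 = y $ 1 \<and> x $ 2 = y $ 2 \<and> x $ 3 = y $ 3"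
  for x y :: "'a^4"
  by (auto simp: vec_eq_iff forall_4')

lemma inner_vec4: "x \<bullet> y = x $ 0 * y $ 0 + x $ 1 * y $ 1 + x $ 2 * y $ 2 + x $ 3 * y $ 3"
  for x y :: "real^4"
  by (simp add: inner_vec_def sum_4')

lemma exhaust_5: fixes x :: 5 shows "x = 1 \<or> x = 2 \<or> x = 3 \<or> x = 4 \<or> x = 5"
proof (induct x)
  case (of_int z)
  then have "z = 0 \<or> z = 1 \<or> z = 2 \<or> z = 3 \<or> z = 4" by (simp add: eval_nat_numeral) arith
  then show ?case by auto
qed

lemma exhaust_6: fixes x :: 6 shows "x = 1 \<or> x = 2 \<or> x = 3 \<or> x = 4 \<or> x = 5 \<or> x = 6"
proof (induct x)
  case (of_int z)
  then have "z = 0 \<or> z = 1 \<or> z = 2 \<or> z = 3 \<or> z = 4 \<or> z = 5" by (simp add: eval_nat_numeral) arith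
  then show ?case by auto
qed

lemma forall_5: "(\<forall>i::5. P i) \<longleftrightarrow> P 1 \<and> P 2 \<and> P 3 \<and> P 4 \<and> P 5"
  by (metis exhaust_5)

lemma forall_6: "(\<forall>i::6. P i) \<longleftrightarrow> P 1 \<and> P 2 \<and> P 3 \<and> P 4 \<and> P 5 \<and> P 6"
  by (metis exhaust_6)

lemma vec5_eq_iff:
  "x = y \<longleftrightarrow> x $ 1 = y $ 1 \<and> x $ 2 = y $ 2 \<and> x $ 3 = y $ 3 \<and> x $ 4 = y $ 4 \<and> x $ 5 = y $ 5"
  for x y :: "'a^5"
  by (auto simp: vec_eq_iff forall_5)

lemma vector_5 [simp]:
  "(vector [a, b, c, d, e] :: ('a::zero)^5) $ 1 = a"
  "(vector [a, b, c, d, e] :: ('a::zero)^5) $ 2 = b"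
  "(vector [a, b, c, d, e] :: ('a::zero)^5) $ 3 = c"
  "(vector [a, b, c, d, e] :: ('a::zero)^5) $ 4 = d"
  "(vector [a, b, c, d, e] :: ('a::zero)^5) $ 5 = e"
  by (simp_all add: vector_def)

lemma vector_6 [simp]:
  "(vector [a, b, c, d, e, f] :: ('a::zero)^6) $ 1 = a"
  "(vector [a, b, c, d, e, f] :: ('a::zero)^6) $ 2 = b"
  "(vector [a, b, c, d, e, f] :: ('a::zero)^6) $ 3 = c"
  "(vector [a, b, c, d, e, f] :: ('a::zero)^6) $ 4 = d"
  "(vector [a, b, c, d, e, f] :: ('a::zero)^6) $ 5 = e"
  "(vector [a, b, c, d, e, f] :: ('a::zero)^6) $ 6 = f"
  by (simp_all add: vector_def)

section \<open>The symplectic form on the points of projective 3-space\<close>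

text \<open>A line lies in the linear complex iff it is isotropic for this form.\<close>

definition sympl :: "real^4 \<Rightarrow> real^4 \<Rightarrow> real" where
  "sympl x y = x $ 0 * y $ 3 - x $ 3 * y $ 0 - x $ 1 * y $ 2 + x $ 2 * y $ 1"

text \<open>Polar planes and coplanarity are stated with the Euclidean inner product; this vector is
  the null plane of \<open>x\<close> in that language.\<close>

definition sympl_dual :: "real^4 \<Rightarrow> real^4" where
  "sympl_dual x = (\<chi> i. if i = 0 then - (x $ 3) else if i = 1 then x $ 2
     else if i = 2 then - (x $ 1) else x $ 0)"

text \<open>The Pfaffian of the skew Gram matrix of four points: coplanarity is tested on values of
  \<open>sympl\<close> alone.\<close>

definition pfaffian :: "real^4 \<Rightarrow> real^4 \<Rightarrow> real^4 \<Rightarrow> real^4 \<Rightarrow> real" where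
  "pfaffian x y z w = sympl x y * sympl z w - sympl x z * sympl y w + sympl x w * sympl y z"

lemma sympl_dual_nth [simp]:
  "sympl_dual x $ 0 = - (x $ 3)" "sympl_dual x $ 1 = x $ 2"
  "sympl_dual x $ 2 = - (x $ 1)" "sympl_dual x $ 3 = x $ 0"
  by (simp_all add: sympl_dual_def)

lemma inner_sympl_dual: "y \<bullet> sympl_dual x = sympl x y"
  by (simp add: inner_vec4 sympl_def algebra_simps)

lemma sympl_linear [simp]:
  "sympl (x + y) z = sympl x z + sympl y z" "sympl z (x + y) = sympl z x + sympl z y"
  "sympl (x - y) z = sympl x z - sympl y z" "sympl z (x - y) = sympl z x - sympl z y"
  "sympl (r *\<^sub>R x) z = r * sympl x z" "sympl z (r *\<^sub>R x) = r * sympl z x"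
  "sympl (- x) z = - sympl x z" "sympl z (- x) = - sympl z x"
  "sympl 0 z = 0" "sympl z 0 = 0"
  by (simp_all add: sympl_def algebra_simps)

lemma sympl_self [simp]: "sympl x x = 0"
  by (simp add: sympl_def)

lemma sympl_commute: "sympl x y = - sympl y x"
  by (simp add: sympl_def)

lemma sympl_dual_linear [simp]:
  "sympl_dual (x + y) = sympl_dual x + sympl_dual y"
  "sympl_dual (r *\<^sub>R x) = r *\<^sub>R sympl_dual x"
  "sympl_dual 0 = 0"
  by (simp_all add: vec4_eq_iff)

lemma sympl_dual_eq_0_iff [simp]: "sympl_dual x = 0 \<longleftrightarrow> x = 0"
  by (auto simp: vec4_eq_iff)

lemma sympl_nondegenerate: assumes "\<And>y. sympl x y = 0" shows "x = 0"
proof -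
  have "sympl_dual x \<bullet> sympl_dual x = 0" using assms by (simp add: inner_sympl_dual)
  then show ?thesis by simp
qed

text \<open>The Pfaffian is, up to sign, the determinant of the four vectors.\<close>

lemma pfaffian_eq_0_if_orthogonal:
  assumes "w \<noteq> 0" "w \<bullet> x1 = 0" "w \<bullet> x2 = 0" "w \<bullet> x3 = 0" "w \<bullet> x4 = 0"
  shows "pfaffian x1 x2 x3 x4 = 0"
proof -
  \<comment> \<open>Cramer's rule, once for each coordinate of \<open>w\<close>.\<close>
  have "w $ 0 * pfaffian x1 x2 x3 x4 = 0"
    using assms(2-5) unfolding inner_vec4 pfaffian_def sympl_def by algebra
  moreover have "w $ 1 * pfaffian x1 x2 x3 x4 = 0"
    using assms(2-5) unfolding inner_vec4 pfaffian_def sympl_def by algebra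
  moreover have "w $ 2 * pfaffian x1 x2 x3 x4 = 0"
    using assms(2-5) unfolding inner_vec4 pfaffian_def sympl_def by algebra
  moreover have "w $ 3 * pfaffian x1 x2 x3 x4 = 0"
    using assms(2-5) unfolding inner_vec4 pfaffian_def sympl_def by algebra
  ultimately show ?thesis using assms(1) by (auto simp: vec4_eq_iff)
qed

section \<open>Oriented circles as isotropic lines\<close>

text \<open>
  The operators \<open>cliff U\<close> represent the Clifford algebra of the quadratic form of the linear complex
  on \<open>real^4\<close>; the line with coordinates \<open>U\<close> is the kernel of \<open>cliff U\<close>.
\<close>

definition cliff :: "real^5 \<Rightarrow> real^4 \<Rightarrow> real^4" where
  "cliff U x = (\<chi> i. if i = 0 then U $ 5 * x $ 0 - U $ 3 * x $ 1 + U $ 1 * x $ 2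
     else if i = 1 then U $ 4 * x $ 0 - U $ 5 * x $ 1 + U $ 1 * x $ 3
     else if i = 2 then U $ 2 * x $ 0 - U $ 5 * x $ 2 + U $ 3 * x $ 3
     else U $ 2 * x $ 1 - U $ 4 * x $ 2 + U $ 5 * x $ 3)"

definition complex_form :: "real^5 \<Rightarrow> real^5 \<Rightarrow> real" where
  "complex_form U W = U $ 1 * W $ 2 + U $ 2 * W $ 1 - U $ 3 * W $ 4 - U $ 4 * W $ 3 + 2 * (U $ 5 * W $ 5)"

lemma cliff_nth [simp]:
  "cliff U x $ 0 = U $ 5 * x $ 0 - U $ 3 * x $ 1 + U $ 1 * x $ 2"
  "cliff U x $ 1 = U $ 4 * x $ 0 - U $ 5 * x $ 1 + U $ 1 * x $ 3"
  "cliff U x $ 2 = U $ 2 * x $ 0 - U $ 5 * x $ 2 + U $ 3 * x $ 3"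
  "cliff U x $ 3 = U $ 2 * x $ 1 - U $ 4 * x $ 2 + U $ 5 * x $ 3"
  by (simp_all add: cliff_def)

lemma cliff_linear [simp]:
  "cliff U (x + y) = cliff U x + cliff U y" "cliff U (x - y) = cliff U x - cliff U y"
  "cliff U (r *\<^sub>R x) = r *\<^sub>R cliff U x" "cliff U (- x) = - cliff U x" "cliff U 0 = 0"
  "cliff (U + W) x = cliff U x + cliff W x" "cliff (U - W) x = cliff U x - cliff W x"
  "cliff (r *\<^sub>R U) x = r *\<^sub>R cliff U x" "cliff 0 x = 0"
  by (simp_all add: vec4_eq_iff algebra_simps)

text \<open>The Clifford relation, normalised so that \<open>cliff U\<close> squares to half of
  \<open>complex_form U U\<close>. Isotropic vectors thus give operators of square zero, orthogonal
  ones anticommuting operators; incidence of lines is drawn from this.\<close>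

lemma cliff_anticommute: "cliff U (cliff W x) + cliff W (cliff U x) = complex_form U W *\<^sub>R x"
  by (simp add: vec4_eq_iff complex_form_def) algebra

lemma sympl_cliff: "sympl (cliff U x) y = sympl x (cliff U y)"
  by (simp add: sympl_def algebra_simps)

lemma complex_coords_nth [simp]:
  "complex_coords \<alpha> \<beta> $ 1 = plucker \<alpha> \<beta> 0 1" "complex_coords \<alpha> \<beta> $ 2 = plucker \<alpha> \<beta> 2 3"
  "complex_coords \<alpha> \<beta> $ 3 = plucker \<alpha> \<beta> 0 2" "complex_coords \<alpha> \<beta> $ 4 = plucker \<alpha> \<beta> 1 3"
  "complex_coords \<alpha> \<beta> $ 5 = plucker \<alpha> \<beta> 0 3"
  by (simp_all add: complex_coords_def)

lemma sympl_eq_plucker: "sympl \<alpha> \<beta> = plucker \<alpha> \<beta> 0 3 - plucker \<alpha> \<beta> 1 2"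
  by (simp add: sympl_def plucker_def)

lemma plucker_scale: "plucker x (r *\<^sub>R y) i j = r * plucker x y i j"
  by (simp add: plucker_def algebra_simps)

lemma complex_coords_linear:
  "complex_coords x (y - z) = complex_coords x y - complex_coords x z"
  "complex_coords x (r *\<^sub>R y) = r *\<^sub>R complex_coords x y"
  by (simp_all add: vec5_eq_iff plucker_def algebra_simps)

text \<open>On an isotropic pair the sixth coordinate \<open>plucker x y 1 2\<close> equals the
  fifth, so all 2x2 minors vanish.\<close>

lemma complex_coords_eq_0_imp_parallel:
  assumes "complex_coords x y = 0" "sympl x y = 0" "x \<noteq> 0"
  shows "\<exists>t. y = t *\<^sub>R x"
proof -
  have P: "x $ 0 * y $ 1 = x $ 1 * y $ 0" "x $ 2 * y $ 3 = x $ 3 * y $ 2" "x $ 0 * y $ 2 = x $ 2 * y $ 0"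
    "x $ 1 * y $ 3 = x $ 3 * y $ 1" "x $ 0 * y $ 3 = x $ 3 * y $ 0" "x $ 1 * y $ 2 = x $ 2 * y $ 1"
    using assms(1,2) by (auto simp: vec5_eq_iff sympl_eq_plucker plucker_def)
  consider "x $ 0 \<noteq> 0" | "x $ 1 \<noteq> 0" | "x $ 2 \<noteq> 0" | "x $ 3 \<noteq> 0"
    using assms(3) by (auto simp: vec4_eq_iff)
  then show ?thesis
  proof cases
    case 1 then show ?thesis using P by (intro exI[of _ "y $ 0 / x $ 0"]) (simp add: vec4_eq_iff field_simps)
  next
    case 2 then show ?thesis using P by (intro exI[of _ "y $ 1 / x $ 1"]) (simp add: vec4_eq_iff field_simps)
  next
    case 3 then show ?thesis using P by (intro exI[of _ "y $ 2 / x $ 2"]) (simp add: vec4_eq_iff field_simps)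
  next
    case 4 then show ?thesis using P by (intro exI[of _ "y $ 3 / x $ 3"]) (simp add: vec4_eq_iff field_simps)
  qed
qed

lemma cliff_complex_coords:
  assumes "sympl \<alpha> \<beta> = 0"
  shows "cliff (complex_coords \<alpha> \<beta>) \<alpha> = 0" "cliff (complex_coords \<alpha> \<beta>) \<beta> = 0"
  using assms by (simp_all add: vec4_eq_iff plucker_def sympl_def) algebra+

lemma complex_coords_kernel:
  assumes "cliff (complex_coords x \<beta>) y = 0" "sympl x y = 0" "sympl x \<beta> = 0"
  shows "complex_coords x y $ i * complex_coords x \<beta> $ j = complex_coords x y $ j * complex_coords x \<beta> $ i"
proof -
  note s = assms(2,3)[unfolded sympl_def]
  have k: "cliff (complex_coords x \<beta>) y $ 0 = 0" "cliff (complex_coords x \<beta>) y $ 1 = 0"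
    "cliff (complex_coords x \<beta>) y $ 2 = 0" "cliff (complex_coords x \<beta>) y $ 3 = 0"
    using assms(1) by simp_all
  note k = k[unfolded cliff_nth complex_coords_nth plucker_def]
  note defs = complex_coords_nth plucker_def
  have "complex_coords x y $ 1 * complex_coords x \<beta> $ 2 = complex_coords x y $ 2 * complex_coords x \<beta> $ 1"
    "complex_coords x y $ 1 * complex_coords x \<beta> $ 3 = complex_coords x y $ 3 * complex_coords x \<beta> $ 1"
    "complex_coords x y $ 1 * complex_coords x \<beta> $ 4 = complex_coords x y $ 4 * complex_coords x \<beta> $ 1"
    "complex_coords x y $ 1 * complex_coords x \<beta> $ 5 = complex_coords x y $ 5 * complex_coords x \<beta> $ 1"
    "complex_coords x y $ 2 * complex_coords x \<beta> $ 3 = complex_coords x y $ 3 * complex_coords x \<beta> $ 2"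
    "complex_coords x y $ 2 * complex_coords x \<beta> $ 4 = complex_coords x y $ 4 * complex_coords x \<beta> $ 2"
    "complex_coords x y $ 2 * complex_coords x \<beta> $ 5 = complex_coords x y $ 5 * complex_coords x \<beta> $ 2"
    "complex_coords x y $ 3 * complex_coords x \<beta> $ 4 = complex_coords x y $ 4 * complex_coords x \<beta> $ 3"
    "complex_coords x y $ 3 * complex_coords x \<beta> $ 5 = complex_coords x y $ 5 * complex_coords x \<beta> $ 3"
    "complex_coords x y $ 4 * complex_coords x \<beta> $ 5 = complex_coords x y $ 5 * complex_coords x \<beta> $ 4"
    unfolding defs using s k by algebra+
  then show ?thesis using exhaust_5[of i] exhaust_5[of j] by (elim disjE; simp only:)
qed

text \<open>For isotropic \<open>U\<close> the image of \<open>cliff U\<close> lies in its kernel.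
  Joining an image point to a kernel point \<open>x\<close> recovers \<open>U\<close>, as soon as
  \<open>x\<close> and \<open>y\<close> are not conjugate.\<close>

lemma complex_coords_cliff:
  assumes "cliff U x = 0" "complex_form U U = 0"
  shows "complex_coords x (cliff U y) = sympl x y *\<^sub>R U" "sympl x (cliff U y) = 0"
proof -
  show "sympl x (cliff U y) = 0" using assms(1) by (simp flip: sympl_cliff)
  have K: "U $ 5 * x $ 0 - U $ 3 * x $ 1 + U $ 1 * x $ 2 = 0" "U $ 4 * x $ 0 - U $ 5 * x $ 1 + U $ 1 * x $ 3 = 0"
    "U $ 2 * x $ 0 - U $ 5 * x $ 2 + U $ 3 * x $ 3 = 0" "U $ 2 * x $ 1 - U $ 4 * x $ 2 + U $ 5 * x $ 3 = 0"
    using assms(1) by (auto simp: vec4_eq_iff)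
  show "complex_coords x (cliff U y) = sympl x y *\<^sub>R U"
    unfolding vec5_eq_iff complex_coords_nth plucker_def cliff_nth vector_scaleR_component sympl_def
      real_scaleR_def
    by (intro conjI; use K in algebra)
qed

lemma cliff_eq_0_imp: assumes "\<And>x. cliff U x = 0" shows "U = 0"
proof -
  have "cliff U (axis 0 1) = 0" "cliff U (axis 1 1) = 0" "cliff U (axis 2 1) = 0" using assms by blast+
  then show ?thesis by (auto simp: vec4_eq_iff vec5_eq_iff axis_def)
qed

lemma span_pair_iff: "x \<in> span {a, b} \<longleftrightarrow> (\<exists>s t. x = s *\<^sub>R a + t *\<^sub>R b)"
  for x :: "'a::real_vector"
  unfolding span_insert span_empty by (auto simp: algebra_simps diff_eq_eq)

text \<open>\<open>line_of\<close> speaks of spanning pairs. Any nonzero kernel point can serve as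
  the first member; the second is a rescaled image point.\<close>

lemma kernel_decomposable:
  assumes "complex_form U U = 0" "cliff U x = 0" "x \<noteq> 0"
  obtains \<beta> where "sympl x \<beta> = 0" "complex_coords x \<beta> = U"
proof -
  obtain y where "sympl x y \<noteq> 0" using sympl_nondegenerate assms(3) by blast
  then have "sympl x ((1 / sympl x y) *\<^sub>R cliff U y) = 0"
    "complex_coords x ((1 / sympl x y) *\<^sub>R cliff U y) = U"
    using complex_coords_cliff[OF assms(2,1)] by (simp_all add: complex_coords_linear)
  then show ?thesis using that by blast
qed

section \<open>Incidence of circles read off from the Clifford operators\<close>

locale lie_plucker =
  fixes \<Phi> :: "real^5 \<Rightarrow> real^5"
  assumes isometry: "lie_plucker_isometry \<Phi>"
begin

abbreviation T :: "real^5 \<Rightarrow> real^4 \<Rightarrow> real^4" where "T V \<equiv> cliff (\<Phi> V)"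
abbreviation L :: "real^5 \<Rightarrow> (real^4) set" where "L V \<equiv> line_of \<Phi> V"

lemma linear_\<Phi>: "linear \<Phi>"
  using isometry by (simp add: lie_plucker_isometry_def)

lemma complex_form_\<Phi>: "complex_form (\<Phi> V) (\<Phi> W) = lie_form V W"
proof -
  have Q: "complex_form (\<Phi> X) (\<Phi> X) = lie_form X X" for X
    using isometry by (simp add: lie_plucker_isometry_def complex_form_def power2_eq_square algebra_simps)
  have "complex_form (\<Phi> V + \<Phi> W) (\<Phi> V + \<Phi> W) = lie_form (V + W) (V + W)"
    using Q[of "V + W"] by (simp add: linear_add[OF linear_\<Phi>])
  moreover have "complex_form (X + Y) (X + Y) = complex_form X X + 2 * complex_form X Y + complex_form Y Y" for X Y
    by (simp add: complex_form_def algebra_simps)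
  moreover have "lie_form (X + Y) (X + Y) = lie_form X X + 2 * lie_form X Y + lie_form Y Y" for X Y
    by (simp add: lie_form_def field_simps)
  ultimately show ?thesis using Q[of V] Q[of W] by simp
qed

lemma T_anticommute: "T V (T W x) + T W (T V x) = lie_form V W *\<^sub>R x"
  by (simp add: cliff_anticommute complex_form_\<Phi>)

lemma lie_form_nondegenerate: assumes "\<And>W. lie_form V W = 0" shows "V = 0"
  using assms[of "axis 1 1"] assms[of "axis 2 1"] assms[of "axis 3 1"] assms[of "axis 4 1"] assms[of "axis 5 1"]
  by (auto simp: lie_form_def axis_def vec5_eq_iff)

lemma inj_\<Phi>: "inj \<Phi>"
proof (rule linear_injective_0[OF linear_\<Phi>, THEN iffD2], intro allI impI)
  fix V assume "\<Phi> V = 0"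
  then have "lie_form V W = 0" for W by (simp add: complex_form_def flip: complex_form_\<Phi>)
  then show "V = 0" by (rule lie_form_nondegenerate)
qed

lemma surj_\<Phi>: "surj \<Phi>"
  using linear_\<Phi> inj_\<Phi> linear_injective_imp_surjective by blast

lemma \<Phi>_eq_0_iff [simp]: "\<Phi> V = 0 \<longleftrightarrow> V = 0"
  using inj_\<Phi> linear_0[OF linear_\<Phi>] by (metis injD)

lemma same_circle_iff_\<Phi>: "same_circle V W \<longleftrightarrow> (\<exists>s. s \<noteq> 0 \<and> \<Phi> V = s *\<^sub>R \<Phi> W)"
  unfolding same_circle_def by (metis inj_\<Phi> injD linear_scale[OF linear_\<Phi>])

lemma oriented_circleD:
  assumes "oriented_circle V"
  shows "V \<noteq> 0" "lie_form V V = 0" "\<Phi> V \<noteq> 0" "complex_form (\<Phi> V) (\<Phi> V) = 0"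
  using assms by (auto simp: oriented_circle_def complex_form_\<Phi>)

lemma T_T: "oriented_circle V \<Longrightarrow> T V (T V x) = 0"
  using T_anticommute[of V V x] oriented_circleD(2)[of V] by (auto simp: vec4_eq_iff)

text \<open>Trades the union over spanning pairs for the kernel of one operator, so that membership
  becomes a computation.\<close>

lemma line_of_iff: assumes "oriented_circle V" shows "x \<in> L V \<longleftrightarrow> T V x = 0"
proof
  assume "x \<in> L V"
  then obtain \<alpha> \<beta> where "x \<in> span {\<alpha>, \<beta>}" and g: "plucker \<alpha> \<beta> 0 3 = plucker \<alpha> \<beta> 1 2" "complex_coords \<alpha> \<beta> = \<Phi> V"
    by (auto simp: line_of_def)
  then obtain s t where x: "x = s *\<^sub>R \<alpha> + t *\<^sub>R \<beta>" by (auto simp: span_pair_iff)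
  have "cliff (complex_coords \<alpha> \<beta>) \<alpha> = 0" "cliff (complex_coords \<alpha> \<beta>) \<beta> = 0"
    using cliff_complex_coords[of \<alpha> \<beta>] g(1) by (simp_all add: sympl_eq_plucker)
  then show "T V x = 0" by (simp add: x g(2))
next
  assume x: "T V x = 0"
  have "\<exists>z. T V z \<noteq> 0" using cliff_eq_0_imp oriented_circleD(3)[OF assms] by blast
  then obtain z where z: "T V z \<noteq> 0" by blast
  \<comment> \<open>A decomposition needs a nonzero kernel point; for \<open>x = 0\<close> an image
    point stands in.\<close>
  define x' where "x' = (if x = 0 then T V z else x)"
  have "T V x' = 0" "x' \<noteq> 0" using x z T_T[OF assms] by (auto simp: x'_def)
  then obtain \<beta> where \<beta>: "sympl x' \<beta> = 0" "complex_coords x' \<beta> = \<Phi> V"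
    using kernel_decomposable oriented_circleD(4)[OF assms] by metis
  have "x \<in> span {x', \<beta>}" by (auto simp: x'_def intro: span_base span_0)
  then show "x \<in> L V" using \<beta> unfolding line_of_def by (auto simp: sympl_eq_plucker)
qed

lemma line_basis:
  assumes "oriented_circle V"
  obtains \<alpha> \<beta> where "\<alpha> \<in> L V" "\<beta> \<in> L V" "sympl \<alpha> \<beta> = 0" "complex_coords \<alpha> \<beta> = \<Phi> V"
proof -
  obtain z where z: "T V z \<noteq> 0" using cliff_eq_0_imp oriented_circleD(3)[OF assms] by blast
  obtain \<beta> where "sympl (T V z) \<beta> = 0" "complex_coords (T V z) \<beta> = \<Phi> V"
    using kernel_decomposable[OF oriented_circleD(4)[OF assms] T_T[OF assms] z] .
  moreover have "T V (T V z) = 0" "T V \<beta> = 0"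
    using cliff_complex_coords(2)[OF calculation(1)] calculation(2) T_T[OF assms] by simp_all
  ultimately show ?thesis using that line_of_iff[OF assms] by blast
qed

text \<open>Isotropic planes in dimension four are Lagrangian. For the converse, self-adjointness
  moves \<open>T V\<close> across the form, and its image lies in the line.\<close>

lemma line_polar:
  assumes "oriented_circle V" shows "y \<in> L V \<longleftrightarrow> (\<forall>x\<in>L V. sympl x y = 0)"
proof
  assume y: "y \<in> L V"
  show "\<forall>x\<in>L V. sympl x y = 0"
  proof (cases "y = 0")
    case False
    obtain \<beta> where b: "sympl y \<beta> = 0" "complex_coords y \<beta> = \<Phi> V"
      using kernel_decomposable[OF oriented_circleD(4)[OF assms] _ False] y line_of_iff[OF assms] by auto
    show ?thesis
    proof
      fix x assume "x \<in> L V"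
      then have "cliff (complex_coords y \<beta>) x = 0" using b line_of_iff[OF assms] by simp
      moreover have "complex_coords y \<beta> \<noteq> 0" using b(2) assms oriented_circleD by simp
      ultimately have "sympl x y *\<^sub>R complex_coords y \<beta> = 0"
        using b(1) by (simp add: vec4_eq_iff vec5_eq_iff plucker_def sympl_def) algebra
      with \<open>complex_coords y \<beta> \<noteq> 0\<close> show "sympl x y = 0" by simp
    qed
  qed simp
next
  assume A: "\<forall>x\<in>L V. sympl x y = 0"
  have "sympl (T V y) z = 0" for z
    using A T_T[OF assms] line_of_iff[OF assms] by (metis sympl_cliff sympl_commute neg_equal_0_iff_equal)
  then show "y \<in> L V" using sympl_nondegenerate line_of_iff[OF assms] by blast
qed

lemma line_isotropic: "oriented_circle V \<Longrightarrow> x \<in> L V \<Longrightarrow> y \<in> L V \<Longrightarrow> sympl x y = 0"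
  using line_polar by blast

lemma line_combination: "oriented_circle V \<Longrightarrow> x \<in> L V \<Longrightarrow> y \<in> L V \<Longrightarrow> s *\<^sub>R x + t *\<^sub>R y \<in> L V"
  by (simp add: line_of_iff)

lemma line_scale: "oriented_circle V \<Longrightarrow> x \<in> L V \<Longrightarrow> s *\<^sub>R x \<in> L V"
  by (simp add: line_of_iff)

lemma complex_coords_on_line:
  assumes "oriented_circle V" "x \<in> L V" "y \<in> L V" shows "\<exists>k. complex_coords x y = k *\<^sub>R \<Phi> V"
proof (cases "x = 0")
  case True
  then show ?thesis by (intro exI[of _ 0]) (simp add: vec5_eq_iff plucker_def)
next
  case False
  obtain \<beta> where b: "sympl x \<beta> = 0" "complex_coords x \<beta> = \<Phi> V"
    using kernel_decomposable[OF oriented_circleD(4)[OF assms(1)] _ False] assms line_of_iff by metis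
  have K: "complex_coords x y $ i * complex_coords x \<beta> $ j = complex_coords x y $ j * complex_coords x \<beta> $ i" for i j
    using complex_coords_kernel[of x \<beta> y] b line_of_iff assms line_isotropic by metis
  obtain j where j: "\<Phi> V $ j \<noteq> 0" using oriented_circleD(3)[OF assms(1)] by (auto simp: vec_eq_iff)
  have "complex_coords x y = (complex_coords x y $ j / \<Phi> V $ j) *\<^sub>R \<Phi> V"
    using K[of _ j] j b(2) by (simp add: vec_eq_iff field_simps)
  then show ?thesis by blast
qed

lemma line_eq_span:
  assumes "oriented_circle V" "x \<in> L V" "y \<in> L V" "x \<noteq> 0" "\<nexists>t. y = t *\<^sub>R x"
  shows "L V = span {x, y}"
proof
  obtain k where k: "complex_coords x y = k *\<^sub>R \<Phi> V" using complex_coords_on_line[OF assms(1-3)] by blast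
  have "k \<noteq> 0" using complex_coords_eq_0_imp_parallel[of x y] k assms line_isotropic by auto
  show "L V \<subseteq> span {x, y}"
  proof
    fix z assume z: "z \<in> L V"
    obtain k' where k': "complex_coords x z = k' *\<^sub>R \<Phi> V" using complex_coords_on_line[OF assms(1,2) z] by blast
    have "complex_coords x (z - (k' / k) *\<^sub>R y) = 0" using \<open>k \<noteq> 0\<close> by (simp add: complex_coords_linear k k')
    moreover have "sympl x (z - (k' / k) *\<^sub>R y) = 0" using assms z line_isotropic by simp
    ultimately obtain t where "z - (k' / k) *\<^sub>R y = t *\<^sub>R x"
      using complex_coords_eq_0_imp_parallel assms(4) by blast
    then have "z = t *\<^sub>R x + (k' / k) *\<^sub>R y" by (simp add: diff_eq_eq)
    then show "z \<in> span {x, y}" by (auto simp: span_pair_iff)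
  qed
  show "span {x, y} \<subseteq> L V" using assms(1-3) by (auto simp: span_pair_iff line_combination)
qed

text \<open>The join of two independent common points would have coordinates proportional to both
  \<open>\<Phi> V\<close> and \<open>\<Phi> W\<close>.\<close>

lemma common_points_parallel:
  assumes "oriented_circle V" "oriented_circle W" "\<not> same_circle V W"
    "x \<in> L V" "x \<in> L W" "y \<in> L V" "y \<in> L W" "x \<noteq> 0"
  shows "\<exists>t. y = t *\<^sub>R x"
proof -
  obtain k where k: "complex_coords x y = k *\<^sub>R \<Phi> V" using complex_coords_on_line assms by blast
  obtain l where l: "complex_coords x y = l *\<^sub>R \<Phi> W" using complex_coords_on_line assms by blast
  have "k = 0"
  proof (rule ccontr)
    assume "k \<noteq> 0"
    then have "l \<noteq> 0" using k l oriented_circleD(3)[OF assms(1)] by auto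
    have "\<Phi> V = (l / k) *\<^sub>R \<Phi> W" using k l \<open>k \<noteq> 0\<close> by (metis divide_inverse_commute real_vector_affinity_eq scaleR_one scaleR_scaleR left_inverse)
    then have "same_circle V W" unfolding same_circle_iff_\<Phi>
      using \<open>k \<noteq> 0\<close> \<open>l \<noteq> 0\<close> by (intro exI[of _ "l / k"]) simp
    then show False using assms(3) by blast
  qed
  then show ?thesis using k complex_coords_eq_0_imp_parallel line_isotropic assms by simp
qed

lemma same_circle_imp_line_eq:
  assumes "same_circle V W" shows "L V = L W"
proof -
  have half: "L V \<subseteq> L W" if "\<Phi> V = s *\<^sub>R \<Phi> W" "s \<noteq> 0" for V W s
  proof
    fix x assume "x \<in> L V"
    then obtain \<alpha> \<beta> where x: "x \<in> span {\<alpha>, \<beta>}" and g: "plucker \<alpha> \<beta> 0 3 = plucker \<alpha> \<beta> 1 2" "complex_coords \<alpha> \<beta> = \<Phi> V"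
      by (auto simp: line_of_def)
    from x obtain a b where ab: "x = a *\<^sub>R \<alpha> + b *\<^sub>R \<beta>" by (auto simp: span_pair_iff)
    have "x = a *\<^sub>R \<alpha> + (b * s) *\<^sub>R ((1 / s) *\<^sub>R \<beta>)" using that(2) ab by simp
    then have "x \<in> span {\<alpha>, (1 / s) *\<^sub>R \<beta>}" by (auto simp only: span_pair_iff)
    moreover have "complex_coords \<alpha> ((1 / s) *\<^sub>R \<beta>) = \<Phi> W" using g(2) that by (simp add: complex_coords_linear)
    moreover have "plucker \<alpha> ((1 / s) *\<^sub>R \<beta>) 0 3 = plucker \<alpha> ((1 / s) *\<^sub>R \<beta>) 1 2"
      using g(1) by (simp add: plucker_scale)
    ultimately show "x \<in> L W" unfolding line_of_def by blast
  qed
  obtain s where s: "s \<noteq> 0" "\<Phi> V = s *\<^sub>R \<Phi> W" using assms by (auto simp: same_circle_iff_\<Phi>)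
  then have "\<Phi> W = (1 / s) *\<^sub>R \<Phi> V" by simp
  then show ?thesis using half[OF s(2,1)] half[of W "1 / s" V] s(1) by auto
qed

lemma line_eq_imp_same_circle:
  assumes "oriented_circle V" "oriented_circle W" "L V = L W" shows "same_circle V W"
proof (rule ccontr)
  assume "\<not> same_circle V W"
  obtain \<alpha> \<beta> where ab: "\<alpha> \<in> L V" "\<beta> \<in> L V" "complex_coords \<alpha> \<beta> = \<Phi> V" by (rule line_basis[OF assms(1)])
  have "\<alpha> \<noteq> 0" using ab(3) oriented_circleD(3)[OF assms(1)] by (auto simp: vec5_eq_iff plucker_def)
  with common_points_parallel[OF assms(1,2) \<open>\<not> same_circle V W\<close>] ab assms(3) obtain t where "\<beta> = t *\<^sub>R \<alpha>" by blast
  then have "\<Phi> V = 0" using ab(3) by (auto simp: vec5_eq_iff plucker_def)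
  then show False using oriented_circleD(3)[OF assms(1)] by simp
qed

text \<open>Contact makes the two operators anticommute, so every \<open>T V (T W z)\<close> lies in
  both kernels. If all these values vanish, the image of \<open>T W\<close> already lies in the
  kernel of \<open>T V\<close>.\<close>

lemma contact_imp_common_point:
  assumes "oriented_circle V" "oriented_circle W" "contact V W"
  obtains x where "x \<noteq> 0" "x \<in> L V" "x \<in> L W"
proof (cases "\<exists>z. T V (T W z) \<noteq> 0")
  case True
  then obtain z where z: "T V (T W z) \<noteq> 0" by blast
  have "T V (T W z) = - T W (T V z)"
    using T_anticommute[of V W z] assms(3) by (simp add: contact_def eq_neg_iff_add_eq_0)
  then have "T W (T V (T W z)) = 0" using T_T[OF assms(2)] by simp
  then show ?thesis using that[of "T V (T W z)"] z T_T[OF assms(1)] assms line_of_iff by blast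
next
  case False
  obtain z where "T W z \<noteq> 0" using cliff_eq_0_imp oriented_circleD(3)[OF assms(2)] by blast
  then show ?thesis using that[of "T W z"] False T_T[OF assms(2)] assms line_of_iff by blast
qed

lemma common_point_imp_contact:
  assumes "oriented_circle V" "oriented_circle W" "x \<noteq> 0" "x \<in> L V" "x \<in> L W"
  shows "contact V W"
  using T_anticommute[of V W x] assms by (simp add: line_of_iff contact_def)

lemma meets_inD: "meets_in A B p \<Longrightarrow> p \<noteq> 0 \<and> p \<in> A \<and> p \<in> B"
  using span_base[of p "{p}"] by (auto simp: meets_in_def)

lemma meets_inI:
  assumes "oriented_circle V" "oriented_circle W" "\<not> same_circle V W" "p \<in> L V" "p \<in> L W" "p \<noteq> 0"
  shows "meets_in (L V) (L W) p"
  unfolding meets_in_def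
proof (intro conjI equalityI subsetI)
  fix x assume "x \<in> L V \<inter> L W"
  then show "x \<in> span {p}" using common_points_parallel[OF assms(1-5) _ _ assms(6)] by (auto simp: span_singleton)
next
  fix x assume "x \<in> span {p}"
  then show "x \<in> L V \<inter> L W" using assms by (auto simp: span_singleton line_of_iff)
qed fact

end

section \<open>Reflection and geodesic circles\<close>

lemma reflect_nth [simp]:
  "reflect V $ 1 = V $ 1" "reflect V $ 2 = - (V $ 2)" "reflect V $ 3 = V $ 3"
  "reflect V $ 4 = V $ 4" "reflect V $ 5 = V $ 5"
  by (simp_all add: reflect_def)

lemma lie_form_reflect: "lie_form (reflect V) (reflect W) = lie_form V W"
  by (simp add: lie_form_def)

lemma lie_form_commute: "lie_form V W = lie_form W V"
  by (simp add: lie_form_def)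

lemma contact_commute: "contact V W \<longleftrightarrow> contact W V"
  by (simp add: contact_def lie_form_commute)

lemma oriented_circle_reflect [simp]: "oriented_circle (reflect V) \<longleftrightarrow> oriented_circle V"
  by (auto simp: oriented_circle_def lie_form_reflect vec5_eq_iff)

lemma contact_reflect_geodesic: "geodesic_circle G \<Longrightarrow> contact G (reflect V) \<longleftrightarrow> contact G V"
  by (simp add: geodesic_circle_def contact_def lie_form_def)

lemma lie_form_scale: "lie_form (s *\<^sub>R V) W = s * lie_form V W" "lie_form W (s *\<^sub>R V) = s * lie_form W V"
  by (simp_all add: lie_form_def algebra_simps)

lemma contact_same_circle: "same_circle V V' \<Longrightarrow> contact W V \<longleftrightarrow> contact W V'"
  by (auto simp: same_circle_def contact_def lie_form_scale)

lemma same_circle_refl [simp]: "same_circle V V"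
  by (auto simp: same_circle_def intro: exI[of _ 1])

lemma same_circle_sym: "same_circle V W \<Longrightarrow> same_circle W V"
  unfolding same_circle_def by (metis divide_self_if inverse_eq_divide inverse_zero nonzero_imp_inverse_nonzero scaleR_one scaleR_scaleR left_inverse)

lemma same_circle_trans: "same_circle U V \<Longrightarrow> same_circle V W \<Longrightarrow> same_circle U W"
  unfolding same_circle_def by (metis mult_eq_0_iff scaleR_scaleR)

text \<open>The proportionality factor would be -1, which kills all coordinates but the second; such
  a vector is not isotropic.\<close>

lemma not_same_circle_reflect:
  assumes "oriented_circle V" "V $ 2 \<noteq> 0" shows "\<not> same_circle (reflect V) V"
proof
  assume "same_circle (reflect V) V"
  then obtain s where s: "s \<noteq> 0" "reflect V = s *\<^sub>R V" by (auto simp: same_circle_def)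
  then have "- V $ 2 = s * V $ 2" "V $ 1 = s * V $ 1" "V $ 3 = s * V $ 3" "V $ 4 = s * V $ 4" "V $ 5 = s * V $ 5"
    by (auto simp: vec5_eq_iff)
  then have "s = -1" using assms(2) by (metis minus_mult_left mult_1 mult_cancel_right)
  then have "V $ 1 = 0" "V $ 3 = 0" "V $ 4 = 0" "V $ 5 = 0"
    using \<open>V $ 1 = s * V $ 1\<close> \<open>V $ 3 = s * V $ 3\<close> \<open>V $ 4 = s * V $ 4\<close> \<open>V $ 5 = s * V $ 5\<close> by auto
  then show False using assms by (simp add: oriented_circle_def lie_form_def)
qed

context lie_plucker
begin

text \<open>
  \<open>mirror\<close> is the involution of the point space which induces the reflection of circles. A geodesic
  circle corresponds to a line spanned by one point of either eigenspace, and a circle which is not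
  geodesic to the graph of a linear map between the eigenspaces.
\<close>

definition mirror :: "real^4 \<Rightarrow> real^4" where
  "mirror x = sqrt 2 *\<^sub>R T (axis 2 1) x"

lemma lie_form_axis: "lie_form (axis 2 1) V = V $ 2" "lie_form V (axis 2 1) = V $ 2"
  by (simp_all add: lie_form_def axis_def)

lemma mirror_linear [simp]:
  "mirror (x + y) = mirror x + mirror y" "mirror (x - y) = mirror x - mirror y"
  "mirror (r *\<^sub>R x) = r *\<^sub>R mirror x" "mirror (- x) = - mirror x" "mirror 0 = 0"
  by (simp_all add: mirror_def algebra_simps)

text \<open>The second unit vector has Lie norm 1, so its operator squares to 1/2; this is the
  origin of the factor \<open>sqrt 2\<close>.\<close>

lemma mirror_mirror [simp]: "mirror (mirror x) = x"
proof -
  have "2 *\<^sub>R T (axis 2 1) (T (axis 2 1) x) = x"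
    using T_anticommute[of "axis 2 1" "axis 2 1" x] by (simp add: lie_form_axis scaleR_2)
  then show ?thesis by (simp add: mirror_def)
qed

lemma sympl_mirror: "sympl (mirror x) y = sympl x (mirror y)"
  by (simp add: mirror_def sympl_cliff)

lemma T_mirror: "T V (mirror x) = (sqrt 2 * V $ 2) *\<^sub>R x - mirror (T V x)"
proof -
  have "T V (T (axis 2 1) x) = V $ 2 *\<^sub>R x - T (axis 2 1) (T V x)"
    using T_anticommute[of V "axis 2 1" x] by (simp add: lie_form_axis eq_diff_eq)
  then show ?thesis by (simp add: mirror_def scaleR_diff_right)
qed

lemma T_reflect: "T (reflect V) x = T V x - (sqrt 2 * V $ 2) *\<^sub>R mirror x"
proof -
  have "reflect V = V - (2 * V $ 2) *\<^sub>R axis 2 1" by (simp add: vec5_eq_iff axis_def)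
  then have "\<Phi> (reflect V) = \<Phi> V - (2 * V $ 2) *\<^sub>R \<Phi> (axis 2 1)"
    by (simp add: linear_diff[OF linear_\<Phi>] linear_scale[OF linear_\<Phi>])
  then have "T (reflect V) x = T V x - (2 * V $ 2) *\<^sub>R T (axis 2 1) x" by simp
  then show ?thesis by (simp add: mirror_def mult.commute mult.left_commute)
qed

text \<open>Reflection of circles is conjugation of their operators by \<open>mirror\<close>, up to
  sign.\<close>

lemma line_reflect: assumes "oriented_circle V" shows "x \<in> L (reflect V) \<longleftrightarrow> mirror x \<in> L V"
proof -
  have "T (reflect V) x = - mirror (T V (mirror x))"
    by (simp add: T_reflect T_mirror algebra_simps)
  then show ?thesis using assms by (simp add: line_of_iff) (metis mirror_linear(5) mirror_mirror)
qed

lemma mirror_geodesic: "geodesic_circle V \<Longrightarrow> x \<in> L V \<Longrightarrow> mirror x \<in> L V"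
  by (simp add: geodesic_circle_def line_of_iff T_mirror)

lemma sympl_eigenspaces: "mirror p = p \<Longrightarrow> mirror q = - q \<Longrightarrow> sympl p q = 0"
  using sympl_mirror[of p q] by simp

text \<open>By \<open>T_mirror\<close>, the multiple \<open>sqrt 2 * V $ 2\<close> of an eigenvector
  in the kernel is 0. A circle which is not geodesic thus misses both eigenspaces, which makes it a
  graph over either of them.\<close>

lemma eigenvector_not_on_circle:
  assumes "oriented_circle V" "V $ 2 \<noteq> 0" "x \<in> L V" "mirror x = \<tau> *\<^sub>R x" shows "x = 0"
  using assms T_mirror[of V x] by (simp add: line_of_iff)

text \<open>If the projection to an eigenspace vanished on the line, its image would be polar to the
  line, hence contained in it, and the projection would vanish everywhere. Then
  \<open>mirror\<close> is a scalar which anticommutes with \<open>T V\<close>, and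
  \<open>T V\<close> would be zero.\<close>

lemma geodesic_eigenvector:
  assumes V: "geodesic_circle V" and \<tau>: "\<tau> = 1 \<or> \<tau> = -1"
  obtains p where "p \<noteq> 0" "p \<in> L V" "mirror p = \<tau> *\<^sub>R p"
proof -
  have o: "oriented_circle V" using V by (simp add: geodesic_circle_def)
  have eig: "mirror (x + \<tau> *\<^sub>R mirror x) = \<tau> *\<^sub>R (x + \<tau> *\<^sub>R mirror x)" for x using \<tau> by auto
  have "\<exists>x\<in>L V. x + \<tau> *\<^sub>R mirror x \<noteq> 0"
  proof (rule ccontr)
    assume "\<not> ?thesis"
    then have neg: "x + \<tau> *\<^sub>R mirror x = 0" if "x \<in> L V" for x using that by blast
    have zero: "y + \<tau> *\<^sub>R mirror y = 0" for y
    proof -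
      let ?y = "y + \<tau> *\<^sub>R mirror y"
      have "sympl x ?y = 0" if "x \<in> L V" for x
        using neg[OF that] by (metis sympl_linear(2,6,9) sympl_linear(1,5) sympl_mirror)
      then have "?y \<in> L V" using line_polar[OF o] by blast
      from neg[OF this] have "?y + ?y = 0" using \<tau> by (auto simp: add.commute)
      then show ?thesis by (metis scaleR_2 scaleR_eq_0_iff zero_neq_numeral)
    qed
    have "T V y = 0" for y
    proof -
      have "mirror z = - \<tau> *\<^sub>R z" for z
        using zero[of z] \<tau> by (auto simp: add_eq_0_iff)
      then have "T V (- \<tau> *\<^sub>R y) = - (- \<tau> *\<^sub>R T V y)"
        using T_mirror[of V y] V by (simp add: geodesic_circle_def)
      then show ?thesis using \<tau> by (auto simp: vec4_eq_iff simp del: cliff_nth)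
    qed
    then show False using cliff_eq_0_imp oriented_circleD(3)[OF o] by blast
  qed
  then obtain x where x: "x \<in> L V" "x + \<tau> *\<^sub>R mirror x \<noteq> 0" by blast
  have "x + \<tau> *\<^sub>R mirror x \<in> L V"
    using line_combination[OF o x(1) mirror_geodesic[OF V x(1)], of 1 \<tau>] by simp
  then show ?thesis using that x eig by blast
qed

lemma eigenvectors_not_parallel:
  assumes "mirror p = p" "mirror q = - q" "q \<noteq> 0" shows "\<nexists>t. q = t *\<^sub>R p"
  using assms by (metis mirror_linear(3) scaleR_minus1_left add_eq_0_iff scaleR_2 scaleR_eq_0_iff zero_neq_numeral)

lemma geodesic_line_eq:
  assumes V: "geodesic_circle V" and "p \<in> L V" "q \<in> L V" "p \<noteq> 0" "q \<noteq> 0" "mirror p = p" "mirror q = - q"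
  shows "L V = span {p, q}"
  using line_eq_span[of V p q] eigenvectors_not_parallel[of p q] assms by (simp add: geodesic_circle_def)

end

section \<open>Sites\<close>

lemma site_eq_iff: "m = n \<longleftrightarrow> m $ 1 = n $ 1 \<and> m $ 2 = n $ 2 \<and> m $ 3 = n $ 3" for m n :: "'a^3"
  by (auto simp: vec_eq_iff forall_3)

lemma unit_step_nth [simp]:
  "unit_step 1 $ 1 = 1" "unit_step 1 $ 2 = 0" "unit_step 1 $ 3 = 0"
  "unit_step 2 $ 1 = 0" "unit_step 2 $ 2 = 1" "unit_step 2 $ 3 = 0"
  "unit_step 3 $ 1 = 0" "unit_step 3 $ 2 = 0" "unit_step 3 $ 3 = 1"
  by (simp_all add: unit_step_def axis_def)

lemma exists_3: "(\<exists>i::3. P i) \<longleftrightarrow> P 1 \<or> P 2 \<or> P 3"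
  by (metis exhaust_3)

lemma adjacent_iff: "adjacent m n \<longleftrightarrow> \<bar>n $ 1 - m $ 1\<bar> + \<bar>n $ 2 - m $ 2\<bar> + \<bar>n $ 3 - m $ 3\<bar> = 1"
proof -
  have *: "\<bar>x\<bar> + \<bar>y\<bar> + \<bar>z\<bar> = 1 \<longleftrightarrow> (x = 1 \<and> y = 0 \<and> z = 0) \<or> (x = -1 \<and> y = 0 \<and> z = 0) \<or>
    (x = 0 \<and> y = 1 \<and> z = 0) \<or> (x = 0 \<and> y = -1 \<and> z = 0) \<or> (x = 0 \<and> y = 0 \<and> z = 1) \<or> (x = 0 \<and> y = 0 \<and> z = -1)"
    for x y z :: int
  proof
    assume s: "\<bar>x\<bar> + \<bar>y\<bar> + \<bar>z\<bar> = 1"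
    then have "x = -1 \<or> x = 0 \<or> x = 1" "y = -1 \<or> y = 0 \<or> y = 1" "z = -1 \<or> z = 0 \<or> z = 1" by linarith+
    with s show "(x = 1 \<and> y = 0 \<and> z = 0) \<or> (x = -1 \<and> y = 0 \<and> z = 0) \<or>
      (x = 0 \<and> y = 1 \<and> z = 0) \<or> (x = 0 \<and> y = -1 \<and> z = 0) \<or> (x = 0 \<and> y = 0 \<and> z = 1) \<or> (x = 0 \<and> y = 0 \<and> z = -1)"
      by (elim disjE) simp_all
  qed auto
  show ?thesis unfolding adjacent_def exists_3 site_eq_iff *
    by (rule iffI; elim disjE conjE; simp)
qed

lemma adjacent_commute: "adjacent m n \<longleftrightarrow> adjacent n m"
  by (auto simp: adjacent_def)

text \<open>Opposite corners of a lattice face, in a form accessible to linear arithmetic.\<close>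

definition diagonal :: "site \<Rightarrow> site \<Rightarrow> bool" where
  "diagonal m n \<longleftrightarrow> \<bar>n $ 1 - m $ 1\<bar> \<le> 1 \<and> \<bar>n $ 2 - m $ 2\<bar> \<le> 1 \<and> \<bar>n $ 3 - m $ 3\<bar> \<le> 1 \<and>
     \<bar>n $ 1 - m $ 1\<bar> + \<bar>n $ 2 - m $ 2\<bar> + \<bar>n $ 3 - m $ 3\<bar> = 2"

lemma adjacent_parity: "adjacent m n \<Longrightarrow> even_site n \<longleftrightarrow> \<not> even_site m"
  unfolding adjacent_def even_site_def exists_3 by auto

definition sign_edges :: "int \<Rightarrow> int \<Rightarrow> int \<Rightarrow> 3 \<Rightarrow> site" where
  "sign_edges r s t k = (if k = 1 then r *s unit_step 1 else if k = 2 then s *s unit_step 2 else t *s unit_step 3)"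

lemma sign_edges_simps [simp]:
  "sign_edges r s t 1 = r *s unit_step 1" "sign_edges r s t 2 = s *s unit_step 2"
  "sign_edges r s t 3 = t *s unit_step 3"
  by (simp_all add: sign_edges_def)

lemma cube_edges_sign_edges:
  "\<bar>r\<bar> = 1 \<Longrightarrow> \<bar>s\<bar> = 1 \<Longrightarrow> \<bar>t\<bar> = 1 \<Longrightarrow> cube_edges (sign_edges r s t)"
  by (auto simp: cube_edges_def forall_3 abs_if site_eq_iff split: if_splits)

lemma cube_edgesE:
  assumes "cube_edges a"
  obtains r s t where "\<bar>r\<bar> = 1" "\<bar>s\<bar> = 1" "\<bar>t\<bar> = 1" "a = sign_edges r s t"
proof -
  have *: "\<exists>r. \<bar>r\<bar> = 1 \<and> a k = r *s unit_step k" for k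
  proof (cases "a k = unit_step k")
    case True then show ?thesis by (intro exI[of _ 1]) auto
  next
    case False
    then have "a k = - unit_step k" using assms by (auto simp: cube_edges_def)
    then show ?thesis by (intro exI[of _ "-1"]) (auto simp: vec_eq_iff)
  qed
  obtain r s t where "\<bar>r\<bar> = 1" "a 1 = r *s unit_step 1" "\<bar>s\<bar> = 1" "a 2 = s *s unit_step 2"
    "\<bar>t\<bar> = 1" "a 3 = t *s unit_step 3" using *[of 1] *[of 2] *[of 3] by blast
  moreover from this have "a k = sign_edges r s t k" for k using exhaust_3[of k] by auto
  ultimately show ?thesis using that[of r s t] by blast
qed

lemma diagonalE:
  assumes "diagonal m n"
  obtains a j k where "cube_edges a" "j \<noteq> k" "n = m + a j + a k"
proof -
  define d where "d i = n $ i - m $ i" for i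
  have d: "\<bar>d 1\<bar> \<le> 1" "\<bar>d 2\<bar> \<le> 1" "\<bar>d 3\<bar> \<le> 1" "\<bar>d 1\<bar> + \<bar>d 2\<bar> + \<bar>d 3\<bar> = 2"
    using assms by (simp_all add: diagonal_def d_def)
  then consider "\<bar>d 1\<bar> = 1" "\<bar>d 2\<bar> = 1" "d 3 = 0" | "\<bar>d 2\<bar> = 1" "\<bar>d 3\<bar> = 1" "d 1 = 0"
    | "\<bar>d 1\<bar> = 1" "\<bar>d 3\<bar> = 1" "d 2 = 0" by linarith
  moreover have n: "n $ i = m $ i + d i" for i by (simp add: d_def)
  ultimately show ?thesis
  proof cases
    case 1 show ?thesis
      by (rule that[OF cube_edges_sign_edges[of "d 1" "d 2" 1], of 1 2]) (use 1 in \<open>simp_all add: site_eq_iff n\<close>)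
  next
    case 2 show ?thesis
      by (rule that[OF cube_edges_sign_edges[of 1 "d 2" "d 3"], of 2 3]) (use 2 in \<open>simp_all add: site_eq_iff n\<close>)
  next
    case 3 show ?thesis
      by (rule that[OF cube_edges_sign_edges[of "d 1" 1 "d 3"], of 1 3]) (use 3 in \<open>simp_all add: site_eq_iff n\<close>)
  qed
qed

lemma combine_simps [simp]:
  "even_site n \<Longrightarrow> combine g c n = g n" "\<not> even_site n \<Longrightarrow> combine g c n = c n"
  by (simp_all add: combine_def)

lemma diagonal_parity: "diagonal m n \<Longrightarrow> even_site n \<longleftrightarrow> even_site m"
proof -
  assume "diagonal m n"
  then have "even (\<bar>n $ 1 - m $ 1\<bar> + \<bar>n $ 2 - m $ 2\<bar> + \<bar>n $ 3 - m $ 3\<bar>)" by (simp add: diagonal_def)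
  then show "even_site n \<longleftrightarrow> even_site m" by (simp add: even_site_def) blast
qed

lemma generic_diagonal: "generic V \<Longrightarrow> diagonal m n \<Longrightarrow> \<not> contact (V m) (V n)"
  by (erule diagonalE) (auto simp: generic_def)

lemma generic_antipodal:
  assumes "generic V" "\<bar>n $ 1 - m $ 1\<bar> = 1" "\<bar>n $ 2 - m $ 2\<bar> = 1" "\<bar>n $ 3 - m $ 3\<bar> = 1"
  shows "\<not> contact (V m) (V n)"
proof -
  have "opposite_site m (sign_edges (n $ 1 - m $ 1) (n $ 2 - m $ 2) (n $ 3 - m $ 3)) = n"
    by (simp add: opposite_site_def site_eq_iff)
  then show ?thesis using assms cube_edges_sign_edges unfolding generic_def by metis
qed

section \<open>Generic geodesic-circle complexes in the eigenspaces of the reflection\<close>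

text \<open>
  What an elementary cube amounts to in the eigenspaces: \<open>p k\<close>, \<open>q k\<close> belong to its geodesic
  circles, \<open>m i k *\<^sub>R p k + q k\<close> is the common point of the \<open>i\<close>-th circle and the \<open>k\<close>-th geodesic
  circle, and equal indices denote opposite vertices.
\<close>

definition tetra :: "(nat \<Rightarrow> nat \<Rightarrow> real) \<Rightarrow> (nat \<Rightarrow> real^4) \<Rightarrow> (nat \<Rightarrow> real^4) \<Rightarrow> bool" where
  "tetra m p q \<longleftrightarrow>
     (\<forall>i\<in>{..<4}. \<forall>k\<in>{..<4}. sympl (p i) (q k) = 0 \<and>
        (i \<noteq> k \<longrightarrow> m i k \<noteq> 0 \<and> sympl (p i) (p k) \<noteq> 0 \<and>
           (\<forall>l\<in>{..<4}. l \<noteq> i \<and> l \<noteq> k \<longrightarrow>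
              m i k * m i l * sympl (p k) (p l) = - sympl (q k) (q l) \<and> (m i k)\<^sup>2 \<noteq> (m l k)\<^sup>2)))"

definition circle_vertex :: "site \<Rightarrow> (3 \<Rightarrow> site) \<Rightarrow> nat \<Rightarrow> site" where
  "circle_vertex v a i =
     (if i = 0 then v else if i = 1 then v + a 2 + a 3 else if i = 2 then v + a 3 + a 1 else v + a 1 + a 2)"

definition geodesic_vertex :: "site \<Rightarrow> (3 \<Rightarrow> site) \<Rightarrow> nat \<Rightarrow> site" where
  "geodesic_vertex v a k =
     (if k = 0 then v + a 1 + a 2 + a 3 else if k = 1 then v + a 1 else if k = 2 then v + a 2 else v + a 3)"

lemma less_4_cases: "i \<in> {..<4} \<longleftrightarrow> i = 0 \<or> i = 1 \<or> i = 2 \<or> i = (3 :: nat)"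
  by auto

lemma cube_vertices:
  assumes "cube_edges a" "\<not> even_site v" "i \<in> {..<4}" "k \<in> {..<4}" "i \<noteq> k"
  shows "\<not> even_site (circle_vertex v a i)" "even_site (geodesic_vertex v a k)"
    "adjacent (circle_vertex v a i) (geodesic_vertex v a k)"
    "diagonal (circle_vertex v a i) (circle_vertex v a k)"
    "diagonal (geodesic_vertex v a i) (geodesic_vertex v a k)"
proof -
  obtain r s t where a: "\<bar>r\<bar> = 1" "\<bar>s\<bar> = 1" "\<bar>t\<bar> = 1" "a = sign_edges r s t"
    using cube_edgesE assms(1) by blast
  show adj: "adjacent (circle_vertex v a i) (geodesic_vertex v a k)"
    using assms(3-5) a(1-3) unfolding less_4_cases
    by (elim disjE) (simp_all add: a(4) adjacent_iff circle_vertex_def geodesic_vertex_def)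
  show dc: "diagonal (circle_vertex v a i) (circle_vertex v a k)"
    using assms(3-5) a(1-3) unfolding less_4_cases
    by (elim disjE) (simp_all add: a(4) diagonal_def circle_vertex_def)
  show "diagonal (geodesic_vertex v a i) (geodesic_vertex v a k)"
    using assms(3-5) a(1-3) unfolding less_4_cases
    by (elim disjE) (simp_all add: a(4) diagonal_def geodesic_vertex_def)
  have "\<not> even_site (circle_vertex v a j)" if "j \<in> {..<4}" for j
  proof (cases "j = 0")
    case False
    then have "diagonal (circle_vertex v a 0) (circle_vertex v a j)"
      using that a(1-3) unfolding less_4_cases
      by (elim disjE) (simp_all add: a(4) diagonal_def circle_vertex_def)
    then show ?thesis using diagonal_parity assms(2) by (auto simp: circle_vertex_def)
  qed (simp add: circle_vertex_def assms(2))
  then show "\<not> even_site (circle_vertex v a i)" using assms(3) by blast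
  then show "even_site (geodesic_vertex v a k)" using adjacent_parity[OF adj] by blast
qed

context lie_plucker
begin

lemma touching_point:
  assumes C: "oriented_circle C" and G: "geodesic_circle G" and ct: "contact G C"
    and pq: "p \<in> L G" "q \<in> L G" "p \<noteq> 0" "q \<noteq> 0" "mirror p = p" "mirror q = - q"
  obtains s t where "s *\<^sub>R p + t *\<^sub>R q \<in> L C" "s *\<^sub>R p + t *\<^sub>R q \<noteq> 0"
proof -
  have "oriented_circle G" using G by (simp add: geodesic_circle_def)
  then obtain x where "x \<noteq> 0" "x \<in> L G" "x \<in> L C" using contact_imp_common_point C ct by metis
  then show ?thesis using that geodesic_line_eq[OF G pq] by (auto simp: span_pair_iff)
qed

text \<open>Neither coefficient of the touching point vanishes, because a circle which is not
  geodesic contains no eigenvector; dividing by that of \<open>q\<close> gives the slope later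
  called \<open>\<mu>\<close>.\<close>

lemma touching_coefficient:
  assumes C: "oriented_circle C" "C $ 2 \<noteq> 0" and G: "geodesic_circle G" and ct: "contact G C"
    and pq: "p \<in> L G" "q \<in> L G" "p \<noteq> 0" "q \<noteq> 0" "mirror p = p" "mirror q = - q"
  shows "\<exists>s. s \<noteq> 0 \<and> s *\<^sub>R p + q \<in> L C"
proof -
  obtain s t where st: "s *\<^sub>R p + t *\<^sub>R q \<in> L C" "s *\<^sub>R p + t *\<^sub>R q \<noteq> 0"
    using touching_point[OF C(1) G ct pq] .
  have "t \<noteq> 0" using st eigenvector_not_on_circle[OF C, of "s *\<^sub>R p" 1] pq by auto
  have "s \<noteq> 0" using st eigenvector_not_on_circle[OF C, of "t *\<^sub>R q" "-1"] pq by auto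
  moreover have "(s / t) *\<^sub>R p + q \<in> L C"
    using line_scale[OF C(1) st(1), of "1 / t"] \<open>t \<noteq> 0\<close> by (simp add: algebra_simps)
  ultimately show ?thesis using \<open>t \<noteq> 0\<close> by (metis divide_eq_0_iff)
qed

end

lemma adjacentE:
  assumes "adjacent m n" obtains r j where "\<bar>r\<bar> = 1" "n = m + r *s unit_step j"
proof -
  obtain k where "n = m + unit_step k \<or> n = m - unit_step k"
    using assms unfolding adjacent_def by (metis add_diff_cancel_right')
  then have "n = m + 1 *s unit_step k \<or> n = m + (-1) *s unit_step k" by (simp add: vec_eq_iff)
  then show ?thesis using that[of 1 k] that[of "-1" k] by auto
qed

text \<open>Two vertices adjacent to \<open>n\<close> span a face with \<open>n\<close>; the conclusion also supplies a fifth vertex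
  of a cube containing that face.\<close>

lemma face_completion:
  assumes "adjacent n v" "adjacent n v'" "diagonal v v'"
  obtains n'' where "adjacent v n''" "adjacent v' n''" "diagonal n n''"
    and "\<And>V. generic V \<Longrightarrow> \<exists>m. adjacent v' m \<and> \<not> contact (V v) (V m)"
proof -
  obtain r j where v: "\<bar>r\<bar> = 1" "v = n + r *s unit_step j" using assms(1) adjacentE by blast
  obtain s k where v': "\<bar>s\<bar> = 1" "v' = n + s *s unit_step k" using assms(2) adjacentE by blast
  have jk: "j \<noteq> k"
  proof
    assume "j = k"
    have "\<bar>r - s\<bar> = 0 \<or> \<bar>r - s\<bar> = 2" using v(1) v'(1) by (auto simp: abs_if split: if_splits)
    with \<open>j = k\<close> show False using assms(3) exhaust_3[of k] by (auto simp: diagonal_def v v' abs_minus_commute)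
  qed
  have "\<exists>l. l \<noteq> j \<and> l \<noteq> k" unfolding exists_3 using exhaust_3[of j] exhaust_3[of k] by (elim disjE) simp_all
  then obtain l where l: "l \<noteq> j" "l \<noteq> k" by blast
  show ?thesis
  proof (rule that[of "n + r *s unit_step j + s *s unit_step k"])
    show "adjacent v (n + r *s unit_step j + s *s unit_step k)"
      using exhaust_3[of k] v' by (auto simp: adjacent_iff v)
    show "adjacent v' (n + r *s unit_step j + s *s unit_step k)"
      using exhaust_3[of j] v by (auto simp: adjacent_iff v')
    show "diagonal n (n + r *s unit_step j + s *s unit_step k)"
      using exhaust_3[of j] exhaust_3[of k] jk v(1) v'(1) by (auto simp: diagonal_def)
  next
    fix V assume V: "generic V"
    \<comment> \<open>A step along the third axis leads to the vertex antipodal to \<open>v\<close>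
      in a cube through the face.\<close>
    let ?m = "v' + unit_step l"
    have "adjacent v' ?m" by (auto simp: adjacent_def)
    moreover have "\<not> contact (V v) (V ?m)"
      by (rule generic_antipodal[OF V]; use exhaust_3[of j] exhaust_3[of k] exhaust_3[of l] jk l v(1) v'(1) in \<open>auto simp: v v'\<close>)
    ultimately show "\<exists>m. adjacent v' m \<and> \<not> contact (V v) (V m)" by blast
  qed
qed

text \<open>The vectors are fixed once, and genericity is asked of the geodesic circles only: the
  frame then survives every change of the circles, and the slopes of different choices can be
  compared.\<close>

locale spinor_frame = lie_plucker +
  fixes g c :: "site \<Rightarrow> real^5" and p q :: "site \<Rightarrow> real^4"
  assumes complex: "geodesic_circle_complex g c"
    and generic_g: "\<And>m n. even_site m \<Longrightarrow> diagonal m n \<Longrightarrow> \<not> contact (g m) (g n)"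
    and frame: "\<And>n. even_site n \<Longrightarrow> p n \<in> L (g n) \<and> q n \<in> L (g n) \<and> p n \<noteq> 0 \<and> q n \<noteq> 0 \<and>
      mirror (p n) = p n \<and> mirror (q n) = - q n"
begin

lemma geodesic_g: "even_site n \<Longrightarrow> geodesic_circle (g n)"
  and oriented_g: "even_site n \<Longrightarrow> oriented_circle (g n)"
  and oriented_c: "\<not> even_site v \<Longrightarrow> oriented_circle (c v)"
  using complex by (auto simp: geodesic_circle_complex_def geodesic_circle_def)

lemma contact_gc: "\<not> even_site v \<Longrightarrow> adjacent v n \<Longrightarrow> contact (g n) (c v)"
  using complex adjacent_parity[of v n] by (auto simp: geodesic_circle_complex_def adjacent_commute)

lemma line_g: "even_site n \<Longrightarrow> L (g n) = span {p n, q n}"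
  using geodesic_line_eq geodesic_g frame by blast

lemma sympl_pq [simp]: "even_site m \<Longrightarrow> even_site n \<Longrightarrow> sympl (p m) (q n) = 0"
  and sympl_qp [simp]: "even_site m \<Longrightarrow> even_site n \<Longrightarrow> sympl (q m) (p n) = 0"
  using frame sympl_eigenspaces sympl_commute by (metis minus_zero)+

lemma sympl_p_ne: "even_site m \<Longrightarrow> diagonal m n \<Longrightarrow> sympl (p m) (p n) \<noteq> 0"
  and sympl_q_ne: "even_site m \<Longrightarrow> diagonal m n \<Longrightarrow> sympl (q m) (q n) \<noteq> 0"
proof -
  assume m: "even_site m" and mn: "diagonal m n"
  have n: "even_site n" using diagonal_parity mn m by blast
  have nc: "\<not> contact (g m) (g n)" using generic_g m mn .
  have no: "x \<notin> L (g m)" if "x \<in> L (g n)" "x \<noteq> 0" for x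
    using common_point_imp_contact[OF oriented_g[OF m] oriented_g[OF n] that(2)] that nc by blast
  show "sympl (p m) (p n) \<noteq> 0"
  proof
    assume "sympl (p m) (p n) = 0"
    then have "p n \<in> L (g m)" unfolding line_polar[OF oriented_g[OF m]]
      using m n by (auto simp: line_g[OF m] span_pair_iff)
    then show False using no frame[OF n] by blast
  qed
  show "sympl (q m) (q n) \<noteq> 0"
  proof
    assume "sympl (q m) (q n) = 0"
    then have "q n \<in> L (g m)" unfolding line_polar[OF oriented_g[OF m]]
      using m n by (auto simp: line_g[OF m] span_pair_iff)
    then show False using no frame[OF n] by blast
  qed
qed

text \<open>A touching point is a combination of \<open>p\<close> and \<open>q\<close>; applying
  \<open>mirror\<close> shows that a geodesic \<open>C\<close> contains the \<open>p\<close> or the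
  \<open>q\<close> of each of the three circles. Two of the three are of the same kind, and isotropy
  of \<open>C\<close> contradicts genericity.\<close>

lemma touching_not_geodesic:
  assumes C: "oriented_circle C"
    and n: "even_site (n 1)" "even_site (n 2)" "even_site (n 3)"
    and dg: "diagonal (n 1) (n 2)" "diagonal (n 1) (n 3)" "diagonal (n 2) (n (3 :: 3))"
    and ct: "\<And>k. contact (g (n k)) C"
  shows "C $ 2 \<noteq> 0"
proof
  assume "C $ 2 = 0"
  then have gc: "geodesic_circle C" using C by (simp add: geodesic_circle_def)
  have ev: "even_site (n k)" for k using n exhaust_3[of k] by auto
  have pq: "p (n k) \<in> L C \<or> q (n k) \<in> L C" for k
  proof -
    obtain s t where st: "s *\<^sub>R p (n k) + t *\<^sub>R q (n k) \<in> L C" "s *\<^sub>R p (n k) + t *\<^sub>R q (n k) \<noteq> 0"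
      using touching_point[OF C geodesic_g[OF ev] ct] frame[OF ev] by metis
    have "s *\<^sub>R p (n k) - t *\<^sub>R q (n k) \<in> L C" using mirror_geodesic[OF gc st(1)] frame[OF ev] by simp
    from line_combination[OF C st(1) this, of 1 1] line_combination[OF C st(1) this, of 1 "-1"]
    have sp: "(2 * s) *\<^sub>R p (n k) \<in> L C" "(2 * t) *\<^sub>R q (n k) \<in> L C" by (simp_all add: algebra_simps flip: scaleR_2)
    show ?thesis
    proof (cases "s = 0")
      case False
      then show ?thesis using line_scale[OF C sp(1), of "1 / (2 * s)"] by simp
    next
      case True
      then have "t \<noteq> 0" using st(2) by auto
      then show ?thesis using line_scale[OF C sp(2), of "1 / (2 * t)"] by simp
    qed
  qed
  have "\<not> (p (n j) \<in> L C \<and> p (n k) \<in> L C)" "\<not> (q (n j) \<in> L C \<and> q (n k) \<in> L C)"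
    if "diagonal (n j) (n k)" for j k
    using that sympl_p_ne sympl_q_ne ev line_isotropic[OF C] by blast+
  then show False using pq dg by metis
qed

lemma c_not_geodesic: assumes v: "\<not> even_site v" shows "c v $ 2 \<noteq> 0"
proof -
  define n where "n k = v + unit_step k" for k
  have adj: "adjacent v (n k)" for k by (auto simp: adjacent_def n_def)
  have ev: "even_site (n k)" for k using adjacent_parity adj v by blast
  show ?thesis
    by (rule touching_not_geodesic[OF oriented_c[OF v], of n])
      (use ev contact_gc[OF v adj] in \<open>simp_all add: n_def diagonal_def\<close>)
qed

definition \<mu> :: "site \<Rightarrow> site \<Rightarrow> real" where
  "\<mu> v n = (THE s. s *\<^sub>R p n + q n \<in> L (c v))"

definition X :: "site \<Rightarrow> site \<Rightarrow> real^4" where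
  "X v n = \<mu> v n *\<^sub>R p n + q n"

lemma p_notin_circle: assumes "\<not> even_site v" "even_site n" "s *\<^sub>R p n \<in> L (c v)" shows "s = 0"
  using eigenvector_not_on_circle[OF oriented_c c_not_geodesic, of v "s *\<^sub>R p n" 1] assms frame[of n] by simp

lemma \<mu>_unique:
  assumes v: "\<not> even_site v" and n: "even_site n" and s: "s *\<^sub>R p n + q n \<in> L (c v)"
  shows "\<mu> v n = s"
  unfolding \<mu>_def
proof (rule the_equality)
  show "s *\<^sub>R p n + q n \<in> L (c v)" by (rule s)
next
  fix s' assume "s' *\<^sub>R p n + q n \<in> L (c v)"
  from line_combination[OF oriented_c[OF v] this s, of 1 "-1"] have "(s' - s) *\<^sub>R p n \<in> L (c v)"
    by (simp add: algebra_simps)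
  then show "s' = s" using p_notin_circle v n by fastforce
qed

lemma
  assumes v: "\<not> even_site v" and vn: "adjacent v n"
  shows X_on_circle: "X v n \<in> L (c v)" and \<mu>_nonzero: "\<mu> v n \<noteq> 0"
proof -
  have n: "even_site n" using adjacent_parity vn v by blast
  obtain s where s: "s \<noteq> 0" "s *\<^sub>R p n + q n \<in> L (c v)"
    using touching_coefficient[OF oriented_c[OF v] c_not_geodesic[OF v] geodesic_g[OF n] contact_gc[OF v vn]] frame[OF n] by blast
  have "\<mu> v n = s" by (rule \<mu>_unique[OF v n s(2)])
  then show "X v n \<in> L (c v)" "\<mu> v n \<noteq> 0" using s by (simp_all add: X_def)
qed

lemma X_on_geodesic: "even_site n \<Longrightarrow> X v n \<in> L (g n)"
  unfolding line_g span_pair_iff X_def by (metis scaleR_one)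

lemma X_nonzero: "even_site n \<Longrightarrow> X v n \<noteq> 0"
  using eigenvectors_not_parallel[of "p n" "q n"] frame[of n] unfolding X_def
  by (metis add_eq_0_iff scaleR_minus_left)

lemma c_g_not_same: assumes "\<not> even_site v" "even_site n" shows "\<not> same_circle (c v) (g n)"
  using c_not_geodesic[OF assms(1)] geodesic_g[OF assms(2)] by (auto simp: same_circle_def geodesic_circle_def)

lemma meets_X:
  assumes "\<not> even_site v" "adjacent v n"
  shows "meets_in (L (c v)) (L (g n)) (X v n)" "meets_in (L (g n)) (L (c v)) (X v n)"
proof -
  have n: "even_site n" using adjacent_parity assms by blast
  show "meets_in (L (c v)) (L (g n)) (X v n)"
    by (rule meets_inI[OF oriented_c[OF assms(1)] oriented_g[OF n] c_g_not_same[OF assms(1) n]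
          X_on_circle[OF assms] X_on_geodesic[OF n] X_nonzero[OF n]])
  then show "meets_in (L (g n)) (L (c v)) (X v n)" by (simp add: meets_in_def Int_commute)
qed

text \<open>Isotropy of the line of \<open>c v\<close>, split along the eigenspaces. The product
  relations on faces and cubes come from it.\<close>

lemma \<mu>_\<mu>:
  assumes v: "\<not> even_site v" and "adjacent v n" "adjacent v n'"
  shows "\<mu> v n * \<mu> v n' * sympl (p n) (p n') = - sympl (q n) (q n')"
proof -
  have "even_site n" "even_site n'" using adjacent_parity assms by blast+
  then show ?thesis
    using line_isotropic[OF oriented_c[OF v] X_on_circle[OF v assms(2)] X_on_circle[OF v assms(3)]]
    by (simp add: X_def algebra_simps eq_neg_iff_add_eq_0)
qed

lemma X_not_parallel:
  assumes v: "\<not> even_site v" and "adjacent v n" "adjacent v n'" "diagonal n n'"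
  shows "\<nexists>t. X v n' = t *\<^sub>R X v n"
proof
  have n: "even_site n" "even_site n'" using adjacent_parity assms by blast+
  assume "\<exists>t. X v n' = t *\<^sub>R X v n"
  moreover have "sympl (p n) (X v n) = 0" using n by (simp add: X_def)
  ultimately have "sympl (p n) (X v n') = 0" by auto
  then show False using n assms sympl_p_ne[OF n(1) assms(4)] \<mu>_nonzero by (auto simp: X_def)
qed

lemma line_c:
  assumes "\<not> even_site v" "adjacent v n" "adjacent v n'" "diagonal n n'"
  shows "L (c v) = span {X v n, X v n'}"
proof -
  have "even_site n" using adjacent_parity assms by blast
  then show ?thesis
    by (intro line_eq_span oriented_c X_on_circle X_nonzero X_not_parallel) (use assms in auto)
qed

lemma line_reflect_c:
  assumes v: "\<not> even_site v" and "adjacent v n" "adjacent v n'" "diagonal n n'"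
    and c': "oriented_circle C" "- \<mu> v n *\<^sub>R p n + q n \<in> L C" "- \<mu> v n' *\<^sub>R p n' + q n' \<in> L C"
  shows "same_circle C (reflect (c v))"
proof (rule ccontr)
  have n: "even_site n" "even_site n'" using adjacent_parity assms by blast+
  assume "\<not> same_circle C (reflect (c v))"
  moreover have "- \<mu> v m *\<^sub>R p m + q m \<in> L (reflect (c v))" if "adjacent v m" for m
  proof -
    have m: "even_site m" using adjacent_parity v that by blast
    have "mirror (- \<mu> v m *\<^sub>R p m + q m) = - 1 *\<^sub>R X v m" using frame[OF m] by (simp add: X_def)
    then show ?thesis using line_scale[OF oriented_c[OF v] X_on_circle[OF v that], of "-1"]
      by (simp add: line_reflect[OF oriented_c[OF v]])
  qed
  moreover have "- \<mu> v n *\<^sub>R p n + q n \<noteq> 0"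
    using eigenvectors_not_parallel[of "p n" "q n"] frame[OF n(1)] by (metis add_eq_0_iff scaleR_minus_left)
  ultimately obtain t where "- \<mu> v n' *\<^sub>R p n' + q n' = t *\<^sub>R (- \<mu> v n *\<^sub>R p n + q n)"
    using common_points_parallel[OF c'(1) _ _ c'(2) _ c'(3), of "reflect (c v)"] oriented_c[OF v] assms(2,3) by auto
  then have "sympl (p n) (- \<mu> v n' *\<^sub>R p n' + q n') = 0" using n by simp
  then show False using n assms sympl_p_ne[OF n(1) assms(4)] \<mu>_nonzero by auto
qed

end

locale generic_frame = spinor_frame +
  assumes generic: "generic (combine g c)"
begin

text \<open>Equal slopes give the two circles a common point. Opposite slopes at \<open>n\<close>
  give opposite slopes at the fourth corner of the face, so \<open>c v'\<close> is the reflection of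
  \<open>c v\<close>; then \<open>c v\<close> touches every geodesic circle next to
  \<open>v'\<close>, one of which is antipodal to \<open>v\<close> in a cube.\<close>

lemma \<mu>_square_ne:
  assumes v: "\<not> even_site v" and nv: "adjacent n v" "adjacent n v'" "diagonal v v'"
  shows "(\<mu> v n)\<^sup>2 \<noteq> (\<mu> v' n)\<^sup>2"
proof
  have v': "\<not> even_site v'" and n: "even_site n" using adjacent_parity diagonal_parity assms by blast+
  have vn: "adjacent v n" "adjacent v' n" using nv adjacent_commute by blast+
  assume "(\<mu> v n)\<^sup>2 = (\<mu> v' n)\<^sup>2"
  then consider "\<mu> v n = \<mu> v' n" | "\<mu> v' n = - \<mu> v n" by (auto simp: power2_eq_iff)
  then show False
  proof cases
    case 1
    then have "X v n \<in> L (c v')" using X_on_circle[OF v' vn(2)] by (simp add: X_def)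
    then have "contact (c v) (c v')"
      using common_point_imp_contact oriented_c v v' X_nonzero n X_on_circle[OF v vn(1)] by blast
    then show False using generic_diagonal[OF generic nv(3)] v v' by simp
  next
    case 2
    obtain n'' where n'': "adjacent v n''" "adjacent v' n''" "diagonal n n''"
      and m: "\<And>V. generic V \<Longrightarrow> \<exists>m. adjacent v' m \<and> \<not> contact (V v) (V m)"
      using face_completion[OF nv] by metis
    have "\<mu> v n * \<mu> v n'' * sympl (p n) (p n'') = \<mu> v' n * \<mu> v' n'' * sympl (p n) (p n'')"
      using \<mu>_\<mu> v v' vn n'' by metis
    then have "(\<mu> v n * \<mu> v n'') * sympl (p n) (p n'') = (\<mu> v n * - \<mu> v' n'') * sympl (p n) (p n'')"
      using 2 by simp
    then have "\<mu> v n * \<mu> v n'' = \<mu> v n * - \<mu> v' n''"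
      by (simp only: mult_right_cancel[OF sympl_p_ne[OF n n''(3)]])
    then have "\<mu> v n'' = - \<mu> v' n''" using \<mu>_nonzero[OF v vn(1)] by (metis mult_left_cancel)
    then have "same_circle (c v') (reflect (c v))"
      using line_reflect_c[OF v vn(1) n''(1,3) oriented_c[OF v']] 2
        X_on_circle[OF v' vn(2)] X_on_circle[OF v' n''(2)] by (simp add: X_def)
    moreover obtain m where m: "adjacent v' m" "\<not> contact (combine g c v) (combine g c m)" using m[OF generic] by blast
    moreover have "even_site m" using adjacent_parity v' m by blast
    ultimately show False
      using contact_gc[OF v' m(1)] contact_same_circle contact_reflect_geodesic[OF geodesic_g] v contact_commute
      by (metis combine_simps)
  qed
qed

lemma tetra_cube:
  assumes v: "\<not> even_site v" and a: "cube_edges a"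
  shows "tetra (\<lambda>i k. \<mu> (circle_vertex v a i) (geodesic_vertex v a k))
    (\<lambda>k. p (geodesic_vertex v a k)) (\<lambda>k. q (geodesic_vertex v a k))"
proof -
  note V = cube_vertices[OF a v]
  have ev: "even_site (geodesic_vertex v a k)" "\<not> even_site (circle_vertex v a k)" if "k \<in> {..<4}" for k
    using V(2)[of "if k = 0 then 1 else 0" k] V(1)[of k "if k = 0 then 1 else 0"] that by auto
  show ?thesis unfolding tetra_def
    by (intro ballI conjI impI; (elim conjE)?;
      (rule sympl_pq | rule \<mu>_nonzero | rule sympl_p_ne | rule \<mu>_\<mu> | rule \<mu>_square_ne)?;
      (simp_all add: ev V adjacent_commute[of "geodesic_vertex v a _"])?)
qed

end

lemma (in lie_plucker) generic_frame_exists: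
  assumes "geodesic_circle_complex g c" "generic (combine g c)"
  obtains p q where "generic_frame \<Phi> g c p q"
proof -
  have "\<exists>p q. p \<in> L (g n) \<and> q \<in> L (g n) \<and> p \<noteq> 0 \<and> q \<noteq> 0 \<and> mirror p = p \<and> mirror q = - q" if "even_site n" for n
  proof -
    have G: "geodesic_circle (g n)" using assms(1) that by (simp add: geodesic_circle_complex_def)
    obtain p where "p \<noteq> 0" "p \<in> L (g n)" "mirror p = 1 *\<^sub>R p" using geodesic_eigenvector[OF G, of 1] by blast
    moreover obtain q where "q \<noteq> 0" "q \<in> L (g n)" "mirror q = (-1) *\<^sub>R q" using geodesic_eigenvector[OF G, of "-1"] by blast
    ultimately show ?thesis by auto
  qed
  then obtain p q where "\<And>n. even_site n \<Longrightarrow> p n \<in> L (g n) \<and> q n \<in> L (g n) \<and> p n \<noteq> 0 \<and> q n \<noteq> 0 \<and>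
      mirror (p n) = p n \<and> mirror (q n) = - q n" by metis
  moreover have "\<not> contact (g m) (g n)" if "even_site m" "diagonal m n" for m n
    using generic_diagonal[OF assms(2) that(2)] diagonal_parity that by simp
  ultimately have "generic_frame \<Phi> g c p q" by unfold_locales (use assms in auto)
  then show ?thesis by (rule that)
qed

section \<open>Correlations\<close>

lemma add_diff_6:
  "i + 1 - 1 = i" "i - 1 + 1 = i" "i + 2 - 1 = i + 1" "i - 1 + 2 = i + 1" "i + 3 - 1 = i + 2" "i + 3 + 3 = i"
  for i :: 6
  by (simp_all add: algebra_simps)

lemma hyperplane_eq_imp_parallel:
  fixes u v :: "'a::euclidean_space"
  assumes "{y. y \<bullet> u = 0} = {y. y \<bullet> v = 0}" "v \<noteq> 0"
  obtains t where "t \<noteq> 0" "u = t *\<^sub>R v"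
proof -
  define t where "t = (u \<bullet> v) / (v \<bullet> v)"
  have vv: "v \<bullet> v \<noteq> 0" using assms(2) by simp
  have "u - t *\<^sub>R v \<in> {y. y \<bullet> v = 0}" using vv by (simp add: t_def inner_diff_left)
  then have "(u - t *\<^sub>R v) \<bullet> u = 0" "(u - t *\<^sub>R v) \<bullet> v = 0" using assms(1) by auto
  then have "(u - t *\<^sub>R v) \<bullet> (u - t *\<^sub>R v) = 0" by (simp add: inner_diff_right)
  then have u: "u = t *\<^sub>R v" by simp
  have "t \<noteq> 0"
  proof
    assume "t = 0"
    then have "v \<in> {y. y \<bullet> u = 0}" using u by simp
    then show False using assms(1) vv by simp
  qed
  then show ?thesis using that u by blast
qed

context lie_plucker
begin

text \<open>\<open>x i\<close> is the vertex where the edges \<open>H (i - 1)\<close> and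
  \<open>H i\<close> meet. General position is encoded as skewness of edges two apart.\<close>

definition hexagon :: "(6 \<Rightarrow> real^5) \<Rightarrow> (6 \<Rightarrow> real^4) \<Rightarrow> bool" where
  "hexagon H x \<longleftrightarrow> (\<forall>i. oriented_circle (H i) \<and> \<not> contact (H i) (H (i + 2)) \<and>
     meets_in (L (H (i - 1))) (L (H i)) (x i))"

lemma hexagonD:
  assumes "hexagon H x"
  shows "oriented_circle (H i)" "\<not> contact (H i) (H (i + 2))"
    "x i \<noteq> 0" "x i \<in> L (H i)" "x (i + 1) \<in> L (H i)"
proof -
  have h: "oriented_circle (H j) \<and> \<not> contact (H j) (H (j + 2)) \<and> meets_in (L (H (j - 1))) (L (H j)) (x j)" for j
    using assms by (simp add: hexagon_def)
  show "oriented_circle (H i)" "\<not> contact (H i) (H (i + 2))" "x i \<noteq> 0" "x i \<in> L (H i)"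
    using h[of i] meets_inD by blast+
  show "x (i + 1) \<in> L (H i)" using h[of "i + 1"] meets_inD by (metis add_diff_6(1))
qed

lemma hexagon_consecutive: "hexagon H x \<Longrightarrow> sympl (x i) (x (i + 1)) = 0"
  using hexagonD[of H x i] line_isotropic by blast

lemma hexagon_edge:
  assumes h: "hexagon H x" shows "L (H i) = span {x i, x (i + 1)}"
proof (rule line_eq_span)
  show "oriented_circle (H i)" "x i \<in> L (H i)" "x (i + 1) \<in> L (H i)" "x i \<noteq> 0"
    using hexagonD[OF h] by blast+
  show "\<nexists>t. x (i + 1) = t *\<^sub>R x i"
  proof
    assume "\<exists>t. x (i + 1) = t *\<^sub>R x i"
    then obtain t where "x (i + 1) = t *\<^sub>R x i" by blast
    moreover have "x i \<in> L (H (i - 1))" using hexagonD(5)[OF h, of "i - 1"] by (simp add: add_diff_6)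
    ultimately have "x (i + 1) \<in> L (H (i - 1))" using line_scale hexagonD(1)[OF h] by metis
    moreover have "x (i + 1) \<in> L (H (i + 1))" using hexagonD(4)[OF h] .
    ultimately have "contact (H (i - 1)) (H (i - 1 + 2))"
      using common_point_imp_contact hexagonD[OF h] by (metis add_diff_6(4))
    then show False using hexagonD(2)[OF h] by blast
  qed
qed

text \<open>Otherwise \<open>x (i + 1)\<close> is polar to both ends of the edge
  \<open>H (i - 1)\<close>, hence lies on it, and this edge meets \<open>H (i + 1)\<close>.\<close>

lemma hexagon_second:
  assumes h: "hexagon H x" shows "sympl (x (i - 1)) (x (i + 1)) \<noteq> 0"
proof
  assume "sympl (x (i - 1)) (x (i + 1)) = 0"
  moreover have "sympl (x i) (x (i + 1)) = 0" by (rule hexagon_consecutive[OF h])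
  moreover have "L (H (i - 1)) = span {x (i - 1), x i}" using hexagon_edge[OF h, of "i - 1"] by (simp add: add_diff_6)
  ultimately have "x (i + 1) \<in> L (H (i - 1))"
    unfolding line_polar[OF hexagonD(1)[OF h]] by (auto simp: span_pair_iff)
  then have "contact (H (i - 1)) (H (i - 1 + 2))"
    using common_point_imp_contact hexagonD[OF h] by (metis add_diff_6(4))
  then show False using hexagonD(2)[OF h] by blast
qed

text \<open>Both edges at \<open>x i\<close> are isotropic, so the plane of the hexagon at a vertex
  is the null plane of that vertex. This reduces a correlation to a map between points.\<close>

lemma hexagon_plane:
  assumes h: "hexagon H x"
  shows "span {x (i - 1), x i, x (i + 1)} = {y. sympl (x i) y = 0}"
proof
  have "sympl (x i) (x (i - 1)) = 0"
    using hexagon_consecutive[OF h, of "i - 1"] by (simp add: add_diff_6 sympl_commute[of "x i"])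
  moreover have "sympl (x i) (x (i + 1)) = 0" by (rule hexagon_consecutive[OF h])
  ultimately show "span {x (i - 1), x i, x (i + 1)} \<subseteq> {y. sympl (x i) y = 0}"
    by (intro span_minimal) (auto simp: subspace_def)
next
  let ?u = "x (i - 1)" and ?v = "x i" and ?w = "x (i + 1)"
  show "{y. sympl ?v y = 0} \<subseteq> span {?u, ?v, ?w}"
  proof
    fix y assume "y \<in> {y. sympl ?v y = 0}"
    then have y: "sympl ?v y = 0" by simp
    \<comment> \<open>These remove the components along the two neighbours: the remainder
      \<open>y'\<close> is polar to both edges at \<open>x i\<close>, hence a multiple of
      \<open>x i\<close>.\<close>
    define s t where "s = sympl ?u y / sympl ?u ?w" and "t = sympl ?w y / sympl ?u ?w"
    have uw: "sympl ?u ?w \<noteq> 0" by (rule hexagon_second[OF h])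
    define y' where "y' = y - s *\<^sub>R ?w + t *\<^sub>R ?u"
    have vu: "sympl ?v ?u = 0" "sympl ?v ?w = 0"
      using hexagon_consecutive[OF h, of "i - 1"] hexagon_consecutive[OF h, of i]
      by (simp_all add: add_diff_6 sympl_commute[of "x i"])
    have y': "sympl ?u y' = 0" "sympl ?v y' = 0" "sympl ?w y' = 0"
      using uw y vu by (simp_all add: y'_def s_def t_def sympl_commute[of ?w ?u])
    have "y' \<in> L (H (i - 1))" "y' \<in> L (H i)"
      unfolding line_polar[OF hexagonD(1)[OF h]]
      using y' hexagon_edge[OF h, of "i - 1"] hexagon_edge[OF h, of i] by (auto simp: span_pair_iff add_diff_6)
    then have "y' \<in> span {?v}" using h by (auto simp: hexagon_def meets_in_def)
    then obtain r where "y' = r *\<^sub>R ?v" by (auto simp: span_singleton)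
    then have "y = s *\<^sub>R ?w - t *\<^sub>R ?u + r *\<^sub>R ?v" by (simp add: y'_def algebra_simps)
    also have "\<dots> \<in> span {?u, ?v, ?w}"
      by (intro span_add span_diff span_scale span_base) auto
    finally show "y \<in> span {?u, ?v, ?w}" .
  qed
qed

text \<open>On four consecutive vertices the Pfaffian reduces, up to sign, to a product of two
  values from \<open>hexagon_second\<close>.\<close>

lemma hexagon_spanning:
  assumes h: "hexagon H x" and d: "\<And>i. d \<bullet> x i = 0" shows "d = 0"
proof (rule ccontr)
  assume "d \<noteq> 0"
  from pfaffian_eq_0_if_orthogonal[OF this] have "pfaffian (x 1) (x (1 + 1)) (x (2 + 1)) (x (3 + 1)) = 0" using d by blast
  then have "sympl (x 1) (x 3) * sympl (x 2) (x 4) = 0"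
    using hexagon_consecutive[OF h, of 1] hexagon_consecutive[OF h, of 2] hexagon_consecutive[OF h, of 3]
    unfolding pfaffian_def by simp
  then show False using hexagon_second[OF h, of 2] hexagon_second[OF h, of 3] by simp
qed

text \<open>With \<open>hexagon_plane\<close>, equality of planes becomes proportionality of
  normals: \<open>B\<close> maps each vertex to the null plane of the opposite one.\<close>

lemma associated_correlation_iff:
  assumes h: "hexagon H x"
  shows "associated_correlation x B \<longleftrightarrow> transpose B = B \<and> invertible B \<and>
    (\<forall>i. \<exists>t. t \<noteq> 0 \<and> B *v x i = t *\<^sub>R sympl_dual (x (i + 3)))"
proof -
  have "polar_plane B (x i) = span {x (i + 3 - 1), x (i + 3), x (i + 3 + 1)} \<longleftrightarrow>
    (\<exists>t. t \<noteq> 0 \<and> B *v x i = t *\<^sub>R sympl_dual (x (i + 3)))" for i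
  proof -
    have "polar_plane B (x i) = span {x (i + 3 - 1), x (i + 3), x (i + 3 + 1)} \<longleftrightarrow>
      {y. y \<bullet> (B *v x i) = 0} = {y. y \<bullet> sympl_dual (x (i + 3)) = 0}"
      unfolding hexagon_plane[OF h, of "i + 3"] polar_plane_def by (simp add: inner_sympl_dual)
    also have "\<dots> \<longleftrightarrow> (\<exists>t. t \<noteq> 0 \<and> B *v x i = t *\<^sub>R sympl_dual (x (i + 3)))"
    proof
      assume "{y. y \<bullet> (B *v x i) = 0} = {y. y \<bullet> sympl_dual (x (i + 3)) = 0}"
      from hyperplane_eq_imp_parallel[OF this] show "\<exists>t. t \<noteq> 0 \<and> B *v x i = t *\<^sub>R sympl_dual (x (i + 3))"
        using hexagonD(3)[OF h] by (metis sympl_dual_eq_0_iff)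
    next
      assume "\<exists>t. t \<noteq> 0 \<and> B *v x i = t *\<^sub>R sympl_dual (x (i + 3))"
      then obtain t where "t \<noteq> 0" "B *v x i = t *\<^sub>R sympl_dual (x (i + 3))" by blast
      then show "{y. y \<bullet> (B *v x i) = 0} = {y. y \<bullet> sympl_dual (x (i + 3)) = 0}" by simp
    qed
    finally show ?thesis .
  qed
  then show ?thesis unfolding associated_correlation_def by blast
qed

lemma symmetric_matrix_inner:
  fixes B :: "real^'n^'n" shows "transpose B = B \<Longrightarrow> x \<bullet> (B *v y) = y \<bullet> (B *v x)"
  by (metis dot_lmul_matrix inner_commute transpose_matrix_vector)

text \<open>On each vertex \<open>B'\<close> is a multiple of \<open>B\<close>. By symmetry the
  factors at neighbouring vertices agree, as \<open>B\<close> pairs these nontrivially, and the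
  vertices span the space.\<close>

lemma associated_correlation_unique:
  assumes h: "hexagon H x" and B: "associated_correlation x B" and h': "hexagon H x'" and B': "associated_correlation x' B'"
  obtains t where "t \<noteq> 0" "\<And>y. B' *v y = t *\<^sub>R (B *v y)"
proof -
  have "\<exists>k. k \<noteq> 0 \<and> x' i = k *\<^sub>R x i" for i
  proof -
    have "span {x i} = span {x' i}" using h h' by (auto simp: hexagon_def meets_in_def)
    then have "x' i \<in> span {x i}" using span_base[of "x' i" "{x' i}"] by blast
    then show ?thesis using hexagonD(3)[OF h', of i] by (auto simp: span_singleton)
  qed
  then obtain k where k: "\<And>i. k i \<noteq> 0" "\<And>i. x' i = k i *\<^sub>R x i" by metis
  obtain b where b: "\<And>i. b i \<noteq> 0" "\<And>i. B *v x i = b i *\<^sub>R sympl_dual (x (i + 3))"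
    using B unfolding associated_correlation_iff[OF h] by metis
  obtain b' where b': "\<And>i. b' i \<noteq> 0" "\<And>i. B' *v x' i = b' i *\<^sub>R sympl_dual (x' (i + 3))"
    using B' unfolding associated_correlation_iff[OF h'] by metis
  define r where "r i = b' i * k (i + 3) / (k i * b i)" for i
  have r: "r i \<noteq> 0" "B' *v x i = r i *\<^sub>R (B *v x i)" for i
  proof -
    show "r i \<noteq> 0" using k b b' by (simp add: r_def)
    have "k i *\<^sub>R (B' *v x i) = (b' i * k (i + 3)) *\<^sub>R sympl_dual (x (i + 3))"
      using b'(2)[of i] by (simp add: k(2) matrix_vector_mult_scaleR)
    then have "(1 / k i) *\<^sub>R (k i *\<^sub>R (B' *v x i)) = r i *\<^sub>R (B *v x i)"
      using b(1)[of i] k(1)[of i] by (simp add: b(2) r_def)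
    then show "B' *v x i = r i *\<^sub>R (B *v x i)" using k(1)[of i] by simp
  qed
  have sym: "transpose B = B" "transpose B' = B'" using B B' by (auto simp: associated_correlation_def)
  have step: "r (i + 1) = r i" for i
  proof -
    have "r i * (x (i + 1) \<bullet> (B *v x i)) = x (i + 1) \<bullet> (B' *v x i)" by (simp add: r)
    also have "\<dots> = r (i + 1) * (x i \<bullet> (B *v x (i + 1)))"
      by (subst symmetric_matrix_inner[OF sym(2)]) (simp add: r)
    also have "\<dots> = r (i + 1) * (x (i + 1) \<bullet> (B *v x i))" using symmetric_matrix_inner[OF sym(1)] by metis
    finally have "r i * (x (i + 1) \<bullet> (B *v x i)) = r (i + 1) * (x (i + 1) \<bullet> (B *v x i))" .
    moreover have "x (i + 1) \<bullet> (B *v x i) \<noteq> 0"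
    proof -
      have "sympl (x (i + 2 - 1)) (x (i + 2 + 1)) \<noteq> 0" by (rule hexagon_second[OF h])
      then have "sympl (x (i + 3)) (x (i + 1)) \<noteq> 0"
        by (simp add: add_diff_6 add.assoc sympl_commute[of "x (i + 3)"])
      then show ?thesis using b(1) by (simp add: b(2) inner_sympl_dual)
    qed
    ultimately show ?thesis by simp
  qed
  have "r 2 = r 1" "r 3 = r 2" "r 4 = r 3" "r 5 = r 4" "r 6 = r 5"
    using step[of 1] step[of 2] step[of 3] step[of 4] step[of 5] by simp_all
  then have "r i = r 1" for i using exhaust_6[of i] by metis
  then obtain \<rho> where const: "\<And>i. r i = \<rho>" by blast
  have "B' *v y = \<rho> *\<^sub>R (B *v y)" for y
  proof -
    have "(B' *v y - \<rho> *\<^sub>R (B *v y)) \<bullet> x i = 0" for i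
    proof -
      have "x i \<bullet> (B' *v y) = \<rho> * (x i \<bullet> (B *v y))"
        using symmetric_matrix_inner[OF sym(1), of "x i" y] symmetric_matrix_inner[OF sym(2), of "x i" y]
        by (simp add: r const)
      then show ?thesis by (simp add: inner_diff_left inner_diff_right inner_commute[of _ "x i"])
    qed
    from hexagon_spanning[OF h this] show ?thesis by simp
  qed
  then show ?thesis using that r(1) const by metis
qed

lemma correlated_unique:
  assumes H: "hexagon H x0" and V: "oriented_circle V" "oriented_circle V'"
    and c: "correlated \<Phi> V W H" "correlated \<Phi> V' W H"
  shows "same_circle V V'"
proof -
  have hex: "hexagon H x" if "\<And>i. meets_in (L (H (i - 1))) (L (H i)) (x i)" for x
    using H that by (auto simp: hexagon_def)
  obtain x B where x: "hexagon H x" "associated_correlation x B" "image_line B (L W) = L V"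
    using c(1) hex unfolding correlated_def by blast
  obtain x' B' where x': "hexagon H x'" "associated_correlation x' B'" "image_line B' (L W) = L V'"
    using c(2) hex unfolding correlated_def by blast
  obtain t where "t \<noteq> 0" "\<And>y. B' *v y = t *\<^sub>R (B *v y)"
    using associated_correlation_unique[OF x(1,2) x'(1,2)] by blast
  then have "image_line B' (L W) = image_line B (L W)" by (simp add: image_line_def polar_plane_def)
  then show ?thesis using line_eq_imp_same_circle V x(3) x'(3) by simp
qed

text \<open>A symmetric correlation composed with the null polarity of the complex is a linear map which
  is self-adjoint in the sense of the third assumption.\<close>

lemma correlatedI:
  assumes H: "hexagon H x" and f: "linear f" "\<And>y z. sympl (f y) z = sympl (f z) y"
    "\<And>y. f (f y) = \<kappa> *\<^sub>R y" "\<kappa> \<noteq> 0"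
    and fx: "\<And>i. \<exists>t. t \<noteq> 0 \<and> f (x i) = t *\<^sub>R x (i + 3)"
    and V: "oriented_circle V" "oriented_circle W" "\<And>y. y \<in> L V \<Longrightarrow> f y \<in> L W" "\<And>y. y \<in> L W \<Longrightarrow> f y \<in> L V"
  shows "correlated \<Phi> V W H"
proof -
  have lin: "linear (\<lambda>y. sympl_dual (f y))"
    using f(1) by (auto intro!: linearI simp: linear_add linear_scale)
  define B where "B = matrix (\<lambda>y. sympl_dual (f y))"
  have B: "B *v y = sympl_dual (f y)" for y unfolding B_def using fun_cong[OF matrix_vector_mul(2)[OF lin], of y] .
  have "transpose B = B"
  proof -
    have "y \<bullet> (transpose B *v z) = y \<bullet> (B *v z)" for y z
    proof -
      have "y \<bullet> (transpose B *v z) = z \<bullet> (B *v y)"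
        unfolding transpose_matrix_vector dot_lmul_matrix[symmetric] by (rule inner_commute)
      then show ?thesis using f(2)[of y z] by (simp add: B inner_sympl_dual)
    qed
    then have "transpose B *v z = B *v z" for z using vector_eq_ldot by blast
    then show ?thesis unfolding matrix_eq by blast
  qed
  moreover have "invertible B"
  proof -
    have "y = 0" if "B *v y = 0" for y
      using that f(3)[of y] f(4) linear_0[OF f(1)] by (simp add: B)
    then show ?thesis by (simp add: invertible_left_inverse matrix_left_invertible_ker)
  qed
  ultimately have "associated_correlation x B"
    unfolding associated_correlation_iff[OF H] using fx by (auto simp: B) (metis sympl_dual_linear(2))
  moreover have img: "image_line B (L X) = L Y"
    if "oriented_circle Y" "\<And>y. y \<in> L X \<Longrightarrow> f y \<in> L Y" "\<And>y. y \<in> L Y \<Longrightarrow> f y \<in> L X" "oriented_circle X" for X Y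
  proof -
    have "\<exists>z\<in>L X. f z = y" if y: "y \<in> L Y" for y
    proof (rule bexI)
      show "f ((1 / \<kappa>) *\<^sub>R f y) = y" using f(3,4) by (simp add: linear_scale[OF f(1)])
      show "(1 / \<kappa>) *\<^sub>R f y \<in> L X" using that(1) \<open>oriented_circle X\<close> y line_scale \<open>\<And>y. y \<in> L Y \<Longrightarrow> f y \<in> L X\<close> by blast
    qed
    then have "f ` L X = L Y" using that(2) by force
    moreover have "image_line B (L X) = {y. \<forall>z\<in>f ` L X. sympl z y = 0}"
      by (auto simp: image_line_def polar_plane_def B inner_sympl_dual)
    ultimately have "image_line B (L X) = {y. \<forall>z\<in>L Y. sympl z y = 0}" by simp
    then show ?thesis using line_polar[OF that(1)] by blast
  qed
  moreover have "\<forall>i. meets_in (L (H (i - 1))) (L (H i)) (x i)" using H by (simp add: hexagon_def)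
  ultimately show ?thesis unfolding correlated_def using img[OF V(2-4,1)] img[OF V(1,4,3,2)] by blast
qed

end

section \<open>The algebra of an elementary cube\<close>

lemma sympl_basis_eq_0:
  assumes "sympl p1 p2 \<noteq> 0" "sympl q1 q2 \<noteq> 0"
    "sympl p1 q1 = 0" "sympl p1 q2 = 0" "sympl p2 q1 = 0" "sympl p2 q2 = 0"
    and d: "sympl d p1 = 0" "sympl d p2 = 0" "sympl d q1 = 0" "sympl d q2 = 0"
  shows "d = 0"
proof (rule ccontr)
  assume "d \<noteq> 0"
  then have "pfaffian p1 p2 q1 q2 = 0"
    using pfaffian_eq_0_if_orthogonal[of "sympl_dual d"] d by (simp add: inner_sympl_dual inner_commute[of "sympl_dual d"])
  then show False using assms(1-6) by (simp add: pfaffian_def)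
qed

text \<open>A cube in normal form: with \<open>p3 = - p1 - p2\<close> and
  \<open>q3 = - q1 - q2\<close>, the distinguished circle has slope 1, \<open>a\<close> and
  \<open>b\<close> are the remaining parameters, and the slopes \<open>- (a * b)\<close> and
  \<open>- (1 / (a * b))\<close> carry the sign of the twisted case. The three conditions with a
  single factor \<open>t\<close> exchange opposite vertices of the hexagon; the last four exchange
  the distinguished circle with the opposite geodesic circle.\<close>

lemma normal_form_correlation:
  fixes p1 p2 q1 q2 :: "real^4" and a b \<eta> :: real
  assumes S: "sympl p1 p2 = \<eta>" "sympl q1 q2 = - \<eta>"
    "sympl p1 q1 = 0" "sympl p1 q2 = 0" "sympl p2 q1 = 0" "sympl p2 q2 = 0"
    and ne: "\<eta> \<noteq> 0" "a \<noteq> 0" "b \<noteq> 0" "a \<noteq> -1" "b \<noteq> -1" "a * b \<noteq> 1"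
  obtains f \<kappa> where "linear f" "\<And>y z. sympl (f y) z = sympl (f z) y" "\<And>y. f (f y) = \<kappa> *\<^sub>R y" "\<kappa> \<noteq> 0"
    "\<exists>t. f (a *\<^sub>R p2 + q2) = t *\<^sub>R ((1 / b) *\<^sub>R p1 + q1)"
    "\<exists>t. f (b *\<^sub>R (- p1 - p2) + (- q1 - q2)) = t *\<^sub>R (- (a * b) *\<^sub>R p2 + q2)"
    "\<exists>t. f (- (1 / (a * b)) *\<^sub>R p1 + q1) = t *\<^sub>R ((1 / a) *\<^sub>R (- p1 - p2) + (- q1 - q2))"
    "\<exists>s t. f (p1 + q1) = s *\<^sub>R ((1 - b\<^sup>2) *\<^sub>R p1 + (b\<^sup>2 * (a\<^sup>2 - 1)) *\<^sub>R p2) + t *\<^sub>R ((1 - b\<^sup>2) *\<^sub>R q1 + (1 - 1 / a\<^sup>2) *\<^sub>R q2)"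
    "\<exists>s t. f (p2 + q2) = s *\<^sub>R ((1 - b\<^sup>2) *\<^sub>R p1 + (b\<^sup>2 * (a\<^sup>2 - 1)) *\<^sub>R p2) + t *\<^sub>R ((1 - b\<^sup>2) *\<^sub>R q1 + (1 - 1 / a\<^sup>2) *\<^sub>R q2)"
    "\<exists>s t. f ((1 - b\<^sup>2) *\<^sub>R p1 + (b\<^sup>2 * (a\<^sup>2 - 1)) *\<^sub>R p2) = s *\<^sub>R (p1 + q1) + t *\<^sub>R (p2 + q2)"
    "\<exists>s t. f ((1 - b\<^sup>2) *\<^sub>R q1 + (1 - 1 / a\<^sup>2) *\<^sub>R q2) = s *\<^sub>R (p1 + q1) + t *\<^sub>R (p2 + q2)"
proof -
  define K where "K x1 x2 x3 x4 = x1 *\<^sub>R p1 + x2 *\<^sub>R p2 + x3 *\<^sub>R q1 + x4 *\<^sub>R q2" for x1 x2 x3 x4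
  \<comment> \<open>\<open>M1\<close> to \<open>M4\<close> are the rows of the matrix of
    \<open>f\<close> in the basis \<open>p1\<close>, \<open>p2\<close>, \<open>q1\<close>,
    \<open>q2\<close>, up to the factor \<open>\<eta>\<close>.\<close>
  define M1 where "M1 x1 x2 x3 x4 = - b * (1 + a) * (1 + b) * x1 + (1 + b)\<^sup>2 * (a * b + b - 1) / b * x2
    + (1 + a) * (1 + b) * x3 - a * (1 + b)\<^sup>2 * x4" for x1 x2 x3 x4
  define M2 where "M2 x1 x2 x3 x4 = b * (1 + a)\<^sup>2 * (a * b - b - 1) * x1 + b * (1 + a) * (1 + b) * x2
    + b * (1 + a)\<^sup>2 * x3 - a * b * (1 + a) * (1 + b) * x4" for x1 x2 x3 x4
  define M3 where "M3 x1 x2 x3 x4 = - a * b * (1 + a) * (1 + b) * x1 + a * (1 + b)\<^sup>2 * x2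
    + a * (1 + a) * (1 + b) * x3 + a * (1 + b)\<^sup>2 * (a * b - a - 1) * x4" for x1 x2 x3 x4
  define M4 where "M4 x1 x2 x3 x4 = - b * (1 + a)\<^sup>2 * x1 + (1 + a) * (1 + b) * x2
    + (1 + a)\<^sup>2 * (a * b + a - 1) / a * x3 - a * (1 + a) * (1 + b) * x4" for x1 x2 x3 x4
  note M = M1_def M2_def M3_def M4_def
  define F where "F x1 x2 x3 x4 = K (M1 x1 x2 x3 x4) (M2 x1 x2 x3 x4) (M3 x1 x2 x3 x4) (M4 x1 x2 x3 x4)" for x1 x2 x3 x4
  \<comment> \<open>The pairings return the coordinates of \<open>y\<close> times
    \<open>\<eta>\<close>, so no choice of coordinates enters the definition.\<close>
  define f where "f y = F (sympl y p2) (- sympl y p1) (- sympl y q2) (sympl y q1)" for y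
  have S': "sympl p2 p1 = - \<eta>" "sympl q2 q1 = \<eta>" "sympl q1 p1 = 0" "sympl q2 p1 = 0" "sympl q1 p2 = 0" "sympl q2 p2 = 0"
    using S by (simp_all add: sympl_commute[of p2 p1] sympl_commute[of q2 q1] sympl_commute[of q1 p1]
        sympl_commute[of q1 p2] sympl_commute[of q2 p1] sympl_commute[of q2 p2])
  have Kadd: "K x1 x2 x3 x4 + K y1 y2 y3 y4 = K (x1 + y1) (x2 + y2) (x3 + y3) (x4 + y4)" for x1 x2 x3 x4 y1 y2 y3 y4
    by (simp add: K_def algebra_simps)
  have Kscale: "r *\<^sub>R K x1 x2 x3 x4 = K (r * x1) (r * x2) (r * x3) (r * x4)" for r x1 x2 x3 x4
    by (simp add: K_def algebra_simps)
  have fK: "f (K x1 x2 x3 x4) = K (\<eta> * M1 x1 x2 x3 x4) (\<eta> * M2 x1 x2 x3 x4) (\<eta> * M3 x1 x2 x3 x4) (\<eta> * M4 x1 x2 x3 x4)" for x1 x2 x3 x4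
  proof -
    have "sympl (K x1 x2 x3 x4) p2 = \<eta> * x1" "- sympl (K x1 x2 x3 x4) p1 = \<eta> * x2"
      "- sympl (K x1 x2 x3 x4) q2 = \<eta> * x3" "sympl (K x1 x2 x3 x4) q1 = \<eta> * x4"
      by (simp_all add: K_def S S' mult.commute)
    moreover have "M1 (\<eta> * x1) (\<eta> * x2) (\<eta> * x3) (\<eta> * x4) = \<eta> * M1 x1 x2 x3 x4"
      "M2 (\<eta> * x1) (\<eta> * x2) (\<eta> * x3) (\<eta> * x4) = \<eta> * M2 x1 x2 x3 x4"
      "M3 (\<eta> * x1) (\<eta> * x2) (\<eta> * x3) (\<eta> * x4) = \<eta> * M3 x1 x2 x3 x4"
      "M4 (\<eta> * x1) (\<eta> * x2) (\<eta> * x3) (\<eta> * x4) = \<eta> * M4 x1 x2 x3 x4"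
      unfolding M by (simp_all add: algebra_simps)
    ultimately show ?thesis by (simp add: f_def F_def)
  qed
  have Kall: "\<exists>x1 x2 x3 x4. y = K x1 x2 x3 x4" for y
  proof -
    have "y - K (sympl y p2 / \<eta>) (- sympl y p1 / \<eta>) (- sympl y q2 / \<eta>) (sympl y q1 / \<eta>) = 0"
      by (rule sympl_basis_eq_0[of p1 p2 q1 q2]) (use S S' ne(1) in \<open>simp_all add: K_def\<close>)
    then show ?thesis by auto
  qed
  have Kcong: "x1 = y1 \<Longrightarrow> x2 = y2 \<Longrightarrow> x3 = y3 \<Longrightarrow> x4 = y4 \<Longrightarrow> K x1 x2 x3 x4 = K y1 y2 y3 y4"
    for x1 x2 x3 x4 y1 y2 y3 y4 by simp
  have span_p0: "s *\<^sub>R ((1 - b\<^sup>2) *\<^sub>R p1 + (b\<^sup>2 * (a\<^sup>2 - 1)) *\<^sub>R p2) + t *\<^sub>R ((1 - b\<^sup>2) *\<^sub>R q1 + (1 - 1 / a\<^sup>2) *\<^sub>R q2)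
      = K (s * (1 - b\<^sup>2)) (s * (b\<^sup>2 * (a\<^sup>2 - 1))) (t * (1 - b\<^sup>2)) (t * (1 - 1 / a\<^sup>2))" for s t
    by (simp add: K_def algebra_simps)
  have span_c0: "s *\<^sub>R (p1 + q1) + t *\<^sub>R (p2 + q2) = K s t s t" for s t
    by (simp add: K_def algebra_simps)
  have fpq: "f (p1 + q1) = K (\<eta> * (1 + a) * (1 - b\<^sup>2)) (\<eta> * (1 + a) * (b\<^sup>2 * (a\<^sup>2 - 1)))
      (\<eta> * (a * (1 + a)) * (1 - b\<^sup>2)) (\<eta> * (a * (1 + a)) * (1 - 1 / a\<^sup>2))"
    "f (p2 + q2) = K (- \<eta> * (1 + b) / b * (1 - b\<^sup>2)) (- \<eta> * (1 + b) / b * (b\<^sup>2 * (a\<^sup>2 - 1)))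
      (- \<eta> * (a\<^sup>2 * (1 + b)) * (1 - b\<^sup>2)) (- \<eta> * (a\<^sup>2 * (1 + b)) * (1 - 1 / a\<^sup>2))"
    "f ((1 - b\<^sup>2) *\<^sub>R p1 + (b\<^sup>2 * (a\<^sup>2 - 1)) *\<^sub>R p2) =
      K (\<eta> * (a * b * (1 + a) * (1 + b)\<^sup>2 * (a * b - 1))) (\<eta> * (b * (1 + a)\<^sup>2 * (1 + b) * (a * b - 1)))
        (\<eta> * (a * b * (1 + a) * (1 + b)\<^sup>2 * (a * b - 1))) (\<eta> * (b * (1 + a)\<^sup>2 * (1 + b) * (a * b - 1)))"
    "f ((1 - b\<^sup>2) *\<^sub>R q1 + (1 - 1 / a\<^sup>2) *\<^sub>R q2) =
      K (\<eta> * ((1 + a) * (1 + b)\<^sup>2 * (1 - a * b) / a)) (\<eta> * (b * (1 + a)\<^sup>2 * (1 + b) * (1 - a * b) / a))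
        (\<eta> * ((1 + a) * (1 + b)\<^sup>2 * (1 - a * b) / a)) (\<eta> * (b * (1 + a)\<^sup>2 * (1 + b) * (1 - a * b) / a))"
  proof -
    have e: "p1 + q1 = K 1 0 1 0" "p2 + q2 = K 0 1 0 1"
      "(1 - b\<^sup>2) *\<^sub>R p1 + (b\<^sup>2 * (a\<^sup>2 - 1)) *\<^sub>R p2 = K (1 - b\<^sup>2) (b\<^sup>2 * (a\<^sup>2 - 1)) 0 0"
      "(1 - b\<^sup>2) *\<^sub>R q1 + (1 - 1 / a\<^sup>2) *\<^sub>R q2 = K 0 0 (1 - b\<^sup>2) (1 - 1 / a\<^sup>2)" by (simp_all add: K_def)
    show "f (p1 + q1) = K (\<eta> * (1 + a) * (1 - b\<^sup>2)) (\<eta> * (1 + a) * (b\<^sup>2 * (a\<^sup>2 - 1)))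
      (\<eta> * (a * (1 + a)) * (1 - b\<^sup>2)) (\<eta> * (a * (1 + a)) * (1 - 1 / a\<^sup>2))"
      unfolding e fK M using ne by (intro Kcong; simp add: field_simps power2_eq_square)
    show "f (p2 + q2) = K (- \<eta> * (1 + b) / b * (1 - b\<^sup>2)) (- \<eta> * (1 + b) / b * (b\<^sup>2 * (a\<^sup>2 - 1)))
      (- \<eta> * (a\<^sup>2 * (1 + b)) * (1 - b\<^sup>2)) (- \<eta> * (a\<^sup>2 * (1 + b)) * (1 - 1 / a\<^sup>2))"
      unfolding e fK M using ne by (intro Kcong; simp add: field_simps power2_eq_square)
    show "f ((1 - b\<^sup>2) *\<^sub>R p1 + (b\<^sup>2 * (a\<^sup>2 - 1)) *\<^sub>R p2) =
      K (\<eta> * (a * b * (1 + a) * (1 + b)\<^sup>2 * (a * b - 1))) (\<eta> * (b * (1 + a)\<^sup>2 * (1 + b) * (a * b - 1)))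
        (\<eta> * (a * b * (1 + a) * (1 + b)\<^sup>2 * (a * b - 1))) (\<eta> * (b * (1 + a)\<^sup>2 * (1 + b) * (a * b - 1)))"
      unfolding e fK M using ne by (intro Kcong; simp add: field_simps power2_eq_square)
    show "f ((1 - b\<^sup>2) *\<^sub>R q1 + (1 - 1 / a\<^sup>2) *\<^sub>R q2) =
      K (\<eta> * ((1 + a) * (1 + b)\<^sup>2 * (1 - a * b) / a)) (\<eta> * (b * (1 + a)\<^sup>2 * (1 + b) * (1 - a * b) / a))
        (\<eta> * ((1 + a) * (1 + b)\<^sup>2 * (1 - a * b) / a)) (\<eta> * (b * (1 + a)\<^sup>2 * (1 + b) * (1 - a * b) / a))"
      unfolding e fK M using ne by (intro Kcong; simp add: field_simps power2_eq_square)
  qed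
  have M_add: "M1 (x1 + y1) (x2 + y2) (x3 + y3) (x4 + y4) = M1 x1 x2 x3 x4 + M1 y1 y2 y3 y4"
    "M2 (x1 + y1) (x2 + y2) (x3 + y3) (x4 + y4) = M2 x1 x2 x3 x4 + M2 y1 y2 y3 y4"
    "M3 (x1 + y1) (x2 + y2) (x3 + y3) (x4 + y4) = M3 x1 x2 x3 x4 + M3 y1 y2 y3 y4"
    "M4 (x1 + y1) (x2 + y2) (x3 + y3) (x4 + y4) = M4 x1 x2 x3 x4 + M4 y1 y2 y3 y4" for x1 x2 x3 x4 y1 y2 y3 y4
    unfolding M using ne by (simp_all add: field_simps)
  have lin: "linear f"
  proof (rule linearI)
    show "f (y + z) = f y + f z" for y z
    proof -
      obtain y1 y2 y3 y4 z1 z2 z3 z4 where y: "y = K y1 y2 y3 y4" and z: "z = K z1 z2 z3 z4" using Kall by metis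
      show ?thesis unfolding y z Kadd fK M_add by (simp add: distrib_left)
    qed
    show "f (r *\<^sub>R y) = r *\<^sub>R f y" for r y
    proof -
      obtain y1 y2 y3 y4 where y: "y = K y1 y2 y3 y4" using Kall by metis
      show ?thesis unfolding y fK Kscale M using ne by (intro Kcong; simp add: field_simps)
    qed
  qed
  moreover have "sympl (f y) z = sympl (f z) y" for y z
  proof -
    obtain y1 y2 y3 y4 z1 z2 z3 z4 where y: "y = K y1 y2 y3 y4" and z: "z = K z1 z2 z3 z4" using Kall by metis
    have KK: "sympl (K x1 x2 x3 x4) (K y1 y2 y3 y4) = \<eta> * (x1 * y2 - x2 * y1 - x3 * y4 + x4 * y3)" for x1 x2 x3 x4 y1 y2 y3 y4
      by (simp add: K_def S S' algebra_simps)
    show ?thesis unfolding y z fK KK M using ne by (simp add: field_simps power2_eq_square)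
  qed
  \<comment> \<open>The exclusions \<open>a \<noteq> -1\<close>, \<open>b \<noteq> -1\<close> and
    \<open>a * b \<noteq> 1\<close> keep this scalar nonzero.\<close>
  moreover have "f (f y) = (\<eta>\<^sup>2 * ((1 + a) * (1 + b) * (a * b - 1))\<^sup>2) *\<^sub>R y" (is "_ = ?\<kappa> *\<^sub>R _") for y
  proof -
    have e: "p1 = K 1 0 0 0" "p2 = K 0 1 0 0" "q1 = K 0 0 1 0" "q2 = K 0 0 0 1" by (simp_all add: K_def)
    have ff: "f (f p1) = ?\<kappa> *\<^sub>R p1" "f (f p2) = ?\<kappa> *\<^sub>R p2" "f (f q1) = ?\<kappa> *\<^sub>R q1" "f (f q2) = ?\<kappa> *\<^sub>R q2"
      unfolding e fK Kscale M using ne by ((intro Kcong; simp add: field_simps power2_eq_square)[1])+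
    obtain y1 y2 y3 y4 where y: "y = K y1 y2 y3 y4" using Kall by metis
    show ?thesis unfolding y K_def
      by (simp add: linear_add[OF lin] linear_scale[OF lin] ff scaleR_add_right mult.commute)
  qed
  moreover have "\<eta>\<^sup>2 * ((1 + a) * (1 + b) * (a * b - 1))\<^sup>2 \<noteq> 0" using ne by auto
  moreover have "\<exists>t. f (a *\<^sub>R p2 + q2) = t *\<^sub>R ((1 / b) *\<^sub>R p1 + q1)"
  proof
    have e: "a *\<^sub>R p2 + q2 = K 0 a 0 1" "(1 / b) *\<^sub>R p1 + q1 = K (1 / b) 0 1 0" by (simp_all add: K_def)
    show "f (a *\<^sub>R p2 + q2) = (\<eta> * (a * (1 + b)\<^sup>2 * (a * b - 1))) *\<^sub>R ((1 / b) *\<^sub>R p1 + q1)"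
      unfolding e fK Kscale M using ne by (intro Kcong; simp add: field_simps power2_eq_square)
  qed
  moreover have "\<exists>t. f (b *\<^sub>R (- p1 - p2) + (- q1 - q2)) = t *\<^sub>R (- (a * b) *\<^sub>R p2 + q2)"
  proof
    have e: "b *\<^sub>R (- p1 - p2) + (- q1 - q2) = K (- b) (- b) (-1) (-1)" "- (a * b) *\<^sub>R p2 + q2 = K 0 (- a * b) 0 1"
      by (simp_all add: K_def algebra_simps)
    show "f (b *\<^sub>R (- p1 - p2) + (- q1 - q2)) = (\<eta> * ((1 + a) * (a * b - 1)\<^sup>2 / a)) *\<^sub>R (- (a * b) *\<^sub>R p2 + q2)"
      unfolding e fK Kscale M using ne by (intro Kcong; simp add: field_simps power2_eq_square)
  qed
  moreover have "\<exists>t. f (- (1 / (a * b)) *\<^sub>R p1 + q1) = t *\<^sub>R ((1 / a) *\<^sub>R (- p1 - p2) + (- q1 - q2))"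
  proof
    have e: "- (1 / (a * b)) *\<^sub>R p1 + q1 = K (- (1 / (a * b))) 0 1 0"
      "(1 / a) *\<^sub>R (- p1 - p2) + (- q1 - q2) = K (- (1 / a)) (- (1 / a)) (-1) (-1)"
      by (simp_all add: K_def algebra_simps)
    show "f (- (1 / (a * b)) *\<^sub>R p1 + q1) =
        (- \<eta> * ((1 + a)\<^sup>2 * (1 + b))) *\<^sub>R ((1 / a) *\<^sub>R (- p1 - p2) + (- q1 - q2))"
      unfolding e fK Kscale M using ne by (intro Kcong; simp add: field_simps power2_eq_square)
  qed
  moreover have "\<exists>s t. f (p1 + q1) = s *\<^sub>R ((1 - b\<^sup>2) *\<^sub>R p1 + (b\<^sup>2 * (a\<^sup>2 - 1)) *\<^sub>R p2) + t *\<^sub>R ((1 - b\<^sup>2) *\<^sub>R q1 + (1 - 1 / a\<^sup>2) *\<^sub>R q2)"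
    using span_p0[of "\<eta> * (1 + a)" "\<eta> * (a * (1 + a))"] fpq(1) by metis
  moreover have "\<exists>s t. f (p2 + q2) = s *\<^sub>R ((1 - b\<^sup>2) *\<^sub>R p1 + (b\<^sup>2 * (a\<^sup>2 - 1)) *\<^sub>R p2) + t *\<^sub>R ((1 - b\<^sup>2) *\<^sub>R q1 + (1 - 1 / a\<^sup>2) *\<^sub>R q2)"
    using span_p0[of "- \<eta> * (1 + b) / b" "- \<eta> * (a\<^sup>2 * (1 + b))"] fpq(2) by metis
  moreover have "\<exists>s t. f ((1 - b\<^sup>2) *\<^sub>R p1 + (b\<^sup>2 * (a\<^sup>2 - 1)) *\<^sub>R p2) = s *\<^sub>R (p1 + q1) + t *\<^sub>R (p2 + q2)"
    using span_c0[of "\<eta> * (a * b * (1 + a) * (1 + b)\<^sup>2 * (a * b - 1))" "\<eta> * (b * (1 + a)\<^sup>2 * (1 + b) * (a * b - 1))"] fpq(3) by metis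
  moreover have "\<exists>s t. f ((1 - b\<^sup>2) *\<^sub>R q1 + (1 - 1 / a\<^sup>2) *\<^sub>R q2) = s *\<^sub>R (p1 + q1) + t *\<^sub>R (p2 + q2)"
    using span_c0[of "\<eta> * ((1 + a) * (1 + b)\<^sup>2 * (1 - a * b) / a)" "\<eta> * (b * (1 + a)\<^sup>2 * (1 + b) * (1 - a * b) / a)"] fpq(4) by metis
  ultimately show ?thesis by (rule that)
qed

lemma tetraD:
  assumes "tetra m p q" "i \<in> {..<4}" "k \<in> {..<4}"
  shows "sympl (p i) (q k) = 0" "i \<noteq> k \<Longrightarrow> m i k \<noteq> 0" "i \<noteq> k \<Longrightarrow> sympl (p i) (p k) \<noteq> 0"
    "l \<in> {..<4} \<Longrightarrow> i \<noteq> k \<Longrightarrow> i \<noteq> l \<Longrightarrow> k \<noteq> l \<Longrightarrow> m i k * m i l * sympl (p k) (p l) = - sympl (q k) (q l)"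
    "l \<in> {..<4} \<Longrightarrow> i \<noteq> k \<Longrightarrow> i \<noteq> l \<Longrightarrow> k \<noteq> l \<Longrightarrow> (m i k)\<^sup>2 \<noteq> (m l k)\<^sup>2"
  using assms unfolding tetra_def by metis+

text \<open>The condition which singles out one of the two possible choices of the last circle.\<close>

definition twisted :: "(nat \<Rightarrow> nat \<Rightarrow> real) \<Rightarrow> bool" where
  "twisted m \<longleftrightarrow> m 1 2 * m 2 3 * m 3 1 = - (m 0 1 * m 0 2 * m 0 3)"

text \<open>Both products equal minus the ratio of \<open>sympl (q k) (q l)\<close> and
  \<open>sympl (p k) (p l)\<close>.\<close>

lemma tetra_exchange:
  assumes t: "tetra m p q" and "i \<in> {..<4}" "j \<in> {..<4}" "k \<in> {..<4}" "l \<in> {..<4}" "distinct [i, j, k, l]"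
  shows "m i k * m i l = m j k * m j l"
proof -
  have "m i k * m i l * sympl (p k) (p l) = m j k * m j l * sympl (p k) (p l)"
    using tetraD(4)[OF t, of i k l] tetraD(4)[OF t, of j k l] assms by auto
  then show ?thesis using tetraD(3)[OF t, of k l] assms by auto
qed

text \<open>The exchange relations make the cyclic product independent of its orientation, and its
  product with the reversed one is the square of the product at the distinguished circle.\<close>

lemma
  assumes t: "tetra m p q"
  shows tetra_orientation: "m 1 3 * m 3 2 * m 2 1 = m 1 2 * m 2 3 * m 3 1"
    and tetra_squares: "(m 1 2 * m 2 3 * m 3 1)\<^sup>2 = (m 0 1 * m 0 2 * m 0 3)\<^sup>2"
proof -
  have "m 2 0 * m 2 1 = m 3 0 * m 3 1" "m 1 0 * m 1 2 = m 3 0 * m 3 2" "m 1 0 * m 1 3 = m 2 0 * m 2 3"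
    by (rule tetra_exchange[OF t]; simp)+
  then have "m 1 3 * m 3 2 * m 2 1 * (m 1 0 * m 2 0 * m 3 0) = m 1 2 * m 2 3 * m 3 1 * (m 1 0 * m 2 0 * m 3 0)"
    by algebra
  moreover have "m 1 0 * m 2 0 * m 3 0 \<noteq> 0" using tetraD(2)[OF t] by auto
  ultimately show 1: "m 1 3 * m 3 2 * m 2 1 = m 1 2 * m 2 3 * m 3 1" by simp
  have "m 0 2 * m 0 3 = m 1 2 * m 1 3" "m 0 1 * m 0 3 = m 2 1 * m 2 3" "m 0 1 * m 0 2 = m 3 1 * m 3 2"
    by (rule tetra_exchange[OF t]; simp)+
  with 1 show "(m 1 2 * m 2 3 * m 3 1)\<^sup>2 = (m 0 1 * m 0 2 * m 0 3)\<^sup>2" by algebra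
qed

lemma twisted_permute:
  assumes t: "tetra m p q" and w: "twisted m" and "l \<in> {1, 2, 3}" "k \<in> {1, 2, 3}" "r \<in> {1, 2, 3}" "distinct [l, k, r]"
  shows "m l k * m k r * m r l = - (m 0 l * m 0 k * m 0 r)"
  using assms(3-6) w tetra_orientation[OF t] unfolding twisted_def by (auto simp: ac_simps)

text \<open>The Pfaffian splits by bidegree in the two eigenspaces. The terms with only
  \<open>p\<close> or only \<open>q\<close> vanish, since four vectors of a plane are dependent; the
  three mixed terms vanish by \<open>h1\<close> to \<open>h3\<close>, where the sign in
  \<open>twisted\<close> enters.\<close>

lemma tetra_coplanar:
  assumes t: "tetra m p q" and w: "twisted m"
    and lkr: "l \<in> {1, 2, 3}" "k \<in> {1, 2, 3}" "r \<in> {1, 2, 3}" "distinct [l, k, r]"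
  shows "pfaffian (m 0 l *\<^sub>R p l + q l) (m r k *\<^sub>R p k + q k) (m l 0 *\<^sub>R p 0 + q 0) (m k r *\<^sub>R p r + q r) = 0"
proof -
  have in4: "0 \<in> {..<4::nat}" "l \<in> {..<4}" "k \<in> {..<4}" "r \<in> {..<4}" and d: "distinct [0, l, k, r]" using lkr by auto
  have lkr': "l \<noteq> 0" "k \<noteq> 0" "r \<noteq> 0" "l \<noteq> k" "l \<noteq> r" "k \<noteq> r" "k \<noteq> l" "r \<noteq> l" "r \<noteq> k" using d by auto
  note D = tetraD[OF t] and X = tetra_exchange[OF t]
  have tw: "m l k * m k r * m r l = - (m 0 l * m 0 k * m 0 r)" using twisted_permute[OF t w lkr] .
  have tw': "m l r * m r k * m k l = - (m 0 l * m 0 k * m 0 r)"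
    using twisted_permute[OF t w lkr(1,3,2)] lkr(4) by auto
  have nz: "m i j \<noteq> 0" if "i \<in> {..<4}" "j \<in> {..<4}" "i \<noteq> j" for i j using D(2) that by blast
  have Q: "sympl (q i) (q j) = - (m u i * m u j * sympl (p i) (p j))"
    if "i \<in> {..<4}" "j \<in> {..<4}" "u \<in> {..<4}" "distinct [u, i, j]" for i j u
    using D(4)[of u i j] that by auto
  have ex: "m 0 l * m 0 r = m k l * m k r" "m l 0 * m l r = m k 0 * m k r" "m r 0 * m r k = m l 0 * m l k"
    "m r 0 * m r l = m k 0 * m k l" "m 0 l * m 0 k = m r l * m r k" "m 0 k * m 0 r = m l k * m l r"
    by (rule X; use in4 d in auto)+
  \<comment> \<open>The twisted condition divided by an exchange relation; the sign
    survives.\<close>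
  have B: "m 0 k * m k r = - (m l r * m r k)"
  proof -
    have "(m 0 k * m k r) * m k l = - (m l r * m r k) * m k l" using tw' ex(1) by algebra
    then show ?thesis using nz[OF in4(3,2)] lkr' by (metis mult_right_cancel)
  qed
  have B': "m 0 r * m r k = - (m l k * m k r)"
  proof -
    have ex': "m 0 l * m 0 k = m r l * m r k" by (rule ex)
    have "(m 0 r * m r k) * m r l = - (m l k * m k r) * m r l" using tw ex' by algebra
    then show ?thesis using nz[OF in4(4,2)] lkr' by (metis mult_right_cancel)
  qed
  have C: "m 0 k * m l 0 = - (m k 0 * m r k)"
  proof -
    have "(m 0 k * m l 0) * m l r = - (m k 0 * m r k) * m l r" using B ex(2) by algebra
    then show ?thesis using nz[OF in4(2,4)] lkr' by (metis mult_right_cancel)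
  qed
  have C': "m 0 r * m l 0 = - (m r 0 * m k r)"
  proof -
    have "(m 0 r * m l 0) * m l k = - (m r 0 * m k r) * m l k" using B' ex(3) by algebra
    then show ?thesis using nz[OF in4(2,3)] lkr' by (metis mult_right_cancel)
  qed
  define P where "P i j = sympl (p i) (p j)" for i j
  have QP: "sympl (q l) (q k) = - (m 0 l * m 0 k * P l k)" "sympl (q 0) (q r) = - (m k 0 * m k r * P 0 r)"
    "sympl (q l) (q 0) = - (m r l * m r 0 * P l 0)" "sympl (q k) (q r) = - (m 0 k * m 0 r * P k r)"
    "sympl (q l) (q r) = - (m 0 l * m 0 r * P l r)" "sympl (q k) (q 0) = - (m r k * m r 0 * P k 0)"
    unfolding P_def by (rule Q; use in4 d in auto)+
  have h1: "m 0 l * m 0 k * (m l 0 * m k r) + m k 0 * m k r * (m 0 l * m r k) = 0" using C by algebra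
  have h2: "m r l * m r 0 * (m r k * m k r) + m 0 k * m 0 r * (m 0 l * m l 0) = 0" using ex(3) tw by algebra
  have h3: "m 0 l * m 0 r * (m r k * m l 0) + m r k * m r 0 * (m 0 l * m k r) = 0" using C' by algebra
  have qn: "q 0 \<noteq> 0" "p 0 \<noteq> 0"
    using D(3)[OF in4(1,2)] D(4)[OF in4(3,1,2)] nz[of k 0] nz[of k l] lkr' in4 by auto
  \<comment> \<open>Eigenvectors of different kinds are conjugate, so \<open>q 0\<close> provides a
    functional which annihilates all four.\<close>
  have "pfaffian (p l) (p k) (p 0) (p r) = 0"
    by (rule pfaffian_eq_0_if_orthogonal[of "sympl_dual (q 0)"])
      (use qn D(1) in4 in \<open>auto simp: inner_commute[of "sympl_dual _"] inner_sympl_dual sympl_commute[of "q 0"]\<close>)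
  then have PP: "P l k * P 0 r - P l 0 * P k r + P l r * P k 0 = 0" by (simp add: pfaffian_def P_def)
  have "pfaffian (q l) (q k) (q 0) (q r) = 0"
    by (rule pfaffian_eq_0_if_orthogonal[of "sympl_dual (p 0)"])
      (use qn D(1) in4 in \<open>auto simp: inner_commute[of "sympl_dual _"] inner_sympl_dual\<close>)
  then have QQ: "m 0 l * m 0 k * P l k * (m k 0 * m k r * P 0 r) - m r l * m r 0 * P l 0 * (m 0 k * m 0 r * P k r)
      + m 0 l * m 0 r * P l r * (m r k * m r 0 * P k 0) = 0" by (simp add: pfaffian_def QP)
  have z: "sympl (q i) (p j) = 0" if "i \<in> {..<4}" "j \<in> {..<4}" for i j
    using D(1)[OF that(2,1)] by (simp add: sympl_commute[of "q i"])
  show ?thesis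
  proof -
    have "pfaffian (m 0 l *\<^sub>R p l + q l) (m r k *\<^sub>R p k + q k) (m l 0 *\<^sub>R p 0 + q 0) (m k r *\<^sub>R p r + q r) =
      m 0 l * m r k * m l 0 * m k r * (P l k * P 0 r - P l 0 * P k r + P l r * P k 0)
      + (m 0 l * m 0 k * P l k * (m k 0 * m k r * P 0 r) - m r l * m r 0 * P l 0 * (m 0 k * m 0 r * P k r)
      + m 0 l * m 0 r * P l r * (m r k * m r 0 * P k 0))
      - (m 0 l * m 0 k * (m l 0 * m k r) + m k 0 * m k r * (m 0 l * m r k)) * (P l k * P 0 r)
      + (m r l * m r 0 * (m r k * m k r) + m 0 k * m 0 r * (m 0 l * m l 0)) * (P l 0 * P k r)
      - (m 0 l * m 0 r * (m r k * m l 0) + m r k * m r 0 * (m 0 l * m k r)) * (P l r * P k 0)"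
      unfolding pfaffian_def sympl_linear QP z[OF in4(2,3)] z[OF in4(1,4)] z[OF in4(2,1)] z[OF in4(3,4)] z[OF in4(2,4)] z[OF in4(3,1)]
        D(1)[OF in4(2,3)] D(1)[OF in4(1,4)] D(1)[OF in4(2,1)] D(1)[OF in4(3,4)] D(1)[OF in4(2,4)] D(1)[OF in4(3,1)] P_def
      by (simp add: algebra_simps)
    then show ?thesis unfolding PP QQ h1 h2 h3 by simp
  qed
qed

text \<open>Reduces to \<open>normal_form_correlation\<close>: three vectors of a two-dimensional
  eigenspace satisfy a linear relation, and one factor per index brings both relations and the
  slopes of the distinguished circle to normal form.\<close>

lemma tetra_correlation:
  assumes t: "tetra m p q" and w: "twisted m"
  obtains f \<kappa> where "linear f" "\<And>y z. sympl (f y) z = sympl (f z) y" "\<And>y. f (f y) = \<kappa> *\<^sub>R y" "\<kappa> \<noteq> 0"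
    "\<And>i k. i \<in> {1, 2, 3} \<Longrightarrow> k \<in> {1, 2, 3} \<Longrightarrow> i \<noteq> k \<Longrightarrow>
      \<exists>s. f (m i k *\<^sub>R p k + q k) = s *\<^sub>R (m k i *\<^sub>R p i + q i)"
    "\<And>y. y \<in> span {m 0 1 *\<^sub>R p 1 + q 1, m 0 2 *\<^sub>R p 2 + q 2} \<Longrightarrow> f y \<in> span {p 0, q 0}"
    "\<And>y. y \<in> span {p 0, q 0} \<Longrightarrow> f y \<in> span {m 0 1 *\<^sub>R p 1 + q 1, m 0 2 *\<^sub>R p 2 + q 2}"
proof -
  note D = tetraD[OF t] and X = tetra_exchange[OF t]
  have nz: "m i j \<noteq> 0" if "i \<in> {..<4}" "j \<in> {..<4}" "i \<noteq> j" for i j using D(2) that by blast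
  define P where "P i j = sympl (p i) (p j)" for i j
  have P: "P i j \<noteq> 0" if "i \<in> {..<4}" "j \<in> {..<4}" "i \<noteq> j" for i j using D(3) that by (simp add: P_def)
  have Pc: "P j i = - P i j" for i j by (simp add: P_def sympl_commute[of "p j"])
  have Q: "sympl (q i) (q j) = - (m u i * m u j * P i j)"
    if "i \<in> {..<4}" "j \<in> {..<4}" "u \<in> {..<4}" "distinct [u, i, j]" for i j u
    using D(4)[of u i j] that by (auto simp: P_def)
  have pq: "sympl (p i) (q j) = 0" "sympl (q j) (p i) = 0" if "i \<in> {..<4}" "j \<in> {..<4}" for i j
    using D(1) that sympl_commute[of "q j"] by simp_all
  \<comment> \<open>The numerators are the coefficients of the relation among \<open>p 1\<close>,
    \<open>p 2\<close>, \<open>p 3\<close>. After division by \<open>m 0 k\<close> the same factors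
    give the relation among the \<open>q\<close>, by \<open>Q0\<close>.\<close>
  define \<tau> where "\<tau> = (\<lambda>k. (if k = 1 then P 2 3 else if k = 2 then P 3 1 else P 1 2) / m 0 k)"
  have \<tau>: "\<tau> 1 = P 2 3 / m 0 1" "\<tau> 2 = P 3 1 / m 0 2" "\<tau> 3 = P 1 2 / m 0 3" by (simp_all add: \<tau>_def)
  have n0: "m 0 1 \<noteq> 0" "m 0 2 \<noteq> 0" "m 0 3 \<noteq> 0" "P 2 3 \<noteq> 0" "P 3 1 \<noteq> 0" "P 1 2 \<noteq> 0"
    by (rule nz P; simp)+
  have n1: "m 1 2 \<noteq> 0" "m 2 3 \<noteq> 0" "m 3 1 \<noteq> 0" "m 1 3 \<noteq> 0" "m 2 1 \<noteq> 0" "m 3 2 \<noteq> 0" "m 1 0 \<noteq> 0" "m 2 0 \<noteq> 0"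
    by (rule nz; simp)+
  have \<tau>_nz: "\<tau> 1 \<noteq> 0" "\<tau> 2 \<noteq> 0" "\<tau> 3 \<noteq> 0" using n0 by (simp_all only: \<tau> divide_eq_0_iff simp_thms)
  define p' q' where "p' k = (\<tau> k * m 0 k) *\<^sub>R p k" and "q' k = \<tau> k *\<^sub>R q k" for k
  have p': "p' 1 = P 2 3 *\<^sub>R p 1" "p' 2 = P 3 1 *\<^sub>R p 2" "p' 3 = P 1 2 *\<^sub>R p 3"
    using n0 by (simp_all add: p'_def \<tau> del: One_nat_def)
  have Q0: "sympl (q 1) (q 2) = - (m 0 1 * m 0 2 * P 1 2)" "sympl (q 2) (q 1) = - (m 0 2 * m 0 1 * P 2 1)"
    "sympl (q 3) (q 1) = - (m 0 3 * m 0 1 * P 3 1)" "sympl (q 3) (q 2) = - (m 0 3 * m 0 2 * P 3 2)"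
    by (rule Q; simp)+
  have pq12: "sympl (p 1) (q 1) = 0" "sympl (p 1) (q 2) = 0" "sympl (p 2) (q 1) = 0" "sympl (p 2) (q 2) = 0"
    "sympl (p 3) (q 1) = 0" "sympl (p 3) (q 2) = 0" "sympl (p 0) (q 1) = 0" "sympl (p 0) (q 2) = 0"
    "sympl (q 1) (p 1) = 0" "sympl (q 2) (p 1) = 0" "sympl (q 1) (p 2) = 0" "sympl (q 2) (p 2) = 0"
    "sympl (q 3) (p 1) = 0" "sympl (q 3) (p 2) = 0" "sympl (q 0) (p 1) = 0" "sympl (q 0) (p 2) = 0"
    by (rule pq; simp)+
  have zero: "d = 0" if "sympl d (p 1) = 0" "sympl d (p 2) = 0" "sympl d (q 1) = 0" "sympl d (q 2) = 0" for d
  proof (rule sympl_basis_eq_0[OF _ _ pq12(1-4) that])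
    show "sympl (p 1) (p 2) \<noteq> 0" "sympl (q 1) (q 2) \<noteq> 0" unfolding Q0 using n0 by (auto simp: P_def)
  qed
  have P_self: "P k k = 0" for k by (simp add: P_def)
  have "p' 1 + p' 2 + p' 3 = 0"
  proof (rule zero)
    have "sympl (p' 1 + p' 2 + p' 3) (p j) = P 2 3 * P 1 j + P 3 1 * P 2 j + P 1 2 * P 3 j" for j
      unfolding p' by (simp add: P_def)
    from this[of 1] this[of 2] show "sympl (p' 1 + p' 2 + p' 3) (p 1) = 0" "sympl (p' 1 + p' 2 + p' 3) (p 2) = 0"
      using Pc[of 1 2] Pc[of 2 3] by (simp_all add: P_self del: One_nat_def)
    show "sympl (p' 1 + p' 2 + p' 3) (q 1) = 0" "sympl (p' 1 + p' 2 + p' 3) (q 2) = 0"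
      unfolding p' using pq12 by (simp_all del: One_nat_def)
  qed
  then have "p' 3 = - (p' 1 + p' 2)" using add_eq_0_iff by blast
  then have p3: "p' 3 = - p' 1 - p' 2" by simp
  have "q' 1 + q' 2 + q' 3 = 0"
  proof (rule zero)
    have e: "sympl (q' 1 + q' 2 + q' 3) (q j) = \<tau> 1 * sympl (q 1) (q j) + \<tau> 2 * sympl (q 2) (q j) + \<tau> 3 * sympl (q 3) (q j)" for j
      by (simp add: q'_def)
    show "sympl (q' 1 + q' 2 + q' 3) (q 1) = 0" "sympl (q' 1 + q' 2 + q' 3) (q 2) = 0"
      unfolding e Q0 \<tau> using n0 Pc[of 1 2] Pc[of 2 3] by (simp_all add: field_simps del: One_nat_def)
    show "sympl (q' 1 + q' 2 + q' 3) (p 1) = 0" "sympl (q' 1 + q' 2 + q' 3) (p 2) = 0"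
      unfolding q'_def using pq12 by (simp_all del: One_nat_def)
  qed
  then have "q' 3 = - (q' 1 + q' 2)" using add_eq_0_iff by blast
  then have q3: "q' 3 = - q' 1 - q' 2" by simp
  \<comment> \<open>Two slopes, measured in units of those of the distinguished circle; the exchange
    relations and \<open>tw\<close> express the other ones by them.\<close>
  define a b \<eta> where "a = m 1 2 / m 0 2" and "b = m 2 3 / m 0 3" and "\<eta> = P 2 3 * P 3 1 * P 1 2"
  have ex: "m 0 1 * m 0 3 = m 2 1 * m 2 3" "m 0 2 * m 0 3 = m 1 2 * m 1 3" "m 0 1 * m 0 2 = m 3 1 * m 3 2"
    "m 1 0 * m 1 3 = m 2 0 * m 2 3"
    by (rule X; simp)+
  have tw: "m 1 2 * m 2 3 * m 3 1 = - (m 0 1 * m 0 2 * m 0 3)" using w by (simp only: twisted_def)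
  have sq: "(m 1 2)\<^sup>2 \<noteq> (m 0 2)\<^sup>2" "(m 2 3)\<^sup>2 \<noteq> (m 0 3)\<^sup>2" "(m 2 3)\<^sup>2 \<noteq> (m 1 3)\<^sup>2"
    by (rule D(5); simp)+
  have a2: "a\<^sup>2 \<noteq> 1" "b\<^sup>2 \<noteq> 1" using sq n0 by (simp_all add: a_def b_def power_divide)
  have ab: "a * b = m 2 3 / m 1 3"
    using n0 n1 ex(2) by (simp add: a_def b_def frac_eq_eq)
  have ne: "\<eta> \<noteq> 0" "a \<noteq> 0" "b \<noteq> 0" "a \<noteq> -1" "b \<noteq> -1" "a * b \<noteq> 1"
  proof -
    show "\<eta> \<noteq> 0" "a \<noteq> 0" "b \<noteq> 0" using n0 n1 by (simp_all add: \<eta>_def a_def b_def del: One_nat_def)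
    show "a \<noteq> -1" "b \<noteq> -1" using a2 by auto
    show "a * b \<noteq> 1" unfolding ab using sq(3) n1 by auto
  qed
  have S: "sympl (p' 1) (p' 2) = \<eta>" "sympl (q' 1) (q' 2) = - \<eta>"
    "sympl (p' 1) (q' 1) = 0" "sympl (p' 1) (q' 2) = 0" "sympl (p' 2) (q' 1) = 0" "sympl (p' 2) (q' 2) = 0"
    using n0 pq12 by (simp_all add: p' q'_def Q0 \<tau> \<eta>_def del: One_nat_def flip: P_def)
  define X' where "X' i k = m i k *\<^sub>R p k + q k" for i k
  have X': "X' i k = (1 / \<tau> k) *\<^sub>R (r *\<^sub>R p' k + q' k)" if "m i k = r * m 0 k" "\<tau> k \<noteq> 0" for i k r
    using that by (simp add: X'_def p'_def q'_def scaleR_add_right)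
  have r: "m 1 2 = a * m 0 2" "m 2 1 = 1 / b * m 0 1" "m 2 3 = b * m 0 3" "m 3 2 = - (a * b) * m 0 2"
    "m 3 1 = - (1 / (a * b)) * m 0 1" "m 1 3 = 1 / a * m 0 3" "m 0 1 = 1 * m 0 1" "m 0 2 = 1 * m 0 2"
  proof -
    show "m 3 2 = - (a * b) * m 0 2"
    proof -
      have "(m 3 2 * m 0 3) * m 3 1 = - (m 1 2 * m 2 3) * m 3 1" using tw ex(3) by algebra
      then have "m 3 2 * m 0 3 = - (m 1 2 * m 2 3)" using n1(3) by (metis mult_right_cancel)
      then show ?thesis using n0 by (simp add: a_def b_def field_simps)
    qed
    show "m 3 1 = - (1 / (a * b)) * m 0 1" using n0 n1 tw by (simp add: a_def b_def field_simps del: One_nat_def)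
    show "m 1 2 = a * m 0 2" "m 2 3 = b * m 0 3" using n0 by (simp_all add: a_def b_def)
    show "m 2 1 = 1 / b * m 0 1" "m 1 3 = 1 / a * m 0 3"
      using n1 ex(1,2) by (simp_all add: a_def b_def field_simps del: One_nat_def)
  qed simp_all
  obtain f \<kappa> where f: "linear f" "\<And>y z. sympl (f y) z = sympl (f z) y" "\<And>y. f (f y) = \<kappa> *\<^sub>R y" "\<kappa> \<noteq> 0"
    and h: "\<exists>t. f (a *\<^sub>R p' 2 + q' 2) = t *\<^sub>R ((1 / b) *\<^sub>R p' 1 + q' 1)"
    "\<exists>t. f (b *\<^sub>R p' 3 + q' 3) = t *\<^sub>R (- (a * b) *\<^sub>R p' 2 + q' 2)"
    "\<exists>t. f (- (1 / (a * b)) *\<^sub>R p' 1 + q' 1) = t *\<^sub>R ((1 / a) *\<^sub>R p' 3 + q' 3)"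
    and o: "\<exists>s t. f (p' 1 + q' 1) = s *\<^sub>R ((1 - b\<^sup>2) *\<^sub>R p' 1 + (b\<^sup>2 * (a\<^sup>2 - 1)) *\<^sub>R p' 2) + t *\<^sub>R ((1 - b\<^sup>2) *\<^sub>R q' 1 + (1 - 1 / a\<^sup>2) *\<^sub>R q' 2)"
    "\<exists>s t. f (p' 2 + q' 2) = s *\<^sub>R ((1 - b\<^sup>2) *\<^sub>R p' 1 + (b\<^sup>2 * (a\<^sup>2 - 1)) *\<^sub>R p' 2) + t *\<^sub>R ((1 - b\<^sup>2) *\<^sub>R q' 1 + (1 - 1 / a\<^sup>2) *\<^sub>R q' 2)"
    "\<exists>s t. f ((1 - b\<^sup>2) *\<^sub>R p' 1 + (b\<^sup>2 * (a\<^sup>2 - 1)) *\<^sub>R p' 2) = s *\<^sub>R (p' 1 + q' 1) + t *\<^sub>R (p' 2 + q' 2)"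
    "\<exists>s t. f ((1 - b\<^sup>2) *\<^sub>R q' 1 + (1 - 1 / a\<^sup>2) *\<^sub>R q' 2) = s *\<^sub>R (p' 1 + q' 1) + t *\<^sub>R (p' 2 + q' 2)"
    by (rule normal_form_correlation[OF S ne, folded p3 q3]) (rule that, assumption+)
  have f_lin: "f (x + y) = f x + f y" "f (r *\<^sub>R x) = r *\<^sub>R f x" for x y r
    using f(1) by (simp_all add: linear_add linear_scale)
  have fwd: "\<exists>s. f (X' i k) = s *\<^sub>R X' k i"
    if "f (r *\<^sub>R p' k + q' k) = t *\<^sub>R (r' *\<^sub>R p' i + q' i)" "m i k = r * m 0 k" "m k i = r' * m 0 i" "\<tau> k \<noteq> 0" "\<tau> i \<noteq> 0" for i k r r' t
    unfolding X'[OF that(2,4)] X'[OF that(3,5)] f_lin(2) that(1)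
    using that(4,5) by (intro exI[of _ "t * \<tau> i / \<tau> k"]) simp
  have f3: "\<exists>s. f (X' 1 2) = s *\<^sub>R X' 2 1" "\<exists>s. f (X' 2 3) = s *\<^sub>R X' 3 2" "\<exists>s. f (X' 3 1) = s *\<^sub>R X' 1 3"
    using h fwd r \<tau>_nz by metis+
  have X'_nz: "X' i k \<noteq> 0" if "i \<in> {..<4}" "k \<in> {..<4}" "i \<noteq> k" for i k
  proof
    assume "X' i k = 0"
    then have "sympl (p i) (X' i k) = 0" by simp
    then have "m i k * P i k = 0" using pq(1)[OF that(1,2)] by (simp add: X'_def P_def)
    then show False using nz P that by auto
  qed
  \<comment> \<open>Since \<open>f\<close> squares to a nonzero scalar, every relation can be
    reversed.\<close>
  have bwd: "\<exists>s. f (X' k i) = s *\<^sub>R X' i k" if ik: "\<exists>s. f (X' i k) = s *\<^sub>R X' k i" "X' i k \<noteq> 0" for i k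
  proof -
    obtain s where s: "f (X' i k) = s *\<^sub>R X' k i" using ik(1) by blast
    have "\<kappa> *\<^sub>R X' i k = s *\<^sub>R f (X' k i)" using f(3)[of "X' i k"] s f_lin by simp
    moreover from this have "s \<noteq> 0" using f(4) ik(2) by auto
    ultimately have "f (X' k i) = (\<kappa> / s) *\<^sub>R X' i k"
      by (metis divide_inverse_commute scaleR_one scaleR_scaleR left_inverse)
    then show ?thesis by blast
  qed
  have b3: "\<exists>s. f (X' 2 1) = s *\<^sub>R X' 1 2" "\<exists>s. f (X' 3 2) = s *\<^sub>R X' 2 3" "\<exists>s. f (X' 1 3) = s *\<^sub>R X' 3 1"
    by (rule bwd[OF f3(1)] bwd[OF f3(2)] bwd[OF f3(3)], rule X'_nz; simp)+
  \<comment> \<open>Up to scale these will turn out to be \<open>p 0\<close> and \<open>q 0\<close>,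
    the eigenvectors of the geodesic circle opposite to the distinguished circle.\<close>
  define U W where "U = (1 - b\<^sup>2) *\<^sub>R p' 1 + (b\<^sup>2 * (a\<^sup>2 - 1)) *\<^sub>R p' 2"
    and "W = (1 - b\<^sup>2) *\<^sub>R q' 1 + (1 - 1 / a\<^sup>2) *\<^sub>R q' 2"
  define R where "R k = \<tau> k * m 0 k * P 0 k" for k
  have R: "sympl (p 0) (p' k) = R k" for k by (simp add: R_def p'_def P_def)
  have Rq: "sympl (q 0) (q' k) = - (m i 0 * s * R k)"
    if "i \<in> {..<4}" "k \<in> {..<4}" "distinct [i, 0, k]" "m i k = s * m 0 k" for i k s
    using Q[of 0 k i] that by (simp add: q'_def R_def)
  have Rs: "sympl (q 0) (q' 2) = - (m 1 0 * a * R 2)" "sympl (q 0) (q' 3) = - (m 1 0 * (1 / a) * R 3)"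
    "sympl (q 0) (q' 3) = - (m 2 0 * b * R 3)" "sympl (q 0) (q' 1) = - (m 2 0 * (1 / b) * R 1)"
    by (rule Rq[OF _ _ _ r(1)] Rq[OF _ _ _ r(6)] Rq[OF _ _ _ r(3)] Rq[OF _ _ _ r(2)]; simp)+
  have R_nz: "R 2 \<noteq> 0" "R 3 \<noteq> 0" using P[of 0 2] P[of 0 3] n0 \<tau>_nz by (simp_all add: R_def)
  have m20: "m 2 0 = m 1 0 / (a * b)" using Rs(2,3) R_nz ne by (simp add: field_simps)
  have R3: "R 3 = - R 1 - R 2" unfolding R[symmetric] p3 by simp
  \<comment> \<open>The relation among the \<open>q'\<close>, paired with \<open>q 0\<close>, ties
    \<open>R 1\<close> to \<open>R 2\<close> and hence fixes the direction of
    \<open>p 0\<close>.\<close>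
  have "sympl (q 0) (q' 3) = - sympl (q 0) (q' 1) - sympl (q 0) (q' 2)" unfolding q3 by simp
  then have "m 1 0 * (R 1 * (1 - b\<^sup>2) + b\<^sup>2 * (a\<^sup>2 - 1) * R 2) = 0"
    unfolding Rs(1,2,4) R3 m20 using ne by (simp add: field_simps power2_eq_square) (algebra)
  then have R1: "R 1 * (1 - b\<^sup>2) = - (b\<^sup>2 * (a\<^sup>2 - 1) * R 2)" using n1(7) by (simp add: eq_neg_iff_add_eq_0)
  have S': "sympl (p' 2) (p' 1) = - \<eta>" "sympl (q' 2) (q' 1) = \<eta>" "sympl (q' 1) (p' 1) = 0" "sympl (q' 1) (p' 2) = 0"
    "sympl (q' 2) (p' 1) = 0" "sympl (q' 2) (p' 2) = 0" "sympl (p 0) (q' 1) = 0" "sympl (p 0) (q' 2) = 0"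
    "sympl (q 0) (p' 1) = 0" "sympl (q 0) (p' 2) = 0"
    using S pq12 sympl_commute[of "p' 2" "p' 1"] sympl_commute[of "q' 2" "q' 1"]
    by (simp_all add: p' q'_def del: One_nat_def)
  have b1: "(1 - b\<^sup>2) * \<eta> \<noteq> 0" using a2 ne by simp
  have solve: "x = (t / s) *\<^sub>R y" if "s *\<^sub>R x - t *\<^sub>R y = 0" "s \<noteq> 0" for s t and x y :: "real^4"
  proof -
    have "x = (1 / s) *\<^sub>R (s *\<^sub>R x)" using that(2) by simp
    also have "s *\<^sub>R x = t *\<^sub>R y" using that(1) by simp
    finally show ?thesis by simp
  qed
  have p0: "\<exists>s. s \<noteq> 0 \<and> p 0 = s *\<^sub>R U"
  proof -
    have "((1 - b\<^sup>2) * \<eta>) *\<^sub>R p 0 - R 2 *\<^sub>R U = 0"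
    proof (rule sympl_basis_eq_0[OF _ _ S(3-6)])
      let ?d = "((1 - b\<^sup>2) * \<eta>) *\<^sub>R p 0 - R 2 *\<^sub>R U"
      have "sympl ?d (p' 1) = \<eta> * (R 1 * (1 - b\<^sup>2) + b\<^sup>2 * (a\<^sup>2 - 1) * R 2)"
        using S S' R by (simp add: U_def algebra_simps del: One_nat_def)
      then show "sympl ?d (p' 1) = 0" unfolding R1 by simp
      show "sympl ?d (p' 2) = 0" using S S' R by (simp add: U_def algebra_simps del: One_nat_def)
    qed (use S S' ne in \<open>simp_all add: U_def del: One_nat_def\<close>)
    then have "p 0 = (R 2 / ((1 - b\<^sup>2) * \<eta>)) *\<^sub>R U" using solve[OF _ b1] by simp
    then show ?thesis using R_nz b1 by (metis divide_eq_0_iff)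
  qed
  have q0: "\<exists>s. s \<noteq> 0 \<and> q 0 = s *\<^sub>R W"
  proof -
    have R1': "m 2 0 * (1 / b) * R 1 * (1 - b\<^sup>2) = - (m 1 0 * a * R 2 * (1 - 1 / a\<^sup>2))"
    proof -
      have "m 2 0 * (1 / b) * R 1 * (1 - b\<^sup>2) = m 2 0 * (1 / b) * (R 1 * (1 - b\<^sup>2))" by simp
      also have "\<dots> = - (m 1 0 * a * R 2 * (1 - 1 / a\<^sup>2))"
        unfolding R1 m20 using ne by (simp add: field_simps power2_eq_square del: One_nat_def)
      finally show ?thesis .
    qed
    have "((1 - b\<^sup>2) * \<eta>) *\<^sub>R q 0 - (m 1 0 * a * R 2) *\<^sub>R W = 0"
    proof (rule sympl_basis_eq_0[OF _ _ S(3-6)])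
      let ?d = "((1 - b\<^sup>2) * \<eta>) *\<^sub>R q 0 - (m 1 0 * a * R 2) *\<^sub>R W"
      show "sympl ?d (q' 1) = 0"
      proof -
        have "sympl ?d (q' 1) = - \<eta> * (m 2 0 * (1 / b) * R 1 * (1 - b\<^sup>2) + m 1 0 * a * R 2 * (1 - 1 / a\<^sup>2))"
        proof -
          have "sympl ?d (q' 1) = (1 - b\<^sup>2) * \<eta> * sympl (q 0) (q' 1) - m 1 0 * a * R 2 * ((1 - 1 / a\<^sup>2) * \<eta>)"
            using S S' by (simp add: W_def del: One_nat_def)
          then show ?thesis unfolding Rs(4) by algebra
        qed
        then show ?thesis unfolding R1' by simp
      qed
      show "sympl ?d (q' 2) = 0" using S S' Rs by (simp add: W_def algebra_simps del: One_nat_def)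
    qed (use S S' ne in \<open>simp_all add: W_def del: One_nat_def\<close>)
    then have "q 0 = (m 1 0 * a * R 2 / ((1 - b\<^sup>2) * \<eta>)) *\<^sub>R W" using solve[OF _ b1] by simp
    moreover have "m 1 0 * a * R 2 / ((1 - b\<^sup>2) * \<eta>) \<noteq> 0" using R_nz b1 ne n1 by simp
    ultimately show ?thesis by blast
  qed
  have span_scale: "span {s *\<^sub>R x, t *\<^sub>R y} = span {x, y}" if "s \<noteq> 0" "t \<noteq> 0" for s t and x y :: "real^4"
  proof -
    have "u \<in> span {s *\<^sub>R x, t *\<^sub>R y} \<longleftrightarrow> u \<in> span {x, y}" for u
    proof
      assume "u \<in> span {x, y}"
      then obtain c d where "u = c *\<^sub>R x + d *\<^sub>R y" by (auto simp: span_pair_iff)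
      then have "u = (c / s) *\<^sub>R (s *\<^sub>R x) + (d / t) *\<^sub>R (t *\<^sub>R y)" using that by simp
      then show "u \<in> span {s *\<^sub>R x, t *\<^sub>R y}" unfolding span_pair_iff by blast
    next
      assume "u \<in> span {s *\<^sub>R x, t *\<^sub>R y}"
      then show "u \<in> span {x, y}" unfolding span_pair_iff by auto
    qed
    then show ?thesis by blast
  qed
  have spans: "span {p 0, q 0} = span {U, W}" using p0 q0 span_scale by metis
  have spanc: "span {X' 0 1, X' 0 2} = span {p' 1 + q' 1, p' 2 + q' 2}"
    using X'[OF r(7) \<tau>_nz(1)] X'[OF r(8) \<tau>_nz(2)] span_scale[of "1 / \<tau> 1" "1 / \<tau> 2"] \<tau>_nz by simp
  have f_span: "f y \<in> span {u', v'}" if "y \<in> span {u, v}" "f u \<in> span {u', v'}" "f v \<in> span {u', v'}" for y u v u' v'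
    using that(1) unfolding span_pair_iff[of y] by (auto simp: f_lin intro!: span_add span_scale that(2,3) Real_Vector_Spaces.span_scale)
  have "\<exists>s. f (X' i k) = s *\<^sub>R X' k i" if "i \<in> {1, 2, 3}" "k \<in> {1, 2, 3}" "i \<noteq> k" for i k
    using that f3 b3 by auto
  moreover have "f y \<in> span {U, W}" if "y \<in> span {X' 0 1, X' 0 2}" for y
    by (rule f_span[OF that[unfolded spanc]]; use o(1,2) in \<open>auto simp: span_pair_iff U_def W_def\<close>)
  moreover have "f y \<in> span {X' 0 1, X' 0 2}" if "y \<in> span {U, W}" for y
    unfolding spanc by (rule f_span[OF that]; use o(3,4) in \<open>auto simp: span_pair_iff U_def W_def\<close>)
  ultimately show ?thesis using that[OF f(1-4)] unfolding spans X'_def by blast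
qed

section \<open>Correlated circles\<close>

context lie_plucker
begin

text \<open>Both choices have the same product of slopes on any two edges at \<open>v\<close>, so at
  three edges the slopes agree up to one common sign. Two touching points determine the line, and
  with it the sign at all edges.\<close>

lemma spinor_frame_same_or_reflected:
  assumes "spinor_frame \<Phi> g c p q" "spinor_frame \<Phi> g c' p q" and v: "\<not> even_site v"
  obtains \<tau> where "\<tau> = 1 \<and> same_circle (c' v) (c v) \<or> \<tau> = -1 \<and> same_circle (c' v) (reflect (c v))"
    "\<And>n. adjacent v n \<Longrightarrow> spinor_frame.\<mu> \<Phi> c' p q v n = \<tau> * spinor_frame.\<mu> \<Phi> c p q v n"
proof -
  interpret C: spinor_frame \<Phi> g c p q by (rule assms)
  interpret C': spinor_frame \<Phi> g c' p q by (rule assms)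
  define n where "n k = v + unit_step k" for k
  have adj: "adjacent v (n k)" for k by (auto simp: adjacent_def n_def)
  have ev: "even_site (n k)" for k using adjacent_parity adj v by blast
  have dg: "diagonal (n 1) (n 2)" "diagonal (n 1) (n 3)" "diagonal (n 2) (n 3)"
    by (simp_all add: n_def diagonal_def)
  have prod: "C'.\<mu> v (n j) * C'.\<mu> v (n k) = C.\<mu> v (n j) * C.\<mu> v (n k)" if "diagonal (n j) (n k)" for j k
    using C.\<mu>_\<mu>[OF v adj[of j] adj[of k]] C'.\<mu>_\<mu>[OF v adj[of j] adj[of k]] C.sympl_p_ne[OF ev that] by (metis mult_right_cancel)
  note P = prod[OF dg(1)] prod[OF dg(2)] prod[OF dg(3)]
  have nz: "C.\<mu> v (n k) \<noteq> 0" "C'.\<mu> v (n k) \<noteq> 0" for k using C.\<mu>_nonzero C'.\<mu>_nonzero v adj by blast+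
  have "((C'.\<mu> v (n 1))\<^sup>2 - (C.\<mu> v (n 1))\<^sup>2) * (C.\<mu> v (n 2) * C.\<mu> v (n 3)) = 0" using P by algebra
  then have "(C'.\<mu> v (n 1))\<^sup>2 = (C.\<mu> v (n 1))\<^sup>2" using nz by simp
  then have "C'.\<mu> v (n 1) = 1 * C.\<mu> v (n 1) \<or> C'.\<mu> v (n 1) = -1 * C.\<mu> v (n 1)" by (auto simp: power2_eq_iff)
  then obtain \<tau> where \<tau>: "\<tau> = 1 \<or> \<tau> = -1" "C'.\<mu> v (n 1) = \<tau> * C.\<mu> v (n 1)" by blast
  have \<tau>2: "C'.\<mu> v (n 2) = \<tau> * C.\<mu> v (n 2)" using P(1) \<tau> nz[of 1] by auto
  have X1: "C'.\<mu> v (n 1) *\<^sub>R p (n 1) + q (n 1) \<in> L (c' v)" "C'.\<mu> v (n 2) *\<^sub>R p (n 2) + q (n 2) \<in> L (c' v)"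
    using C'.X_on_circle[OF v adj] unfolding C'.X_def by blast+
  have ex: "\<exists>\<tau>. (\<tau> = 1 \<and> same_circle (c' v) (c v) \<or> \<tau> = -1 \<and> same_circle (c' v) (reflect (c v))) \<and>
    (\<forall>n. adjacent v n \<longrightarrow> C'.\<mu> v n = \<tau> * C.\<mu> v n)"
  proof (cases "\<tau> = 1")
    case True
    have "L (c' v) = L (c v)"
      using C.line_c[OF v adj adj dg(1)] C'.line_c[OF v adj adj dg(1)] \<tau>(2) \<tau>2 True by (simp add: C.X_def C'.X_def)
    then have "same_circle (c' v) (c v)" using line_eq_imp_same_circle C.oriented_c C'.oriented_c v by blast
    moreover have "C'.\<mu> v m = C.\<mu> v m" if "adjacent v m" for m
    proof (rule C'.\<mu>_unique[OF v])
      show "even_site m" using adjacent_parity that v by blast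
      show "C.\<mu> v m *\<^sub>R p m + q m \<in> L (c' v)" using C.X_on_circle[OF v that] \<open>L (c' v) = L (c v)\<close> by (simp add: C.X_def)
    qed
    ultimately show ?thesis by (intro exI[of _ 1]) simp
  next
    case False
    then have m: "\<tau> = -1" using \<tau> by simp
    have S: "same_circle (c' v) (reflect (c v))"
      using C.line_reflect_c[OF v adj[of 1] adj[of 2] dg(1) C'.oriented_c[OF v]] X1 \<tau>(2) \<tau>2 m by simp
    have "C'.\<mu> v m = - C.\<mu> v m" if "adjacent v m" for m
    proof (rule C'.\<mu>_unique[OF v])
      show ev: "even_site m" using adjacent_parity that v by blast
      have "mirror (- C.\<mu> v m *\<^sub>R p m + q m) = - 1 *\<^sub>R C.X v m" using C.frame[OF ev] by (simp add: C.X_def)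
      then have "- C.\<mu> v m *\<^sub>R p m + q m \<in> L (reflect (c v))"
        unfolding line_reflect[OF C.oriented_c[OF v]]
        using line_scale[OF C.oriented_c[OF v] C.X_on_circle[OF v that], of "-1"] by simp
      then show "- C.\<mu> v m *\<^sub>R p m + q m \<in> L (c' v)" using same_circle_imp_line_eq[OF S] by simp
    qed
    then show ?thesis using S by (intro exI[of _ "-1"]) simp
  qed
  then show ?thesis using that by blast
qed

lemma spinor_frame_change:
  assumes "spinor_frame \<Phi> g c p q" "geodesic_circle_complex g c'" shows "spinor_frame \<Phi> g c' p q"
proof -
  interpret spinor_frame \<Phi> g c p q by fact
  show ?thesis by unfold_locales (use assms(2) generic_g frame in auto)
qed

text \<open>Contacts with geodesic circles are unaffected by reflection. A common point of two
  circles of a face is expanded at both geodesic corners: the \<open>q\<close> parts force equal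
  coefficients, the \<open>p\<close> parts equal slopes, against
  \<open>\<mu>_square_ne\<close>.\<close>

lemma generic_frame_change:
  assumes "generic_frame \<Phi> g c p q" "geodesic_circle_complex g c'" shows "generic_frame \<Phi> g c' p q"
proof -
  interpret C: generic_frame \<Phi> g c p q by fact
  interpret C': spinor_frame \<Phi> g c' p q using spinor_frame_change C.spinor_frame_axioms assms(2) by blast
  have pair: "same_circle (c' v) (c v) \<or> same_circle (c' v) (reflect (c v))" if "\<not> even_site v" for v
    using spinor_frame_same_or_reflected[OF C.spinor_frame_axioms C'.spinor_frame_axioms that] by metis
  have sq: "(C'.\<mu> v n)\<^sup>2 = (C.\<mu> v n)\<^sup>2" if vn: "\<not> even_site v" "adjacent v n" for v n
  proof -
    obtain \<tau> where "\<tau> = 1 \<or> \<tau> = -1" "C'.\<mu> v n = \<tau> * C.\<mu> v n"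
      using spinor_frame_same_or_reflected[OF C.spinor_frame_axioms C'.spinor_frame_axioms vn(1)] vn(2) by metis
    then show ?thesis by auto
  qed
  have gc: "contact (g n) (c' v) \<longleftrightarrow> contact (g n) (c v)" if "even_site n" "\<not> even_site v" for n v
    using pair[OF that(2)] contact_same_circle contact_reflect_geodesic[OF C.geodesic_g[OF that(1)]] by blast
  have cc: "\<not> contact (c' v) (c' v')" if v: "\<not> even_site v" and d: "diagonal v v'" for v v'
  proof
    assume ct: "contact (c' v) (c' v')"
    have v': "\<not> even_site v'" using diagonal_parity v d by blast
    obtain a j k where a: "cube_edges a" "j \<noteq> k" "v' = v + a j + a k" using diagonalE[OF d] .
    define n m where "n = v + a j" and "m = v + a k"
    have adj: "adjacent v n" "adjacent v m" "adjacent v' n" "adjacent v' m" "diagonal n m"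
    proof -
      obtain r s t where rst: "\<bar>r\<bar> = 1" "\<bar>s\<bar> = 1" "\<bar>t\<bar> = 1" "a = sign_edges r s t" using cube_edgesE a(1) by blast
      show "adjacent v n" "adjacent v m" "adjacent v' n" "adjacent v' m" "diagonal n m"
        using exhaust_3[of j] exhaust_3[of k] a(2) rst(1-3)
        by (auto simp: n_def m_def a(3) rst(4) adjacent_iff diagonal_def)
    qed
    have ev: "even_site n" "even_site m" using adjacent_parity v adj by blast+
    obtain x where x: "x \<noteq> 0" "x \<in> L (c' v)" "x \<in> L (c' v')"
      using contact_imp_common_point[OF C'.oriented_c[OF v] C'.oriented_c[OF v'] ct] .
    obtain s t where st: "x = s *\<^sub>R C'.X v n + t *\<^sub>R C'.X v m"
      using x(2) C'.line_c[OF v adj(1,2,5)] by (auto simp: span_pair_iff)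
    obtain s' t' where st': "x = s' *\<^sub>R C'.X v' n + t' *\<^sub>R C'.X v' m"
      using x(3) C'.line_c[OF v' adj(3,4,5)] by (auto simp: span_pair_iff)
    have pq: "sympl (p n) (p m) \<noteq> 0" "sympl (q n) (q m) \<noteq> 0" "sympl (p m) (p n) \<noteq> 0" "sympl (q m) (q n) \<noteq> 0"
      using C.sympl_p_ne[OF ev(1) adj(5)] C.sympl_q_ne[OF ev(1) adj(5)] sympl_commute[of "p m"] sympl_commute[of "q m"] by auto
    have e: "sympl x (q m) = s * sympl (q n) (q m)" "sympl x (q m) = s' * sympl (q n) (q m)"
      "sympl x (q n) = t * sympl (q m) (q n)" "sympl x (q n) = t' * sympl (q m) (q n)"
      "sympl x (p m) = s * C'.\<mu> v n * sympl (p n) (p m)" "sympl x (p m) = s' * C'.\<mu> v' n * sympl (p n) (p m)"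
      "sympl x (p n) = t * C'.\<mu> v m * sympl (p m) (p n)" "sympl x (p n) = t' * C'.\<mu> v' m * sympl (p m) (p n)"
      using ev by (simp add: st C'.X_def, simp add: st' C'.X_def)+
    have "s' = s" "t' = t" using e(1-4) pq by simp_all
    then have "(s * C'.\<mu> v n) * sympl (p n) (p m) = (s * C'.\<mu> v' n) * sympl (p n) (p m)"
      "(t * C'.\<mu> v m) * sympl (p m) (p n) = (t * C'.\<mu> v' m) * sympl (p m) (p n)"
      using e(5-8) \<open>s' = s\<close> \<open>t' = t\<close> by metis+
    then have "s * C'.\<mu> v n = s * C'.\<mu> v' n" "t * C'.\<mu> v m = t * C'.\<mu> v' m"
      by (simp_all only: mult_right_cancel[OF pq(1)] mult_right_cancel[OF pq(3)])
    moreover have "C'.\<mu> v n \<noteq> C'.\<mu> v' n" "C'.\<mu> v m \<noteq> C'.\<mu> v' m"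
      using C.\<mu>_square_ne[OF v _ _ d] sq v v' adj adjacent_commute by metis+
    ultimately have "s = 0" "t = 0" by auto
    then show False using x(1) st by simp
  qed
  have "generic (combine g c')"
    unfolding generic_def
  proof (intro allI impI conjI)
    fix n a and j k :: 3 assume a: "cube_edges a"
    obtain r s t where rst: "\<bar>r\<bar> = 1" "\<bar>s\<bar> = 1" "\<bar>t\<bar> = 1" "a = sign_edges r s t" using cube_edgesE a by blast
    show "\<not> contact (combine g c' n) (combine g c' (n + a j + a k))" if "j \<noteq> k"
    proof -
      have d: "diagonal n (n + a j + a k)"
        using exhaust_3[of j] exhaust_3[of k] that rst(1-3) by (auto simp: rst(4) diagonal_def)
      then have "even_site (n + a j + a k) \<longleftrightarrow> even_site n" by (rule diagonal_parity)
      then show ?thesis using C.generic_g[OF _ d] cc[OF _ d] by (cases "even_site n") simp_all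
    qed
    show "\<not> contact (combine g c' n) (combine g c' (opposite_site n a))"
    proof -
      let ?o = "opposite_site n a"
      have "adjacent n (n + a 1)" "diagonal (n + a 1) ?o"
        using rst(1-3) by (simp_all add: rst(4) opposite_site_def adjacent_iff diagonal_def)
      then have par: "even_site ?o \<longleftrightarrow> \<not> even_site n" using adjacent_parity diagonal_parity by blast
      have "\<not> contact (combine g c n) (combine g c ?o)" using C.generic a by (simp add: generic_def)
      then show ?thesis using gc[of n ?o] gc[of ?o n] par contact_commute by (cases "even_site n") simp_all
    qed
  qed
  then show ?thesis by unfold_locales
qed

end

section \<open>Correlation of opposite circles as the twisted condition\<close>

context generic_frame
begin

definition cube_\<mu> :: "site \<Rightarrow> (3 \<Rightarrow> site) \<Rightarrow> nat \<Rightarrow> nat \<Rightarrow> real" where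
  "cube_\<mu> v a i k = \<mu> (circle_vertex v a i) (geodesic_vertex v a k)"

text \<open>Ordered such that adding 3 swaps the indices of \<open>Y\<close>: opposite vertices of
  the hexagon are touching points with circle and geodesic index exchanged.\<close>

definition hexagon_point :: "site \<Rightarrow> (3 \<Rightarrow> site) \<Rightarrow> 6 \<Rightarrow> real^4" where
  "hexagon_point v a i =
     (let Y = \<lambda>i k. X (circle_vertex v a i) (geodesic_vertex v a k)
      in (vector [Y 2 1, Y 3 1, Y 3 2, Y 1 2, Y 1 3, Y 2 3] :: real^4^6) $ i)"

lemma hexagon_site_nth:
  "hexagon_site v a 1 = geodesic_vertex v a 1" "hexagon_site v a 2 = circle_vertex v a 3"
  "hexagon_site v a 3 = geodesic_vertex v a 2" "hexagon_site v a 4 = circle_vertex v a 1"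
  "hexagon_site v a 5 = geodesic_vertex v a 3" "hexagon_site v a 6 = circle_vertex v a 2"
  by (simp_all add: hexagon_site_def geodesic_vertex_def circle_vertex_def)

lemma six_arith: "(0::6) = 6" "(1::6) - 1 = 6" "(2::6) - 1 = 1" "(3::6) - 1 = 2" "(4::6) - 1 = 3" "(5::6) - 1 = 4" "(6::6) - 1 = 5"
  "(1::6) + 2 = 3" "(2::6) + 2 = 4" "(3::6) + 2 = 5" "(4::6) + 2 = 6" "(5::6) + 2 = 1" "(6::6) + 2 = 2"
  "(1::6) + 3 = 4" "(2::6) + 3 = 5" "(3::6) + 3 = 6" "(4::6) + 3 = 1" "(5::6) + 3 = 2" "(6::6) + 3 = 3"
  by simp_all

lemma hexagon_cube:
  assumes v: "\<not> even_site v" and a: "cube_edges a"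
  shows "hexagon (\<lambda>i. combine g c (hexagon_site v a i)) (hexagon_point v a)"
proof -
  note V = cube_vertices[OF a v]
  have ev: "even_site (geodesic_vertex v a k)" "\<not> even_site (circle_vertex v a k)" if "k \<in> {..<4}" for k
    using V(2)[of "if k = 0 then 1 else 0" k] V(1)[of k "if k = 0 then 1 else 0"] that by auto
  let ?G = "\<lambda>k. g (geodesic_vertex v a k)" and ?C = "\<lambda>k. c (circle_vertex v a k)"
  have G: "oriented_circle (?G k)" if "k \<in> {..<4}" for k using ev that oriented_g by blast
  have C: "oriented_circle (?C k)" if "k \<in> {..<4}" for k using ev that oriented_c by blast
  have GG: "\<not> contact (?G i) (?G k)" if "i \<in> {..<4}" "k \<in> {..<4}" "i \<noteq> k" for i k
    using generic_diagonal[OF generic V(5)[OF that]] ev that by simp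
  have CC: "\<not> contact (?C i) (?C k)" if "i \<in> {..<4}" "k \<in> {..<4}" "i \<noteq> k" for i k
    using generic_diagonal[OF generic V(4)[OF that]] ev that by simp
  have M: "meets_in (L (?C i)) (L (?G k)) (X (circle_vertex v a i) (geodesic_vertex v a k))"
    "meets_in (L (?G k)) (L (?C i)) (X (circle_vertex v a i) (geodesic_vertex v a k))"
    if "i \<in> {..<4}" "k \<in> {..<4}" "i \<noteq> k" for i k
    using meets_X[OF V(1)[OF that] V(3)[OF that]] by blast+
  show ?thesis unfolding hexagon_def forall_6 six_arith hexagon_site_nth hexagon_point_def Let_def vector_6
    using ev G C GG CC M by simp
qed

lemma twisted_imp_correlated:
  assumes v: "\<not> even_site v" and a: "cube_edges a" and w: "twisted (cube_\<mu> v a)"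
  shows "correlated_in_cube \<Phi> (combine g c) v a"
proof -
  note V = cube_vertices[OF a v]
  obtain f \<kappa> where f: "linear f" "\<And>y z. sympl (f y) z = sympl (f z) y" "\<And>y. f (f y) = \<kappa> *\<^sub>R y" "\<kappa> \<noteq> 0"
    and h: "\<And>i k. i \<in> {1, 2, 3} \<Longrightarrow> k \<in> {1, 2, 3} \<Longrightarrow> i \<noteq> k \<Longrightarrow>
      \<exists>s. f (X (circle_vertex v a i) (geodesic_vertex v a k)) = s *\<^sub>R X (circle_vertex v a k) (geodesic_vertex v a i)"
    and o: "\<And>y. y \<in> span {X (circle_vertex v a 0) (geodesic_vertex v a 1), X (circle_vertex v a 0) (geodesic_vertex v a 2)} \<Longrightarrow>
      f y \<in> span {p (geodesic_vertex v a 0), q (geodesic_vertex v a 0)}"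
    "\<And>y. y \<in> span {p (geodesic_vertex v a 0), q (geodesic_vertex v a 0)} \<Longrightarrow>
      f y \<in> span {X (circle_vertex v a 0) (geodesic_vertex v a 1), X (circle_vertex v a 0) (geodesic_vertex v a 2)}"
    by (rule tetra_correlation[OF tetra_cube[OF v a] w[unfolded cube_\<mu>_def[abs_def]], folded X_def])
      (rule that, assumption+)
  have c: "circle_vertex v a 0 = v" "geodesic_vertex v a 0 = opposite_site v a"
    by (simp_all add: circle_vertex_def geodesic_vertex_def opposite_site_def)
  have ev: "even_site (opposite_site v a)" using V(2)[of 1 0] c by simp
  have Lc: "L (c v) = span {X (circle_vertex v a 0) (geodesic_vertex v a 1), X (circle_vertex v a 0) (geodesic_vertex v a 2)}"
    using line_c[OF v, of "geodesic_vertex v a 1" "geodesic_vertex v a 2"] V(3)[of 0 1] V(3)[of 0 2] V(5)[of 1 2] by (simp add: c)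
  have Lg: "L (g (opposite_site v a)) = span {p (geodesic_vertex v a 0), q (geodesic_vertex v a 0)}"
    using line_g[OF ev] by (simp add: c)
  note H = hexagon_cube[OF v a]
  have "\<exists>t. t \<noteq> 0 \<and> f (hexagon_point v a i) = t *\<^sub>R hexagon_point v a (i + 3)" for i
  proof -
    have "\<exists>t. f (hexagon_point v a 1) = t *\<^sub>R hexagon_point v a 4" "\<exists>t. f (hexagon_point v a 2) = t *\<^sub>R hexagon_point v a 5"
      "\<exists>t. f (hexagon_point v a 3) = t *\<^sub>R hexagon_point v a 6" "\<exists>t. f (hexagon_point v a 4) = t *\<^sub>R hexagon_point v a 1"
      "\<exists>t. f (hexagon_point v a 5) = t *\<^sub>R hexagon_point v a 2" "\<exists>t. f (hexagon_point v a 6) = t *\<^sub>R hexagon_point v a 3"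
      unfolding hexagon_point_def Let_def vector_6 by (rule h; simp)+
    then have "\<exists>t. f (hexagon_point v a i) = t *\<^sub>R hexagon_point v a (i + 3)"
      using exhaust_6[of i] six_arith by metis
    then obtain t where t: "f (hexagon_point v a i) = t *\<^sub>R hexagon_point v a (i + 3)" by blast
    have "t \<noteq> 0"
    proof
      assume "t = 0"
      then have "f (hexagon_point v a i) = 0" using t by simp
      then have "\<kappa> *\<^sub>R hexagon_point v a i = 0" using f(3)[of "hexagon_point v a i"] linear_0[OF f(1)] by simp
      then show False using f(4) hexagonD(3)[OF H] by simp
    qed
    then show ?thesis using t by blast
  qed
  then show ?thesis unfolding correlated_in_cube_def
    using v ev oriented_c oriented_g o Lc Lg
    by (intro correlatedI[OF H f]) auto
qed

end

text \<open>For the converse reflect \<open>c v\<close>. If the cube is not twisted, it becomes so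
  by the reflection, since the two sides of the condition agree up to sign; then both circles are
  correlated to the same geodesic circle, contrary to \<open>correlated_unique\<close>.\<close>

lemma (in lie_plucker) correlated_in_cube_iff:
  assumes "generic_frame \<Phi> g c p q" and v: "\<not> even_site v" and a: "cube_edges a"
  shows "correlated_in_cube \<Phi> (combine g c) v a \<longleftrightarrow> twisted (generic_frame.cube_\<mu> \<Phi> c p q v a)"
proof
  interpret C: generic_frame \<Phi> g c p q by fact
  show "twisted (C.cube_\<mu> v a) \<Longrightarrow> correlated_in_cube \<Phi> (combine g c) v a"
    using C.twisted_imp_correlated[OF v a] .
  assume cor: "correlated_in_cube \<Phi> (combine g c) v a"
  note V = cube_vertices[OF a v]
  define c' where "c' = c(v := reflect (c v))"
  have "geodesic_circle_complex g c'"
    using C.complex contact_reflect_geodesic oriented_circle_reflect unfolding geodesic_circle_complex_def c'_def by auto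
  then interpret C': generic_frame \<Phi> g c' p q using generic_frame_change[OF assms(1)] by blast
  have cv: "circle_vertex v a 0 = v" by (simp add: circle_vertex_def)
  have other: "circle_vertex v a i \<noteq> v" if "i \<in> {1, 2, 3}" for i
    using V(4)[of 0 i] that by (auto simp: cv diagonal_def)
  have \<mu>_other: "C'.cube_\<mu> v a i k = C.cube_\<mu> v a i k" if "i \<in> {1, 2, 3}" for i k
  proof -
    have "c' (circle_vertex v a i) = c (circle_vertex v a i)" using other[OF that] by (simp add: c'_def)
    then show ?thesis by (simp only: C.cube_\<mu>_def C'.cube_\<mu>_def C.\<mu>_def C'.\<mu>_def)
  qed
  have \<mu>_v: "C'.cube_\<mu> v a 0 k = - C.cube_\<mu> v a 0 k" if k: "k \<in> {1, 2, 3}" for k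
  proof -
    obtain \<tau> where \<tau>: "\<tau> = 1 \<and> same_circle (c' v) (c v) \<or> \<tau> = -1 \<and> same_circle (c' v) (reflect (c v))"
      "\<And>n. adjacent v n \<Longrightarrow> C'.\<mu> v n = \<tau> * C.\<mu> v n"
      using spinor_frame_same_or_reflected[OF C.spinor_frame_axioms C'.spinor_frame_axioms v] by blast
    have "\<not> same_circle (c' v) (c v)"
      using not_same_circle_reflect C.oriented_c[OF v] C.c_not_geodesic[OF v] by (simp add: c'_def)
    then have "\<tau> = -1" using \<tau> by blast
    moreover have "adjacent v (geodesic_vertex v a k)" using V(3)[of 0 k] k by (auto simp: cv)
    ultimately show ?thesis using \<tau>(2) by (simp add: C.cube_\<mu>_def C'.cube_\<mu>_def cv)
  qed
  show "twisted (C.cube_\<mu> v a)"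
  proof (rule ccontr)
    assume nt: "\<not> twisted (C.cube_\<mu> v a)"
    have sq: "(C.cube_\<mu> v a 1 2 * C.cube_\<mu> v a 2 3 * C.cube_\<mu> v a 3 1)\<^sup>2 = (C.cube_\<mu> v a 0 1 * C.cube_\<mu> v a 0 2 * C.cube_\<mu> v a 0 3)\<^sup>2"
      using tetra_squares[OF C.tetra_cube[OF v a]] unfolding C.cube_\<mu>_def .
    then have "twisted (C'.cube_\<mu> v a)"
      using nt by (auto simp: twisted_def \<mu>_other \<mu>_v power2_eq_iff)
    then have cor': "correlated_in_cube \<Phi> (combine g c') v a" by (rule C'.twisted_imp_correlated[OF v a])
    have hs: "combine g c' (hexagon_site v a i) = combine g c (hexagon_site v a i)" for i
    proof -
      have "geodesic_vertex v a k \<noteq> v" if "k \<in> {1, 2, 3}" for k using V(2)[of 0 k] v that by auto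
      then have "hexagon_site v a i \<noteq> v"
        using exhaust_6[of i] other by (elim disjE) (simp_all add: C.hexagon_site_nth)
      then show ?thesis by (simp add: combine_def c'_def)
    qed
    have evo: "even_site (opposite_site v a)" using V(2)[of 1 0] by (simp add: geodesic_vertex_def opposite_site_def)
    have "same_circle (c v) (c' v)"
      using correlated_unique[OF C.hexagon_cube[OF v a] C.oriented_c[OF v] C'.oriented_c[OF v],
          of "g (opposite_site v a)"] cor cor' v evo
      unfolding correlated_in_cube_def hs by simp
    then have "same_circle (reflect (c v)) (c v)" by (metis c'_def fun_upd_same same_circle_sym)
    then show False
      using not_same_circle_reflect[OF C.oriented_c[OF v] C.c_not_geodesic[OF v]] by blast
  qed
qed

section \<open>Flat connections and signs on the lattice\<close>

lemma product_potential:
  fixes u :: "int \<Rightarrow> real"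
  assumes "\<And>i. u i \<noteq> 0"
  shows "\<exists>f. (\<forall>i. f i \<noteq> 0) \<and> (\<forall>i. f (i + 1) = u i * f i)"
proof -
  define f where "f i = (if 0 \<le> i then \<Prod>k\<in>{0..<i}. u k else \<Prod>k\<in>{i..<0}. 1 / u k)" for i
  have "f i \<noteq> 0" for i using assms by (simp add: f_def)
  moreover have "f (i + 1) = u i * f i" for i
  proof (cases "0 \<le> i")
    case True
    then have "{0..<i + 1} = insert i {0..<i}" by auto
    then show ?thesis using True by (simp add: f_def)
  next
    case False
    then have "{i..<0} = insert i {i + 1..<0}" by auto
    then have "f i = 1 / u i * (\<Prod>k\<in>{i + 1..<0}. 1 / u k)" using False by (simp add: f_def)
    moreover have "f (i + 1) = (\<Prod>k\<in>{i + 1..<0}. 1 / u k)"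
      using False by (cases "i = -1") (simp_all add: f_def)
    ultimately show ?thesis using assms[of i] by simp
  qed
  ultimately show ?thesis by blast
qed

text \<open>Induction over the directions: the defect \<open>r\<close> of a potential for the old
  directions is constant along these, so it can be integrated along the new axis. The set of
  directions is a parameter because signs use all three directions, the scales of the intersection
  points only two.\<close>

lemma flat_connection_potential:
  fixes A :: "3 \<Rightarrow> site \<Rightarrow> real" and D :: "3 set"
  assumes nz: "\<And>l n. l \<in> D \<Longrightarrow> A l n \<noteq> 0"
    and flat: "\<And>l m n. l \<in> D \<Longrightarrow> m \<in> D \<Longrightarrow> A l n * A m (n + unit_step l) = A m n * A l (n + unit_step m)"
  shows "\<exists>\<theta>. (\<forall>n. \<theta> n \<noteq> 0) \<and> (\<forall>l\<in>D. \<forall>n. \<theta> (n + unit_step l) = A l n * \<theta> n)"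
proof -
  have "finite D" by simp
  then show ?thesis using nz flat
  proof (induction D rule: finite_induct)
    case empty
    show ?case by (intro exI[of _ "\<lambda>_. 1"]) simp
  next
    case (insert d D)
    then obtain \<theta> where \<theta>: "\<And>n. \<theta> n \<noteq> 0" "\<And>l n. l \<in> D \<Longrightarrow> \<theta> (n + unit_step l) = A l n * \<theta> n"
      by (metis insertCI)
    define r where "r n = \<theta> (n + unit_step d) / (A d n * \<theta> n)" for n
    have r_nz: "r n \<noteq> 0" for n using \<theta>(1) insert.prems(1)[of d] by (simp add: r_def)
    have r_inv: "r (n + unit_step l) = r n" if l: "l \<in> D" for l n
    proof -
      have "A d n * A l (n + unit_step d) = A l n * A d (n + unit_step l)"
        using insert.prems(2)[of d l n] l by simp
      moreover have "\<theta> (n + unit_step l + unit_step d) = A l (n + unit_step d) * \<theta> (n + unit_step d)"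
        using \<theta>(2)[OF l, of "n + unit_step d"] by (simp add: algebra_simps)
      moreover have "\<theta> (n + unit_step l) = A l n * \<theta> n" using \<theta>(2)[OF l] .
      moreover have "A d n \<noteq> 0" "A d (n + unit_step l) \<noteq> 0" "A l n \<noteq> 0" using insert.prems(1) l by auto
      ultimately show ?thesis using \<theta>(1)[of n] unfolding r_def by (simp add: frac_eq_eq) algebra
    qed
    define base where "base n = n - (n $ d) *s unit_step d" for n :: site
    have "\<exists>f. (\<forall>i. f i \<noteq> 0) \<and> (\<forall>i. f (i + 1) = 1 / r (base n + i *s unit_step d) * f i)" for n
      using product_potential[of "\<lambda>i. 1 / r (base n + i *s unit_step d)"] r_nz by simp
    then obtain f where f: "\<And>n i. f n i \<noteq> 0" "\<And>n i. f n (i + 1) = 1 / r (base n + i *s unit_step d) * f n i" by metis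
    \<comment> \<open>Normalised to 1 where coordinate \<open>d\<close> is 0, so that the choice of
      \<open>f\<close> leaves no ambiguity and \<open>F\<close> inherits the invariance of
      \<open>r\<close>.\<close>
    define F where "F n = f (base n) (n $ d) / f (base n) 0" for n
    have f0: "f n i / f n 0 = f n' i / f n' 0" if "\<And>j. r (base n + j *s unit_step d) = r (base n' + j *s unit_step d)" for n n' i
    proof -
      have "f n i * f n' 0 = f n' i * f n 0"
      proof (induction i rule: int_induct[where k = 0])
        case (step1 i)
        then show ?case by (simp add: f(2) that)
      next
        case (step2 i)
        have e: "f n (i - 1 + 1) = 1 / r (base n + (i - 1) *s unit_step d) * f n (i - 1)"
          "f n' (i - 1 + 1) = 1 / r (base n' + (i - 1) *s unit_step d) * f n' (i - 1)"
          by (rule f(2))+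
        have "f n (i - 1) = r (base n' + (i - 1) *s unit_step d) * f n i"
          "f n' (i - 1) = r (base n' + (i - 1) *s unit_step d) * f n' i"
          using e(1)[unfolded that] e(2) r_nz by simp_all
        then show ?case using step2.IH by simp
      qed simp
      then show ?thesis using f(1) by (simp add: frac_eq_eq)
    qed
    have ud: "unit_step k $ k = 1" "k \<noteq> k' \<Longrightarrow> unit_step k $ k' = 0" for k k' :: 3
      by (simp_all add: unit_step_def axis_def)
    have base_d: "base (n + unit_step d) = base n" for n
      by (simp add: base_def ud vec_eq_iff algebra_simps)
    have base_base: "base (base n) = base n" for n by (simp add: base_def ud)
    have base_l: "base (n + unit_step l) = base n + unit_step l" if "l \<noteq> d" for n l
      using that by (simp add: base_def ud vec_eq_iff)
    have base_n: "base n + (n $ d) *s unit_step d = n" for n by (simp add: base_def)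
    have F_d: "F (n + unit_step d) = F n / r n" for n
    proof -
      have "f (base n) (n $ d + 1) = 1 / r n * f (base n) (n $ d)" using f(2)[of "base n" "n $ d"] by (simp add: base_base base_n)
      then show ?thesis by (simp add: F_def base_d ud)
    qed
    have F_l: "F (n + unit_step l) = F n" if l: "l \<in> D" for n l
    proof -
      have ld: "l \<noteq> d" using insert.hyps l by blast
      have "r (base (base n + unit_step l) + j *s unit_step d) = r (base (base n) + j *s unit_step d)" for j
        unfolding base_l[OF ld] base_base using r_inv[OF l, of "base n + j *s unit_step d"] by (simp add: ac_simps)
      then show ?thesis using f0[of "base n + unit_step l" "base n" "n $ d"] ld
        by (simp add: F_def base_l[OF ld] ud)
    qed
    show ?case
    proof (intro exI[of _ "\<lambda>n. \<theta> n * F n"] conjI ballI allI)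
      show "\<theta> n * F n \<noteq> 0" for n using \<theta>(1) f(1) by (simp add: F_def)
      fix l n assume "l \<in> insert d D"
      then show "\<theta> (n + unit_step l) * F (n + unit_step l) = A l n * (\<theta> n * F n)"
      proof
        assume "l = d"
        then show ?thesis using F_d[of n] r_nz[of n] \<theta>(1) insert.prems(1)[of d n] by (simp add: r_def)
      next
        assume "l \<in> D" then show ?thesis using F_l \<theta>(2) by simp
      qed
    qed
  qed
qed

section \<open>The signs of the slopes as a potential\<close>

context generic_frame
begin

definition sign_potential :: "(site \<Rightarrow> real) \<Rightarrow> bool" where
  "sign_potential \<kappa> \<longleftrightarrow> (\<forall>n. \<kappa> n = 1 \<or> \<kappa> n = -1) \<and>
     (\<forall>v n. \<not> even_site v \<and> adjacent v n \<longrightarrow> sgn (\<mu> v n) = \<kappa> v * \<kappa> n)"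

lemma \<mu>_face:
  assumes "\<not> even_site v" "\<not> even_site v'" "adjacent v n" "adjacent v n'" "adjacent v' n" "adjacent v' n'" "diagonal n n'"
  shows "\<mu> v n * \<mu> v n' = \<mu> v' n * \<mu> v' n'"
proof -
  have "even_site n" using adjacent_parity assms by blast
  then show ?thesis using \<mu>_\<mu>[OF assms(1,3,4)] \<mu>_\<mu>[OF assms(2,5,6)] sympl_p_ne[OF _ assms(7)]
    by (metis mult_right_cancel)
qed

text \<open>Around a face the two products in \<open>\<mu>_face\<close> agree, so the signs of the
  slopes form a flat connection.\<close>

lemma sign_potential_exists: "\<exists>\<kappa>. sign_potential \<kappa>"
proof -
  define e where "e m n = sgn (if even_site m then \<mu> n m else \<mu> m n)" for m n
  define A where "A l n = e n (n + unit_step l)" for l n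
  have e_commute: "e m n = e n m" if "adjacent m n" for m n
    using adjacent_parity[OF that] by (auto simp: e_def)
  have e_sign: "e m n = 1 \<or> e m n = -1" if "adjacent m n" for m n
    using \<mu>_nonzero that adjacent_parity[OF that] adjacent_commute by (auto simp: e_def sgn_real_def)
  have adj: "adjacent n (n + unit_step l)" for n l by (auto simp: adjacent_def)
  have "A l n * A m (n + unit_step l) = A m n * A l (n + unit_step m)" for l m n
  proof (cases "l = m")
    case False
    let ?l = "n + unit_step l" and ?m = "n + unit_step m" and ?lm = "n + unit_step l + unit_step m"
    have d: "adjacent ?l ?lm" "adjacent ?m ?lm" "adjacent n ?l" "adjacent n ?m" "diagonal ?l ?m" "diagonal n ?lm"
      using False exhaust_3[of l] exhaust_3[of m] by (auto simp: adjacent_iff diagonal_def)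
    note d' = d(1-4)[unfolded adjacent_commute[of n] adjacent_commute[of _ ?lm]] d(1-4)
    have AA: "A l n * A m ?l = e n ?l * e ?l ?lm" "A m n * A l ?m = e n ?m * e ?m ?lm"
      by (simp_all add: A_def algebra_simps)
    show ?thesis
    proof (cases "even_site n")
      case True
      then have o: "\<not> even_site ?l" "\<not> even_site ?m" using adjacent_parity d by blast+
      have "\<mu> ?l n * \<mu> ?l ?lm = \<mu> ?m n * \<mu> ?m ?lm"
        by (rule \<mu>_face[OF o]) (use d adjacent_commute in blast)+
      then have "sgn (\<mu> ?l n) * sgn (\<mu> ?l ?lm) = sgn (\<mu> ?m n) * sgn (\<mu> ?m ?lm)" by (metis sgn_mult)
      then show ?thesis unfolding AA using True o by (simp add: e_def)
    next
      case False
      have o: "\<not> even_site ?lm" using False d diagonal_parity by blast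
      have ev: "even_site ?l" "even_site ?m" using False adjacent_parity d by blast+
      have "\<mu> n ?l * \<mu> n ?m = \<mu> ?lm ?l * \<mu> ?lm ?m"
        by (rule \<mu>_face[OF False o]) (use d adjacent_commute in blast)+
      then have s: "sgn (\<mu> n ?l) * sgn (\<mu> n ?m) = sgn (\<mu> ?lm ?l) * sgn (\<mu> ?lm ?m)" by (metis sgn_mult)
      have "e n ?l * e n ?m = e ?l ?lm * e ?m ?lm" using s False ev by (simp add: e_def)
      then show ?thesis unfolding AA using e_sign[OF d(1)] e_sign[OF d(2)] e_sign[OF d(3)] e_sign[OF d(4)] by auto
    qed
  qed simp
  moreover have "A l n \<noteq> 0" for l n using e_sign[OF adj[of n l]] by (auto simp: A_def)
  ultimately obtain \<theta> where \<theta>: "\<And>n. \<theta> n \<noteq> 0" "\<And>l n. \<theta> (n + unit_step l) = A l n * \<theta> n"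
    using flat_connection_potential[of UNIV A] by auto
  have e_\<theta>: "e m n = sgn (\<theta> m) * sgn (\<theta> n)" if mn: "adjacent m n" for m n
  proof -
    have *: "e m (m + unit_step k) = sgn (\<theta> m) * sgn (\<theta> (m + unit_step k))" for m k
      using e_sign[OF adj[of m k]] \<theta>(1)[of m] by (auto simp: \<theta>(2) A_def sgn_mult sgn_real_def)
    from mn obtain k where "n = m + unit_step k \<or> m = n + unit_step k" by (auto simp: adjacent_def)
    then show ?thesis using *[of m k] *[of n k] e_commute[OF mn] by auto
  qed
  have "sign_potential (\<lambda>n. sgn (\<theta> n))"
    unfolding sign_potential_def
  proof (intro conjI allI impI)
    show "sgn (\<theta> n) = 1 \<or> sgn (\<theta> n) = -1" for n using \<theta>(1)[of n] by (simp add: sgn_real_def)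
    show "sgn (\<mu> v n) = sgn (\<theta> v) * sgn (\<theta> n)" if "\<not> even_site v \<and> adjacent v n" for v n
      using e_\<theta>[of v n] that by (simp add: e_def)
  qed
  then show ?thesis by blast
qed

text \<open>The signs of the three geodesic circles next to \<open>v\<close> occur on both sides of
  \<open>twisted\<close> and cancel; the sign at \<open>v\<close> occurs to the third power.\<close>

lemma twisted_iff_sign_product:
  assumes \<kappa>: "sign_potential \<kappa>" and v: "\<not> even_site v" and a: "cube_edges a"
  shows "twisted (cube_\<mu> v a) \<longleftrightarrow> \<kappa> v * \<kappa> (v + a 1 + a 2) * \<kappa> (v + a 2 + a 3) * \<kappa> (v + a 3 + a 1) = -1"
proof -
  note V = cube_vertices[OF a v]
  define x y where "x i = \<kappa> (circle_vertex v a i)" and "y k = \<kappa> (geodesic_vertex v a k)" for i k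
  let ?m = "cube_\<mu> v a"
  have sg: "sgn (?m i k) = x i * y k" if "i \<in> {..<4}" "k \<in> {..<4}" "i \<noteq> k" for i k
    using \<kappa> V(1,3)[OF that] by (simp add: sign_potential_def cube_\<mu>_def x_def y_def)
  have nz: "?m i k \<noteq> 0" if "i \<in> {..<4}" "k \<in> {..<4}" "i \<noteq> k" for i k
    using \<mu>_nonzero[OF V(1)[OF that] V(3)[OF that]] by (simp add: cube_\<mu>_def)
  have xy: "x i = 1 \<or> x i = -1" "y i = 1 \<or> y i = -1" for i using \<kappa> by (simp_all add: sign_potential_def x_def y_def)
  define l r where "l = ?m 1 2 * ?m 2 3 * ?m 3 1" and "r = ?m 0 1 * ?m 0 2 * ?m 0 3"
  have "sgn (?m 1 2) = x 1 * y 2" "sgn (?m 2 3) = x 2 * y 3" "sgn (?m 3 1) = x 3 * y 1"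
    "sgn (?m 0 1) = x 0 * y 1" "sgn (?m 0 2) = x 0 * y 2" "sgn (?m 0 3) = x 0 * y 3" by (rule sg; simp)+
  then have s: "sgn l = x 1 * x 2 * x 3 * (y 1 * y 2 * y 3)" "sgn r = x 0 * x 0 * x 0 * (y 1 * y 2 * y 3)"
    by (simp_all add: l_def r_def sgn_mult)
  have "l\<^sup>2 = r\<^sup>2"
    using tetra_squares[OF tetra_cube[OF v a]] unfolding cube_\<mu>_def l_def r_def .
  then have lr: "l = r \<or> l = - r" by (simp add: power2_eq_iff)
  have rnz: "r \<noteq> 0" unfolding r_def using nz[of 0 1] nz[of 0 2] nz[of 0 3] by simp
  have "twisted ?m \<longleftrightarrow> l = - r" by (simp add: twisted_def l_def r_def)
  also have "\<dots> \<longleftrightarrow> sgn l = - sgn r" using lr rnz by (auto simp: sgn_minus sgn_0_0)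
  also have "\<dots> \<longleftrightarrow> x 0 * x 3 * x 1 * x 2 = -1"
    unfolding s using xy[of 0] xy[of 1] xy[of 2] xy[of 3] by (elim disjE) (simp_all add: s)
  finally show ?thesis by (simp add: x_def circle_vertex_def)
qed

end

section \<open>The combinatorics of the Cauchy data\<close>

text \<open>Coordinates relative to the centre of the data. As \<open>w\<close> is an odd site,
  parities are reversed: even coordinate sums belong to circles.\<close>

definition site_at :: "site \<Rightarrow> int \<Rightarrow> int \<Rightarrow> int \<Rightarrow> site" where
  "site_at w x y z = w + vector [x, y, z]"

lemma site_at_nth [simp]:
  "site_at w x y z $ 1 = w $ 1 + x" "site_at w x y z $ 2 = w $ 2 + y" "site_at w x y z $ 3 = w $ 3 + z"
  by (simp_all add: site_at_def)

lemma site_at_eq: "n = site_at w (n $ 1 - w $ 1) (n $ 2 - w $ 2) (n $ 3 - w $ 3)"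
  by (simp add: site_eq_iff)

lemma site_at_shift:
  "site_at w x y z + r *s unit_step 1 = site_at w (x + r) y z"
  "site_at w x y z + r *s unit_step 2 = site_at w x (y + r) z"
  "site_at w x y z + r *s unit_step 3 = site_at w x y (z + r)"
  by (simp_all add: site_eq_iff)

text \<open>The star region relative to \<open>w\<close>, one disjunct per sector, with the
  parameters \<open>i\<close>, \<open>j\<close> eliminated so that integer arithmetic decides
  membership. The sum is 1 because \<open>w\<close> lies one layer below the data.\<close>

definition in_star :: "int \<Rightarrow> int \<Rightarrow> int \<Rightarrow> bool" where
  "in_star x y z \<longleftrightarrow> x + y + z = 1 \<and>
     (0 \<le> x \<and> z \<le> 1 \<and> (x \<le> 1 \<or> 0 \<le> z) \<or> 0 \<le> y \<and> x \<le> 1 \<and> (y \<le> 1 \<or> 0 \<le> x) \<or> 0 \<le> z \<and> y \<le> 1 \<and> (z \<le> 1 \<or> 0 \<le> y))"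

lemma site_at_in_star_region: "site_at w x y z \<in> star_region w \<longleftrightarrow> in_star x y z"
proof -
  have f: "w + unit_step 3 + i *s f1 + j *s f2 = site_at w i (j - i) (1 - j)"
    "w + unit_step 1 + i *s f2 + j *s f3 = site_at w (1 - j) i (j - i)"
    "w + unit_step 2 + i *s f3 + j *s f1 = site_at w (j - i) (1 - j) i" for i j
    by (simp_all add: site_eq_iff f1_def f2_def f3_def)
  have s: "site_at w x y z = site_at w x' y' z' \<longleftrightarrow> x = x' \<and> y = y' \<and> z = z'" for x' y' z'
    by (simp add: site_eq_iff)
  have 1: "(\<exists>i j. (x = i \<and> y = j - i \<and> z = 1 - j) \<and> 0 \<le> i \<and> 0 \<le> j \<and> min i j \<le> 1) \<longleftrightarrow>
    x + y + z = 1 \<and> 0 \<le> x \<and> z \<le> 1 \<and> (x \<le> 1 \<or> 0 \<le> z)"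
  proof -
    have "(\<exists>i j. (x = i \<and> y = j - i \<and> z = 1 - j) \<and> P i j) \<longleftrightarrow> x + y + z = 1 \<and> P x (1 - z)" for P
    proof
      assume "x + y + z = 1 \<and> P x (1 - z)"
      then show "\<exists>i j. (x = i \<and> y = j - i \<and> z = 1 - j) \<and> P i j"
        by (intro exI[of _ x] exI[of _ "1 - z"]) simp
    qed auto
    from this[of "\<lambda>i j. 0 \<le> i \<and> 0 \<le> j \<and> min i j \<le> 1"] show ?thesis
      by (simp only: min_le_iff_disj) auto
  qed
  have 2: "(\<exists>i j. (x = 1 - j \<and> y = i \<and> z = j - i) \<and> 0 \<le> i \<and> 0 \<le> j \<and> min i j \<le> 1) \<longleftrightarrow>
    x + y + z = 1 \<and> 0 \<le> y \<and> x \<le> 1 \<and> (y \<le> 1 \<or> 0 \<le> x)"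
  proof -
    have "(\<exists>i j. (x = 1 - j \<and> y = i \<and> z = j - i) \<and> P i j) \<longleftrightarrow> x + y + z = 1 \<and> P y (1 - x)" for P
    proof
      assume "x + y + z = 1 \<and> P y (1 - x)"
      then show "\<exists>i j. (x = 1 - j \<and> y = i \<and> z = j - i) \<and> P i j"
        by (intro exI[of _ y] exI[of _ "1 - x"]) simp
    qed auto
    from this[of "\<lambda>i j. 0 \<le> i \<and> 0 \<le> j \<and> min i j \<le> 1"] show ?thesis
      by (simp only: min_le_iff_disj) auto
  qed
  have 3: "(\<exists>i j. (x = j - i \<and> y = 1 - j \<and> z = i) \<and> 0 \<le> i \<and> 0 \<le> j \<and> min i j \<le> 1) \<longleftrightarrow>
    x + y + z = 1 \<and> 0 \<le> z \<and> y \<le> 1 \<and> (z \<le> 1 \<or> 0 \<le> y)"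
  proof -
    have "(\<exists>i j. (x = j - i \<and> y = 1 - j \<and> z = i) \<and> P i j) \<longleftrightarrow> x + y + z = 1 \<and> P z (1 - y)" for P
    proof
      assume "x + y + z = 1 \<and> P z (1 - y)"
      then show "\<exists>i j. (x = j - i \<and> y = 1 - j \<and> z = i) \<and> P i j"
        by (intro exI[of _ z] exI[of _ "1 - y"]) simp
    qed auto
    from this[of "\<lambda>i j. 0 \<le> i \<and> 0 \<le> j \<and> min i j \<le> 1"] show ?thesis
      by (simp only: min_le_iff_disj) auto
  qed
  have "site_at w x y z \<in> star_region w \<longleftrightarrow>
    ((\<exists>i j. (x = i \<and> y = j - i \<and> z = 1 - j) \<and> 0 \<le> i \<and> 0 \<le> j \<and> min i j \<le> 1) \<or> (\<exists>i j. (x = 1 - j \<and> y = i \<and> z = j - i) \<and> 0 \<le> i \<and> 0 \<le> j \<and> min i j \<le> 1)) \<or> (\<exists>i j. (x = j - i \<and> y = 1 - j \<and> z = i) \<and> 0 \<le> i \<and> 0 \<le> j \<and> min i j \<le> 1)"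
    unfolding star_region_def f Un_iff mem_Collect_eq s ..
  then show ?thesis unfolding 1 2 3 in_star_def by blast
qed

lemma star_region_A2: "w \<in> A2 (-1) \<Longrightarrow> n \<in> star_region w \<Longrightarrow> n \<in> A2 0"
  using site_at_in_star_region[of w "n $ 1 - w $ 1" "n $ 2 - w $ 2" "n $ 3 - w $ 3"]
  by (simp add: in_star_def A2_def flip: site_at_eq)

text \<open>Three rays of circles below and three above the plane of the data. They start at the
  circles of the central cube: the lower ones at (0, 0, 0), the upper ones at (1, 0, 1), (1, 1, 0)
  and (0, 1, 1).\<close>

definition on_data_rays :: "int \<Rightarrow> int \<Rightarrow> int \<Rightarrow> bool" where
  "on_data_rays x y z \<longleftrightarrow>
     x + y + z = 0 \<and> (0 \<le> x \<and> z = 0 \<or> 0 \<le> y \<and> x = 0 \<or> 0 \<le> z \<and> y = 0) \<or>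
     x + y + z = 2 \<and> (1 \<le> x \<and> z = 1 \<or> 1 \<le> y \<and> x = 1 \<or> 1 \<le> z \<and> y = 1)"

lemma lower_triangle_in_star:
  assumes "x + y + z = 0"
  shows "in_star (x + 1) y z \<and> in_star x (y + 1) z \<and> in_star x y (z + 1) \<longleftrightarrow> on_data_rays x y z"
proof -
  have y: "y = - x - z" using assms by simp
  show ?thesis unfolding in_star_def on_data_rays_def y by presburger
qed

lemma upper_triangle_in_star:
  assumes "x + y + z = 2"
  shows "in_star (x - 1) y z \<and> in_star x (y - 1) z \<and> in_star x y (z - 1) \<longleftrightarrow> on_data_rays x y z"
proof -
  have y: "y = 2 - x - z" using assms by simp
  show ?thesis unfolding in_star_def on_data_rays_def y by presburger
qed

lemma data_circle_sites_iff:
  assumes w: "w \<in> A2 (-1)"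
  shows "site_at w x y z \<in> data_circle_sites w \<longleftrightarrow> on_data_rays x y z"
proof -
  let ?v = "site_at w x y z"
  have w': "w $ 1 + w $ 2 + w $ 3 = -1" using w by (simp add: A2_def)
  have vA: "?v \<in> A2 k \<longleftrightarrow> x + y + z = k + 1" for k using w' by (auto simp: A2_def)
  have nbr: "(\<forall>n\<in>A2 0. adjacent ?v n \<longrightarrow> n \<in> star_region w) \<longleftrightarrow>
    in_star (x + r) y z \<and> in_star x (y + r) z \<and> in_star x y (z + r)"
    if r: "(r = 1 \<or> r = -1)" "x + y + z + r = 1" for r
  proof -
    have "n \<in> A2 0 \<and> adjacent ?v n \<longleftrightarrow> n = site_at w (x + r) y z \<or> n = site_at w x (y + r) z \<or> n = site_at w x y (z + r)" for n
    proof -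
      have "n \<in> A2 0 \<and> adjacent ?v n \<longleftrightarrow> (\<exists>k. n = ?v + r *s unit_step k)"
      proof
        assume n: "n \<in> A2 0 \<and> adjacent ?v n"
        then obtain s j where s: "\<bar>s\<bar> = 1" "n = ?v + s *s unit_step j" using adjacentE by blast
        then have "s = r" using n r w' exhaust_3[of j] by (auto simp: A2_def)
        then show "\<exists>k. n = ?v + r *s unit_step k" using s by blast
      next
        assume "\<exists>k. n = ?v + r *s unit_step k"
        then obtain k where "n = ?v + r *s unit_step k" by blast
        then show "n \<in> A2 0 \<and> adjacent ?v n" using exhaust_3[of k] r w' by (auto simp: A2_def adjacent_iff)
      qed
      then show ?thesis unfolding exists_3 site_at_shift .
    qed
    then show ?thesis using site_at_in_star_region by metis
  qed
  have "\<not> (x + y + z = 0 \<or> x + y + z = 2) \<Longrightarrow> \<not> on_data_rays x y z" by (auto simp: on_data_rays_def)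
  then show ?thesis
    using nbr[of 1] nbr[of "-1"] lower_triangle_in_star[of x y z] upper_triangle_in_star[of x y z] vA[of 1] vA[of "-1"]
    unfolding data_circle_sites_def by auto
qed

lemma odd_site_at: "w \<in> A2 (-1) \<Longrightarrow> even_site (site_at w x y z) \<longleftrightarrow> odd (x + y + z)"
  by (simp add: A2_def even_site_def) presburger

text \<open>
  In the sector spanned by \<open>f1\<close> and \<open>f2\<close>, the circles are attached to the triangles
  \<open>(i, j), (i + 1, j), (i + 1, j + 1)\<close> and \<open>(i, j), (i, j + 1), (i + 1, j + 1)\<close> of the
  triangular lattice, that is to the sites \<open>(i + 1, j - i, 1 - j)\<close> and \<open>(i, j - i, - j)\<close>.
\<close>

lemma sector_closure:
  fixes R :: "int \<Rightarrow> int \<Rightarrow> int \<Rightarrow> bool"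
  assumes close: "\<And>x y z r s t. even (x + y + z) \<Longrightarrow> \<bar>r\<bar> = 1 \<Longrightarrow> \<bar>s\<bar> = 1 \<Longrightarrow> \<bar>t\<bar> = 1 \<Longrightarrow>
      R (x + r) (y + s) z \<Longrightarrow> R x (y + s) (z + t) \<Longrightarrow> R (x + r) y (z + t) \<Longrightarrow> R x y z"
    and data: "\<And>x y z. on_data_rays x y z \<Longrightarrow> R x y z"
  shows "R (int i) (int j - int i) (- int j) \<and> R (int i + 1) (int j - int i) (1 - int j)"
proof (induction "i + j" arbitrary: i j rule: less_induct)
  case less
  have Q: "R (int i') (int j' - int i') (- int j')" and P: "R (int i' + 1) (int j' - int i') (1 - int j')"
    if "i' + j' < i + j" for i' j' using less[OF that] by blast+
  show ?case
  proof
    show "R (int i) (int j - int i) (- int j)"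
    proof (cases "i = 0 \<or> j = 0")
      case True
      then show ?thesis by (intro data) (auto simp: on_data_rays_def)
    next
      case False
      then obtain i' j' where ij: "i = Suc i'" "j = Suc j'" by (metis not0_implies_Suc)
      show ?thesis
        by (rule close[of _ _ _ "-1" 1 1])
          (use P[of i' j] Q[of i' j] Q[of i' j'] ij in \<open>simp_all add: algebra_simps\<close>)
    qed
    show "R (int i + 1) (int j - int i) (1 - int j)"
    proof (cases "i = 0 \<or> j = 0")
      case True
      then show ?thesis by (intro data) (auto simp: on_data_rays_def)
    next
      case False
      then obtain i' j' where ij: "i = Suc i'" "j = Suc j'" by (metis not0_implies_Suc)
      show ?thesis
        by (rule close[of _ _ _ "-1" "-1" 1])
          (use Q[of i j'] P[of i j'] P[of i' j'] ij in \<open>simp_all add: algebra_simps\<close>)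
    qed
  qed
qed

text \<open>With all three signs equal, the other circles of the cube lie two layers away; this
  carries the two data layers up and down.\<close>

lemma layer_closure:
  fixes R :: "int \<Rightarrow> int \<Rightarrow> int \<Rightarrow> bool"
  assumes close: "\<And>x y z r s t. even (x + y + z) \<Longrightarrow> \<bar>r\<bar> = 1 \<Longrightarrow> \<bar>s\<bar> = 1 \<Longrightarrow> \<bar>t\<bar> = 1 \<Longrightarrow>
      R (x + r) (y + s) z \<Longrightarrow> R x (y + s) (z + t) \<Longrightarrow> R (x + r) y (z + t) \<Longrightarrow> R x y z"
    and layers: "\<And>x y z. x + y + z = 0 \<or> x + y + z = 2 \<Longrightarrow> R x y z"
    and "even (x + y + z)"
  shows "R x y z"
proof -
  have up: "R x y z" if "x + y + z = 2 * int k" for k x y z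
    using that
  proof (induction k arbitrary: x y z)
    case (Suc k)
    show ?case
      by (rule close[of x y z "-1" "-1" "-1"]) (use Suc in \<open>simp_all\<close>)
  qed (use layers in simp)
  have down: "R x y z" if "x + y + z = 2 - 2 * int k" for k x y z
    using that
  proof (induction k arbitrary: x y z)
    case (Suc k)
    show ?case
      by (rule close[of x y z 1 1 1]) (use Suc in \<open>simp_all\<close>)
  qed (use layers in simp)
  obtain h where "x + y + z = 2 * h" using assms(3) by (elim evenE)
  then show ?thesis using up[of x y z "nat h"] down[of x y z "nat (1 - h)"] by (cases "0 \<le> h") simp_all
qed

text \<open>The data rays are invariant under cyclic permutation of the coordinates, so one sector
  argument yields all three sectors; these cover both layers of
  \<open>layer_closure\<close>.\<close>

lemma dictated_closure:
  assumes w: "w \<in> A2 (-1)" and data: "data_circle_sites w \<subseteq> D"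
    and close: "\<And>v a. \<not> even_site v \<Longrightarrow> cube_edges a \<Longrightarrow> v + a 1 + a 2 \<in> D \<Longrightarrow> v + a 2 + a 3 \<in> D \<Longrightarrow>
      v + a 3 + a 1 \<in> D \<Longrightarrow> v \<in> D"
    and v: "\<not> even_site v"
  shows "v \<in> D"
proof -
  define R where "R x y z \<longleftrightarrow> site_at w x y z \<in> D" for x y z
  have R_data: "R x y z" if "on_data_rays x y z" for x y z
    using data data_circle_sites_iff[OF w] that by (auto simp: R_def)
  have R_close: "R x y z" if "even (x + y + z)" and rst: "\<bar>r\<bar> = 1" "\<bar>s\<bar> = 1" "\<bar>t\<bar> = 1"
    and "R (x + r) (y + s) z" "R x (y + s) (z + t)" "R (x + r) y (z + t)" for x y z r s t
    unfolding R_def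
  proof (rule close[of _ "sign_edges r s t"])
    show "\<not> even_site (site_at w x y z)" using odd_site_at[OF w] that(1) by simp
    show "cube_edges (sign_edges r s t)" using cube_edges_sign_edges rst .
  qed (use that(5-7) in \<open>simp_all add: R_def site_at_shift\<close>)
  have cyc: "on_data_rays x y z \<Longrightarrow> on_data_rays y z x" for x y z by (auto simp: on_data_rays_def)
  have S1: "R (int i) (int j - int i) (- int j) \<and> R (int i + 1) (int j - int i) (1 - int j)" for i j
    by (rule sector_closure[of R, OF R_close R_data])
  have S2: "R (- int j) (int i) (int j - int i) \<and> R (1 - int j) (int i + 1) (int j - int i)" for i j
  proof (rule sector_closure[of "\<lambda>x y z. R z x y"], goal_cases)
    case (1 x y z r s t)
    then show ?case using R_close[of z x y t r s] by (simp add: ac_simps)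
  next
    case (2 x y z)
    then show ?case using R_data cyc by blast
  qed
  have S3: "R (int j - int i) (- int j) (int i) \<and> R (int j - int i) (1 - int j) (int i + 1)" for i j
  proof (rule sector_closure[of "\<lambda>x y z. R y z x"], goal_cases)
    case (1 x y z r s t)
    then show ?case using R_close[of y z x s t r] by (simp add: ac_simps)
  next
    case (2 x y z)
    then show ?case using R_data cyc by blast
  qed
  have layers: "R x y z" if xyz: "x + y + z = 0 \<or> x + y + z = 2" for x y z
    using xyz
  proof
    assume s: "x + y + z = 0"
    then consider "0 \<le> x" "z \<le> 0" | "0 \<le> y" "x \<le> 0" | "0 \<le> z" "y \<le> 0" by linarith
    then show ?thesis
    proof cases
      case 1
      then have "y = int (nat (- z)) - int (nat x)" using s by simp
      then show ?thesis using S1[of "nat x" "nat (- z)"] 1 by simp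
    next
      case 2
      then have "z = int (nat (- x)) - int (nat y)" using s by simp
      then show ?thesis using S2[of "nat (- x)" "nat y"] 2 by simp
    next
      case 3
      then have "x = int (nat (- y)) - int (nat z)" using s by simp
      then show ?thesis using S3[of "nat (- y)" "nat z"] 3 by simp
    qed
  next
    assume s: "x + y + z = 2"
    then consider "1 \<le> x" "z \<le> 1" | "1 \<le> y" "x \<le> 1" | "1 \<le> z" "y \<le> 1" by linarith
    then show ?thesis
    proof cases
      case 1
      then have "y = int (nat (1 - z)) - int (nat (x - 1))" using s by simp
      then show ?thesis using S1[of "nat (x - 1)" "nat (1 - z)"] 1 by simp
    next
      case 2
      then have "z = int (nat (1 - x)) - int (nat (y - 1))" using s by simp
      then show ?thesis using S2[of "nat (1 - x)" "nat (y - 1)"] 2 by simp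
    next
      case 3
      then have "x = int (nat (1 - y)) - int (nat (z - 1))" using s by simp
      then show ?thesis using S3[of "nat (1 - y)" "nat (z - 1)"] 3 by simp
    qed
  qed
  have "even (v $ 1 - w $ 1 + (v $ 2 - w $ 2) + (v $ 3 - w $ 3))"
    using v odd_site_at[OF w] site_at_eq[of v w] by metis
  from layer_closure[of R, OF R_close layers this] show ?thesis by (simp add: R_def flip: site_at_eq)
qed

subsection \<open>Propagation of the geodesic circles\<close>

text \<open>Relative to the odd site \<open>w\<close>, even sums belong to circles. A circle
  follows, up to reflection, from geodesic circles in the three directions; a geodesic circle from
  two circles and the opposite corner of a face.\<close>

definition geodesic_closed :: "(int \<Rightarrow> int \<Rightarrow> int \<Rightarrow> bool) \<Rightarrow> bool" where
  "geodesic_closed R \<longleftrightarrow> (\<forall>x y z r s t. \<bar>r\<bar> = 1 \<longrightarrow> \<bar>s\<bar> = 1 \<longrightarrow> \<bar>t\<bar> = 1 \<longrightarrow>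
     (even (x + y + z) \<longrightarrow> R (x + r) y z \<longrightarrow> R x (y + s) z \<longrightarrow> R x y (z + t) \<longrightarrow> R x y z) \<and>
     (odd (x + y + z) \<longrightarrow>
        (R (x + r) y z \<longrightarrow> R x (y + s) z \<longrightarrow> R (x + r) (y + s) z \<longrightarrow> R x y z) \<and>
        (R x (y + s) z \<longrightarrow> R x y (z + t) \<longrightarrow> R x (y + s) (z + t) \<longrightarrow> R x y z) \<and>
        (R (x + r) y z \<longrightarrow> R x y (z + t) \<longrightarrow> R (x + r) y (z + t) \<longrightarrow> R x y z)))"

lemma geodesic_closedD:
  assumes "geodesic_closed R" "\<bar>r\<bar> = 1" "\<bar>s\<bar> = 1" "\<bar>t\<bar> = 1"
  shows "even (x + y + z) \<Longrightarrow> R (x + r) y z \<Longrightarrow> R x (y + s) z \<Longrightarrow> R x y (z + t) \<Longrightarrow> R x y z"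
    "odd (x + y + z) \<Longrightarrow> R (x + r) y z \<Longrightarrow> R x (y + s) z \<Longrightarrow> R (x + r) (y + s) z \<Longrightarrow> R x y z"
    "odd (x + y + z) \<Longrightarrow> R x (y + s) z \<Longrightarrow> R x y (z + t) \<Longrightarrow> R x (y + s) (z + t) \<Longrightarrow> R x y z"
    "odd (x + y + z) \<Longrightarrow> R (x + r) y z \<Longrightarrow> R x y (z + t) \<Longrightarrow> R (x + r) y (z + t) \<Longrightarrow> R x y z"
  using assms unfolding geodesic_closed_def by blast+

lemma geodesic_closed_rotate:
  assumes "geodesic_closed R" shows "geodesic_closed (\<lambda>x y z. R z x y)"
  unfolding geodesic_closed_def
proof (intro allI impI conjI)
  fix x y z r s t :: int
  assume rst: "\<bar>r\<bar> = 1" "\<bar>s\<bar> = 1" "\<bar>t\<bar> = 1"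
  note D = geodesic_closedD[OF assms rst(3) rst(1) rst(2), of z x y]
  show "R z x y" if "even (x + y + z)" "R z (x + r) y" "R z x (y + s)" "R (z + t) x y"
    by (rule D(1)) (use that in \<open>simp_all add: ac_simps\<close>)
  show "R z x y" if "odd (x + y + z)" "R z (x + r) y" "R z x (y + s)" "R z (x + r) (y + s)"
    by (rule D(3)) (use that in \<open>simp_all add: ac_simps\<close>)
  show "R z x y" if "odd (x + y + z)" "R z x (y + s)" "R (z + t) x y" "R (z + t) x (y + s)"
    by (rule D(4)) (use that in \<open>simp_all add: ac_simps\<close>)
  show "R z x y" if "odd (x + y + z)" "R z (x + r) y" "R (z + t) x y" "R (z + t) (x + r) y"
    by (rule D(2)) (use that in \<open>simp_all add: ac_simps\<close>)
qed

text \<open>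
  The point \<open>(i + 2, j + 2)\<close> of the triangular lattice is the corner of two triangles of side two
  whose other five points precede it; in each of them the geodesic circle attached to the
  tetrahedron above (below) is found first.
\<close>

lemma geodesic_sector:
  assumes R: "geodesic_closed R" and data: "\<And>x y z. in_star x y z \<Longrightarrow> R x y z"
  shows "R (int i) (int j - int i) (1 - int j)"
proof (induction "i + j" arbitrary: i j rule: less_induct)
  case less
  have IH: "R (int i') (int j' - int i') (1 - int j')" if "i' + j' < i + j" for i' j' using less[OF that] .
  show ?case
  proof (cases "i < 2 \<or> j < 2")
    case True
    then show ?thesis by (intro data) (auto simp: in_star_def)
  next
    case False
    define x y :: int where "x = int i - 2" and "y = int j - 2"
    have g: "R (x + u) (y + v - x - u) (1 - y - v)"
      if "u \<in> {0, 1, 2}" "v \<in> {0, 1, 2}" "u + v < 4" for u v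
    proof -
      have "R (int (nat (x + u))) (int (nat (y + v)) - int (nat (x + u))) (1 - int (nat (y + v)))"
        by (rule IH) (use False that in \<open>auto simp: x_def y_def\<close>)
      then show ?thesis using False that by (auto simp: x_def y_def algebra_simps)
    qed
    note D = geodesic_closedD[OF R, of "-1" "-1" "-1"] and D' = geodesic_closedD[OF R, of "-1" "-1" 1]
      and D1 = geodesic_closedD[OF R, of 1 1 1] and D2 = geodesic_closedD[OF R, of "-1" 1 1]
    have gg: "R a b c" if "a + b + c = 1" "a - x \<in> {0, 1, 2}" "1 - y - c \<in> {0, 1, 2}" "a - x + (1 - y - c) < 4" for a b c
    proof -
      have "b = y + (1 - y - c) - x - (a - x)" using that(1) by simp
      then show ?thesis using g[of "a - x" "1 - y - c"] that(2-4) by simp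
    qed
    \<comment> \<open>By coordinate sum: 2 and 0 are circles above and below the plane, 3 and -1 the
      geodesic circles at the tips of the two tetrahedra. \<open>P'\<close> and \<open>Q'\<close>
      are the circles which share a face with the new corner.\<close>
    have P: "R (x + 1) (y - x) (1 - y)" by (rule D(1)) (simp_all add: gg)
    have P1: "R (x + 2) (y - x - 1) (1 - y)" by (rule D(1)) (simp_all add: gg)
    have Q: "R x (y - x) (- y)" by (rule D1(1)) (simp_all add: gg)
    have Q1: "R x (y - x + 1) (- y - 1)" by (rule D1(1)) (simp_all add: gg)
    have u: "R (x + 2) (y - x) (1 - y)" by (rule D(2)) (use P P1 in \<open>simp_all add: gg add.commute\<close>)
    have u': "R x (y - x) (- y - 1)" by (rule D1(3)) (use Q Q1 in \<open>simp_all add: gg\<close>)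
    have P': "R (x + 2) (y - x) (- y)" by (rule D'(1)) (use u in \<open>simp_all add: gg\<close>)
    have Q': "R (x + 1) (y - x) (- y - 1)" by (rule D2(1)) (use u' in \<open>simp_all add: gg\<close>)
    have "R (x + 2) (y - x) (- y - 1)" by (rule D2(4)) (use P' Q' in \<open>simp_all add: gg add.commute\<close>)
    then show ?thesis by (simp add: x_def y_def algebra_simps)
  qed
qed

lemma geodesic_closure:
  assumes w: "w \<in> A2 (-1)" and data: "star_region w \<subseteq> D"
    and circles: "\<And>v a. \<not> even_site v \<Longrightarrow> cube_edges a \<Longrightarrow> v + a 1 \<in> D \<Longrightarrow> v + a 2 \<in> D \<Longrightarrow> v + a 3 \<in> D \<Longrightarrow> v \<in> D"
    and geodesics: "\<And>n a j k. even_site n \<Longrightarrow> cube_edges a \<Longrightarrow> j \<noteq> k \<Longrightarrow> n + a j \<in> D \<Longrightarrow> n + a k \<in> D \<Longrightarrow>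
      n + a j + a k \<in> D \<Longrightarrow> n \<in> D"
    and n: "even_site n"
  shows "n \<in> D"
proof -
  define R where "R x y z \<longleftrightarrow> site_at w x y z \<in> D" for x y z
  have R: "geodesic_closed R"
    unfolding geodesic_closed_def
  proof (intro allI impI conjI)
    fix x y z r s t :: int
    assume rst: "\<bar>r\<bar> = 1" "\<bar>s\<bar> = 1" "\<bar>t\<bar> = 1"
    note a = cube_edges_sign_edges[OF rst] and ev = odd_site_at[OF w, of x y z]
    show "R x y z" if "even (x + y + z)" "R (x + r) y z" "R x (y + s) z" "R x y (z + t)"
      unfolding R_def by (rule circles[OF _ a]) (use that ev in \<open>simp_all add: R_def site_at_shift\<close>)
    show "R x y z" if "odd (x + y + z)" "R (x + r) y z" "R x (y + s) z" "R (x + r) (y + s) z"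
      unfolding R_def by (rule geodesics[OF _ a, of _ 1 2]) (use that ev in \<open>simp_all add: R_def site_at_shift\<close>)
    show "R x y z" if "odd (x + y + z)" "R x (y + s) z" "R x y (z + t)" "R x (y + s) (z + t)"
      unfolding R_def by (rule geodesics[OF _ a, of _ 2 3]) (use that ev in \<open>simp_all add: R_def site_at_shift\<close>)
    show "R x y z" if "odd (x + y + z)" "R (x + r) y z" "R x y (z + t)" "R (x + r) y (z + t)"
      unfolding R_def by (rule geodesics[OF _ a, of _ 1 3]) (use that ev in \<open>simp_all add: R_def site_at_shift\<close>)
  qed
  have R_data: "R x y z" if "in_star x y z" for x y z
    using data site_at_in_star_region that by (auto simp: R_def)
  have cyc: "in_star x y z \<Longrightarrow> in_star z x y" for x y z by (auto simp: in_star_def)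
  note R' = geodesic_closed_rotate[OF R] note R'' = geodesic_closed_rotate[OF R']
  have S1: "R (int i) (int j - int i) (1 - int j)" for i j
    by (rule geodesic_sector[of R, OF R R_data])
  have S2: "R (1 - int j) (int i) (int j - int i)" for i j
    by (rule geodesic_sector[OF R']) (use R_data cyc in blast)
  have S3: "R (int j - int i) (1 - int j) (int i)" for i j
    by (rule geodesic_sector[OF R'']) (use R_data cyc in blast)
  have layer: "R x y z" if s: "x + y + z = 1" for x y z
  proof -
    consider "0 \<le> x" "z \<le> 1" | "0 \<le> y" "x \<le> 1" | "0 \<le> z" "y \<le> 1" using s by linarith
    then show ?thesis
    proof cases
      case 1
      then have "y = int (nat (1 - z)) - int (nat x)" using s by simp
      then show ?thesis using S1[of "nat x" "nat (1 - z)"] 1 by simp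
    next
      case 2
      then have "z = int (nat (1 - x)) - int (nat y)" using s by simp
      then show ?thesis using S2[of "nat (1 - x)" "nat y"] 2 by simp
    next
      case 3
      then have "x = int (nat (1 - y)) - int (nat z)" using s by simp
      then show ?thesis using S3[of "nat (1 - y)" "nat z"] 3 by simp
    qed
  qed
  note U = geodesic_closedD[OF R, of "-1" "-1" "-1"] and D = geodesic_closedD[OF R, of 1 1 1]
  have up: "\<forall>x y z. x + y + z = 1 + 2 * int k \<longrightarrow> R x y z" for k
  proof (induction k)
    case (Suc k)
    have even: "R x y z" if s: "x + y + z = 2 + 2 * int k" for x y z
    proof -
      have "R (x + - 1) y z" "R x (y + - 1) z" "R x y (z + - 1)" by (rule Suc[rule_format], use s in simp)+
      then show ?thesis using U(1)[of x y z] s by simp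
    qed
    show ?case
    proof (intro allI impI)
      fix x y z assume s: "x + y + z = 1 + 2 * int (Suc k)"
      have "R (x + - 1) y z" "R x (y + - 1) z" by (rule even, use s in simp)+
      moreover have "R (x + - 1) (y + - 1) z" by (rule Suc[rule_format]) (use s in simp)
      moreover have "odd (x + y + z)" using s by simp
      ultimately show "R x y z" using U(2)[of x y z] by simp
    qed
  qed (use layer in simp)
  have down: "\<forall>x y z. x + y + z = 1 - 2 * int k \<longrightarrow> R x y z" for k
  proof (induction k)
    case (Suc k)
    have even: "R x y z" if s: "x + y + z = - 2 * int k" for x y z
    proof -
      have "R (x + 1) y z" "R x (y + 1) z" "R x y (z + 1)" by (rule Suc[rule_format], use s in simp)+
      then show ?thesis using D(1)[of x y z] s by simp
    qed
    show ?case
    proof (intro allI impI)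
      fix x y z assume s: "x + y + z = 1 - 2 * int (Suc k)"
      have "R (x + 1) y z" "R x (y + 1) z" by (rule even, use s in simp)+
      moreover have "R (x + 1) (y + 1) z" by (rule Suc[rule_format]) (use s in simp)
      moreover have "odd (x + y + z)" using s by simp
      ultimately show "R x y z" using D(2)[of x y z] by simp
    qed
  qed (use layer in simp)
  define x y z where "x = n $ 1 - w $ 1" and "y = n $ 2 - w $ 2" and "z = n $ 3 - w $ 3"
  have nxyz: "n = site_at w x y z" unfolding x_def y_def z_def by (rule site_at_eq)
  then have "odd (x + y + z)" using n odd_site_at[OF w] by metis
  then obtain h where h: "x + y + z = 2 * h + 1" by (elim oddE)
  have "R x y z" using up[of "nat h"] down[of "nat (- h)"] h by (cases "0 \<le> h") simp_all
  then show ?thesis by (simp add: R_def nxyz)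
qed

subsection \<open>Signs with prescribed data\<close>

text \<open>The unknowns alternate, \<open>f 0\<close>, \<open>h 0\<close>, \<open>f 1\<close> and
  so on, and each datum involves two consecutive ones. \<open>B\<close> and \<open>C\<close> are the
  values of the third factor on the lower and the upper ray.\<close>

lemma ray_signs:
  fixes A B C :: real and G H :: "nat \<Rightarrow> real"
  assumes "A = 1 \<or> A = -1" "B = 1 \<or> B = -1" "C = 1 \<or> C = -1" "\<And>i. G i = 1 \<or> G i = -1" "\<And>i. H i = 1 \<or> H i = -1"
  obtains f h where "\<And>i. f i = 1 \<or> f i = -1" "\<And>i. h i = 1 \<or> h i = -1" "f 0 = A"
    "\<And>i. f (Suc i) * h i * C = H i" "\<And>i. f i * h i * B = G i"
proof -
  define f where "f = rec_nat A (\<lambda>i y. y * G i * H i * B * C)"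
  have f: "f 0 = A" "\<And>i. f (Suc i) = f i * G i * H i * B * C" by (simp_all add: f_def)
  define h where "h i = G i * f i * B" for i
  have sf: "f i = 1 \<or> f i = -1" for i
  proof (induction i)
    case (Suc i)
    then show ?case using assms(2,3) assms(4)[of i] assms(5)[of i] by (auto simp: f)
  qed (use assms(1) f in simp)
  show ?thesis
  proof (rule that[of f h])
    show "h i = 1 \<or> h i = -1" for i using sf[of i] assms(2) assms(4)[of i] by (auto simp: h_def)
    show "f (Suc i) * h i * C = H i" for i
      using sf[of i] assms(2,3) assms(4)[of i] assms(5)[of i] by (auto simp: f h_def)
    show "f i * h i * B = G i" for i using sf[of i] assms(2) assms(4)[of i] by (auto simp: h_def)
  qed (use sf f in auto)
qed

text \<open>A particular solution: exactly one of the four circles of a cube sits at a site with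
  three odd coordinates.\<close>

definition parity_sign :: "site \<Rightarrow> real" where
  "parity_sign v = (if odd (v $ 1) \<and> odd (v $ 2) \<and> odd (v $ 3) then -1 else 1)"

lemma parity_sign_product:
  assumes "\<not> even_site v" "cube_edges a"
  shows "parity_sign v * parity_sign (v + a 1 + a 2) * parity_sign (v + a 2 + a 3) * parity_sign (v + a 3 + a 1) = -1"
proof -
  obtain r s t where a: "\<bar>r\<bar> = 1" "\<bar>s\<bar> = 1" "\<bar>t\<bar> = 1" "a = sign_edges r s t" using cube_edgesE assms(2) by blast
  have "odd r" "odd s" "odd t" using a(1-3) by (metis dvd_abs_iff odd_one)+
  then show ?thesis using assms(1) by (auto simp: parity_sign_def a(4) even_site_def)
qed

text \<open>
  A product \<open>F1 x * F2 y * F3 z\<close> of signs has product \<open>1\<close> over the circles of every elementary cube,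
  and these products attain all data which are admissible in the central cube.
\<close>

lemma sign_solution:
  fixes \<kappa> :: "site \<Rightarrow> real"
  assumes w: "w \<in> A2 (-1)" and \<kappa>: "\<And>n. \<kappa> n = 1 \<or> \<kappa> n = -1"
    and centre: "\<kappa> w * \<kappa> (w + unit_step 1 + unit_step 2) * \<kappa> (w + unit_step 2 + unit_step 3) *
      \<kappa> (w + unit_step 3 + unit_step 1) = -1"
  obtains S where "\<And>n. S n = 1 \<or> S n = -1" "\<And>v. v \<in> data_circle_sites w \<Longrightarrow> S v = \<kappa> v"
    "\<And>v a. \<not> even_site v \<Longrightarrow> cube_edges a \<Longrightarrow>
      S v * S (v + a 1 + a 2) * S (v + a 2 + a 3) * S (v + a 3 + a 1) = -1"
proof -
  have ps: "parity_sign n = 1 \<or> parity_sign n = -1" for n by (simp add: parity_sign_def)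
  define G where "G x y z = \<kappa> (site_at w x y z) * parity_sign (site_at w x y z)" for x y z
  have G: "G x y z = 1 \<or> G x y z = -1" for x y z using \<kappa>[of "site_at w x y z"] ps[of "site_at w x y z"] by (auto simp: G_def)
  have corners: "w = site_at w 0 0 0" "w + unit_step 1 + unit_step 2 = site_at w 1 1 0"
    "w + unit_step 2 + unit_step 3 = site_at w 0 1 1" "w + unit_step 3 + unit_step 1 = site_at w 1 0 1"
    by (simp_all add: site_eq_iff)
  have wo: "\<not> even_site w" using w by (simp add: A2_def even_site_def)
  have "cube_edges unit_step" by (simp add: cube_edges_def)
  \<comment> \<open>Division by the particular solution leaves a homogeneous problem; this is its
    compatibility condition in the central cube.\<close>
  from parity_sign_product[OF wo this] centre have Gc: "G 0 0 0 * G 1 1 0 * G 0 1 1 * G 1 0 1 = 1"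
    unfolding corners(2-4) G_def corners(1)[symmetric] by algebra
  obtain f1 h1 where r1: "\<And>i. f1 i = 1 \<or> f1 i = -1" "\<And>i. h1 i = 1 \<or> h1 i = -1" "f1 0 = G 1 0 1"
    "\<And>i. f1 (Suc i) * h1 i * 1 = G (int i + 2) (- int i - 1) 1" "\<And>i. f1 i * h1 i * 1 = G (int i + 1) (- int i - 1) 0"
    by (rule ray_signs[of "G 1 0 1" 1 1 "\<lambda>i. G (int i + 1) (- int i - 1) 0" "\<lambda>i. G (int i + 2) (- int i - 1) 1"])
      (use G in auto)
  \<comment> \<open>The freedom in the three factors is spent on the value 1 for
    \<open>F2 0\<close>, \<open>F3 0\<close> and \<open>F3 1\<close>. Three corners of the central
    cube then fix the other initial values, and the fourth agrees by \<open>Gc\<close>.\<close>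
  define F20 F21 F10 F11 where "F20 = (1 :: real)" and "F21 = G 1 1 0 * G 1 0 1" and "F10 = G 0 0 0" and "F11 = G 1 0 1"
  have s: "F21 = 1 \<or> F21 = -1" "F10 = 1 \<or> F10 = -1" "F11 = 1 \<or> F11 = -1"
    using G[of 1 1 0] G[of 1 0 1] G[of 0 0 0] by (auto simp: F21_def F10_def F11_def)
  obtain f2 h2 where r2: "\<And>i. f2 i = 1 \<or> f2 i = -1" "\<And>i. h2 i = 1 \<or> h2 i = -1" "f2 0 = F21"
    "\<And>i. f2 (Suc i) * h2 i * F11 = G 1 (int i + 2) (- int i - 1)" "\<And>i. f2 i * h2 i * F10 = G 0 (int i + 1) (- int i - 1)"
    by (rule ray_signs[of F21 F10 F11 "\<lambda>i. G 0 (int i + 1) (- int i - 1)" "\<lambda>i. G 1 (int i + 2) (- int i - 1)"])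
      (use G s in auto)
  obtain f3 h3 where r3: "\<And>i. f3 i = 1 \<or> f3 i = -1" "\<And>i. h3 i = 1 \<or> h3 i = -1" "f3 0 = 1"
    "\<And>i. f3 (Suc i) * h3 i * F21 = G (- int i - 1) 1 (int i + 2)" "\<And>i. f3 i * h3 i * 1 = G (- int i - 1) 0 (int i + 1)"
    by (rule ray_signs[of 1 1 F21 "\<lambda>i. G (- int i - 1) 0 (int i + 1)" "\<lambda>i. G (- int i - 1) 1 (int i + 2)"])
      (use G s in auto)
  define F where "F f h c x = (if x = 0 then c else if 0 < x then f (nat (x - 1)) else h (nat (- x - 1)))"
    for f h :: "nat \<Rightarrow> real" and c and x :: int
  have Fsign: "F f h c x = 1 \<or> F f h c x = -1"
    if "\<And>i. f i = 1 \<or> f i = -1" "\<And>i. h i = 1 \<or> h i = -1" "c = 1 \<or> c = -1" for f h c x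
    using that by (simp add: F_def)
  \<comment> \<open>Each ray runs through the positive arguments of one factor and the negative
    arguments of the next, so the three rays prescribe disjoint sets of values.\<close>
  define F1 F2 F3 where "F1 = F f1 h3 F10" and "F2 = F f2 h1 1" and "F3 = F f3 h2 1"
  have Fs: "F1 x = 1 \<or> F1 x = -1" "F2 x = 1 \<or> F2 x = -1" "F3 x = 1 \<or> F3 x = -1" for x
    unfolding F1_def F2_def F3_def using Fsign r1(1,2) r2(1,2) r3(1,2) s by blast+
  have Fpos: "F f h c (int i + 1) = f i" "F f h c (int i + 2) = f (Suc i)" "F f h c 1 = f 0" "F f h c 0 = c"
    "F f h c (- int i - 1) = h i" for f h c i
    by (simp_all add: F_def nat_add_distrib)
  have Fdata: "F1 x * F2 y * F3 z = G x y z" if xyz: "on_data_rays x y z" for x y z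
  proof -
    have F0: "F1 0 = F10" "F2 0 = 1" "F3 0 = 1" "F1 1 = F11" "F2 1 = F21" "F3 1 = 1"
      by (simp_all add: F1_def F2_def F3_def Fpos r1(3) r2(3) r3(3) F11_def)
    have R1: "F1 (int i + 1) * F2 (- int i - 1) * F3 0 = G (int i + 1) (- int i - 1) 0"
      "F1 (int i + 2) * F2 (- int i - 1) * F3 1 = G (int i + 2) (- int i - 1) 1" for i
      unfolding F0 unfolding F1_def F2_def Fpos using r1(4,5)[of i] by simp_all
    have R2: "F1 0 * F2 (int i + 1) * F3 (- int i - 1) = G 0 (int i + 1) (- int i - 1)"
      "F1 1 * F2 (int i + 2) * F3 (- int i - 1) = G 1 (int i + 2) (- int i - 1)" for i
      unfolding F0 unfolding F3_def F2_def Fpos using r2(4,5)[of i] by (simp_all add: mult_ac)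
    have R3: "F1 (- int i - 1) * F2 0 * F3 (int i + 1) = G (- int i - 1) 0 (int i + 1)"
      "F1 (- int i - 1) * F2 1 * F3 (int i + 2) = G (- int i - 1) 1 (int i + 2)" for i
      unfolding F0 unfolding F3_def F1_def Fpos using r3(4,5)[of i] by (simp_all add: mult_ac)
    have c: "F1 0 * F2 0 * F3 0 = G 0 0 0" "F1 1 * F2 0 * F3 1 = G 1 0 1" "F1 1 * F2 1 * F3 0 = G 1 1 0"
      "F1 0 * F2 1 * F3 1 = G 0 1 1"
      using Gc G[of 0 0 0] G[of 1 0 1] G[of 1 1 0] G[of 0 1 1] by (auto simp: F0 F10_def F11_def F21_def)
    have "(0 \<le> x \<and> y = - x \<and> z = 0) \<or> (0 \<le> y \<and> z = - y \<and> x = 0) \<or> (0 \<le> z \<and> x = - z \<and> y = 0) \<or>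
      (1 \<le> x \<and> y = 1 - x \<and> z = 1) \<or> (1 \<le> y \<and> z = 1 - y \<and> x = 1) \<or> (1 \<le> z \<and> x = 1 - z \<and> y = 1)"
      using xyz unfolding on_data_rays_def by (elim disjE conjE) simp_all
    then consider "0 \<le> x" "y = - x" "z = 0" | "0 \<le> y" "z = - y" "x = 0" | "0 \<le> z" "x = - z" "y = 0"
      | "1 \<le> x" "y = 1 - x" "z = 1" | "1 \<le> y" "z = 1 - y" "x = 1" | "1 \<le> z" "x = 1 - z" "y = 1" by blast
    then show ?thesis
    proof cases
      case 1 then show ?thesis using R1(1)[of "nat (x - 1)"] c by (cases "x = 0") simp_all
    next
      case 2 then show ?thesis using R2(1)[of "nat (y - 1)"] c by (cases "y = 0") simp_all
    next
      case 3 then show ?thesis using R3(1)[of "nat (z - 1)"] c by (cases "z = 0") simp_all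
    next
      case 4 then show ?thesis using R1(2)[of "nat (x - 2)"] c by (cases "x = 1") simp_all
    next
      case 5 then show ?thesis using R2(2)[of "nat (y - 2)"] c by (cases "y = 1") simp_all
    next
      case 6 then show ?thesis using R3(2)[of "nat (z - 2)"] c by (cases "z = 1") simp_all
    qed
  qed
  define E where "E v = F1 (v $ 1 - w $ 1) * F2 (v $ 2 - w $ 2) * F3 (v $ 3 - w $ 3)" for v :: site
  have E: "E v = 1 \<or> E v = -1" for v
    using Fs(1)[of "v $ 1 - w $ 1"] Fs(2)[of "v $ 2 - w $ 2"] Fs(3)[of "v $ 3 - w $ 3"] by (auto simp: E_def)
  show ?thesis
  proof (rule that[of "\<lambda>v. parity_sign v * E v"])
    show "parity_sign n * E n = 1 \<or> parity_sign n * E n = -1" for n using E[of n] ps[of n] by auto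
    show "parity_sign v * E v = \<kappa> v" if v: "v \<in> data_circle_sites w" for v
    proof -
      define x y z where "x = v $ 1 - w $ 1" and "y = v $ 2 - w $ 2" and "z = v $ 3 - w $ 3"
      have vxyz: "v = site_at w x y z" unfolding x_def y_def z_def by (rule site_at_eq)
      then have "on_data_rays x y z" using v data_circle_sites_iff[OF w] by metis
      from Fdata[OF this] have "E v = \<kappa> v * parity_sign v" by (simp add: E_def G_def vxyz[symmetric] flip: x_def y_def z_def)
      then show ?thesis using ps[of v] by auto
    qed
    fix v a assume v: "\<not> even_site v" and a: "cube_edges a"
    obtain r s t where rst: "a = sign_edges r s t" using cube_edgesE a by blast
    have "E v * E (v + a 1 + a 2) * E (v + a 2 + a 3) * E (v + a 3 + a 1) = 1"
    proof -
      define x y z where "x = v $ 1 - w $ 1" and "y = v $ 2 - w $ 2" and "z = v $ 3 - w $ 3"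
      have "E v = F1 x * F2 y * F3 z" "E (v + a 1 + a 2) = F1 (x + r) * F2 (y + s) * F3 z"
        "E (v + a 2 + a 3) = F1 x * F2 (y + s) * F3 (z + t)" "E (v + a 3 + a 1) = F1 (x + r) * F2 y * F3 (z + t)"
        by (simp_all add: E_def rst x_def y_def z_def algebra_simps)
      then have "E v * E (v + a 1 + a 2) * E (v + a 2 + a 3) * E (v + a 3 + a 1) =
        (F1 x)\<^sup>2 * (F1 (x + r))\<^sup>2 * (F2 y)\<^sup>2 * (F2 (y + s))\<^sup>2 * (F3 z)\<^sup>2 * (F3 (z + t))\<^sup>2"
        by (simp add: power2_eq_square)
      moreover have "(F1 u)\<^sup>2 = 1" "(F2 u)\<^sup>2 = 1" "(F3 u)\<^sup>2 = 1" for u using Fs(1)[of u] Fs(2)[of u] Fs(3)[of u] by auto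
      ultimately show ?thesis by simp
    qed
    with parity_sign_product[OF v a]
    show "parity_sign v * E v * (parity_sign (v + a 1 + a 2) * E (v + a 1 + a 2)) *
      (parity_sign (v + a 2 + a 3) * E (v + a 2 + a 3)) * (parity_sign (v + a 3 + a 1) * E (v + a 3 + a 1)) = -1"
      by algebra
  qed
qed

section \<open>Uniqueness of the complex\<close>

context spinor_frame
begin

text \<open>After \<open>touching_not_geodesic\<close> has ruled out a geodesic \<open>C\<close>,
  the three geodesic circles fix the pairwise products of its slopes, hence the slopes up to a
  common sign.\<close>

lemma circle_unique:
  assumes v: "\<not> even_site v" and a: "cube_edges a" and C: "oriented_circle C"
    and ct: "\<And>k. contact (g (v + a k)) C"
  shows "same_circle C (c v) \<or> same_circle C (reflect (c v))"
proof -
  define n where "n k = v + a k" for k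
  obtain r s t where rst: "\<bar>r\<bar> = 1" "\<bar>s\<bar> = 1" "\<bar>t\<bar> = 1" "a = sign_edges r s t" using cube_edgesE a by blast
  have adj: "adjacent v (n k)" for k using exhaust_3[of k] rst(1-3) by (auto simp: n_def rst(4) adjacent_iff)
  have ev: "even_site (n k)" for k using adjacent_parity adj v by blast
  have dg: "diagonal (n 1) (n 2)" "diagonal (n 1) (n 3)" "diagonal (n 2) (n 3)"
    using rst(1-3) by (simp_all add: n_def rst(4) diagonal_def)
  have C2: "C $ 2 \<noteq> 0" by (rule touching_not_geodesic[OF C, of n]) (use ev dg ct in \<open>simp_all add: n_def\<close>)
  have "\<exists>s. s \<noteq> 0 \<and> s *\<^sub>R p (n k) + q (n k) \<in> L C" for k
    using touching_coefficient[OF C C2 geodesic_g[OF ev] ct[folded n_def]] frame[OF ev] by blast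
  then obtain s where s: "\<And>k. s k \<noteq> 0" "\<And>k. s k *\<^sub>R p (n k) + q (n k) \<in> L C" by metis
  have prod: "s j * s k = \<mu> v (n j) * \<mu> v (n k)" if "diagonal (n j) (n k)" for j k
  proof -
    have "s j * s k * sympl (p (n j)) (p (n k)) = - sympl (q (n j)) (q (n k))"
      using line_isotropic[OF C s(2)[of j] s(2)[of k]] ev by (simp add: algebra_simps eq_neg_iff_add_eq_0)
    then show ?thesis using \<mu>_\<mu>[OF v adj adj] sympl_p_ne[OF ev that] by (metis mult_right_cancel)
  qed
  note P = prod[OF dg(1)] prod[OF dg(2)] prod[OF dg(3)]
  have nz: "\<mu> v (n k) \<noteq> 0" for k using \<mu>_nonzero v adj by blast
  have "((s 1)\<^sup>2 - (\<mu> v (n 1))\<^sup>2) * (\<mu> v (n 2) * \<mu> v (n 3)) = 0" using P by algebra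
  then have "(s 1)\<^sup>2 = (\<mu> v (n 1))\<^sup>2" using nz by simp
  then consider "s 1 = \<mu> v (n 1)" | "s 1 = - \<mu> v (n 1)" by (auto simp: power2_eq_iff)
  then show ?thesis
  proof cases
    case 1
    then have "s 2 = \<mu> v (n 2)" using P(1) nz[of 1] by simp
    then have X: "X v (n 1) \<in> L C" "X v (n 2) \<in> L C" using s(2)[of 1] s(2)[of 2] 1 by (simp_all add: X_def)
    have "L C = L (c v)"
      using line_eq_span[OF C X X_nonzero[OF ev] X_not_parallel[OF v adj adj dg(1)]] line_c[OF v adj adj dg(1)] by simp
    then show ?thesis using line_eq_imp_same_circle[OF C oriented_c[OF v]] by blast
  next
    case 2
    then have "\<mu> v (n 1) * s 2 = \<mu> v (n 1) * - \<mu> v (n 2)" using P(1) by simp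
    then have "s 2 = - \<mu> v (n 2)" using nz[of 1] by (metis mult_left_cancel)
    then show ?thesis
      using line_reflect_c[OF v adj adj dg(1) C] s(2)[of 1] s(2)[of 2] 2 by simp
  qed
qed

end

text \<open>The touching points of \<open>G\<close> with both circles are expanded at the corners
  \<open>n\<close> and \<open>m\<close> of the face. The \<open>q\<close> parts show that the
  coefficients agree; if both were nonzero, the \<open>p\<close> parts would give equal squares of
  slopes. So the eigenvectors of \<open>G\<close> lie on one of the two geodesic circles, and
  \<open>nc\<close> excludes the one at \<open>m\<close>.\<close>

lemma (in generic_frame) second_geodesic:
  assumes n: "even_site n" and a: "cube_edges a" and jk: "j \<noteq> k"
    and G: "geodesic_circle G" and ct: "contact G (c (n + a j))" "contact G (c (n + a k))"
    and nc: "\<not> contact G (g (n + a j + a k))"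
  shows "same_circle G (g n)"
proof -
  define v v' m where "v = n + a j" and "v' = n + a k" and "m = n + a j + a k"
  obtain r s t where rst: "\<bar>r\<bar> = 1" "\<bar>s\<bar> = 1" "\<bar>t\<bar> = 1" "a = sign_edges r s t" using cube_edgesE a by blast
  have adj: "adjacent v n" "adjacent v m" "adjacent v' n" "adjacent v' m" "diagonal n m" "diagonal v v'"
    "adjacent n v" "adjacent n v'"
    using exhaust_3[of j] exhaust_3[of k] jk rst(1-3)
    by (auto simp: v_def v'_def m_def rst(4) adjacent_iff diagonal_def)
  have vo: "\<not> even_site v" "\<not> even_site v'" and m: "even_site m" using adjacent_parity adj n by blast+
  have oG: "oriented_circle G" using G by (simp add: geodesic_circle_def)
  obtain p' where p': "p' \<noteq> 0" "p' \<in> L G" "mirror p' = 1 *\<^sub>R p'" using geodesic_eigenvector[OF G, of 1] by blast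
  obtain q' where q': "q' \<noteq> 0" "q' \<in> L G" "mirror q' = (-1) *\<^sub>R q'" using geodesic_eigenvector[OF G, of "-1"] by blast
  have pq': "mirror p' = p'" "mirror q' = - q'" using p' q' by simp_all
  have split: "\<exists>s \<alpha> \<beta>. s \<noteq> 0 \<and> q' = \<alpha> *\<^sub>R q n + \<beta> *\<^sub>R q m \<and> s *\<^sub>R p' = (\<alpha> * \<mu> u n) *\<^sub>R p n + (\<beta> * \<mu> u m) *\<^sub>R p m"
    if u: "\<not> even_site u" "adjacent u n" "adjacent u m" "contact G (c u)" for u
  proof -
    obtain s where s: "s \<noteq> 0" "s *\<^sub>R p' + q' \<in> L (c u)"
      using touching_coefficient[OF oriented_c[OF u(1)] c_not_geodesic[OF u(1)] G u(4) p'(2) q'(2) p'(1) q'(1) pq'] by blast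
    then obtain \<alpha> \<beta> where e: "s *\<^sub>R p' + q' = \<alpha> *\<^sub>R X u n + \<beta> *\<^sub>R X u m"
      using line_c[OF u(1,2,3) adj(5)] by (auto simp: span_pair_iff)
    have "mirror (s *\<^sub>R p' + q') = mirror (\<alpha> *\<^sub>R X u n + \<beta> *\<^sub>R X u m)" using e by simp
    then have e': "s *\<^sub>R p' - q' = \<alpha> *\<^sub>R (\<mu> u n *\<^sub>R p n - q n) + \<beta> *\<^sub>R (\<mu> u m *\<^sub>R p m - q m)"
      using frame[OF n] frame[OF m] pq' by (simp add: X_def)
    have "(2 :: real) *\<^sub>R q' = (s *\<^sub>R p' + q') - (s *\<^sub>R p' - q')" by (simp add: scaleR_2)
    also have "\<dots> = (2 :: real) *\<^sub>R (\<alpha> *\<^sub>R q n + \<beta> *\<^sub>R q m)" unfolding e e' by (simp add: X_def vec_eq_iff algebra_simps)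
    finally have qq: "q' = \<alpha> *\<^sub>R q n + \<beta> *\<^sub>R q m" by simp
    then have "s *\<^sub>R p' = (\<alpha> * \<mu> u n) *\<^sub>R p n + (\<beta> * \<mu> u m) *\<^sub>R p m"
      using e by (simp add: X_def algebra_simps)
    then show ?thesis using s(1) qq by blast
  qed
  obtain s \<alpha> \<beta> where 1: "s \<noteq> 0" "q' = \<alpha> *\<^sub>R q n + \<beta> *\<^sub>R q m" "s *\<^sub>R p' = (\<alpha> * \<mu> v n) *\<^sub>R p n + (\<beta> * \<mu> v m) *\<^sub>R p m"
    using split[OF vo(1) adj(1,2) ct(1)[folded v_def]] by blast
  obtain s' \<alpha>' \<beta>' where 2: "s' \<noteq> 0" "q' = \<alpha>' *\<^sub>R q n + \<beta>' *\<^sub>R q m" "s' *\<^sub>R p' = (\<alpha>' * \<mu> v' n) *\<^sub>R p n + (\<beta>' * \<mu> v' m) *\<^sub>R p m"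
    using split[OF vo(2) adj(3,4) ct(2)[folded v'_def]] by blast
  have P: "sympl (p n) (p m) \<noteq> 0" "sympl (p m) (p n) \<noteq> 0" and Q: "sympl (q n) (q m) \<noteq> 0" "sympl (q m) (q n) \<noteq> 0"
    using sympl_p_ne[OF n adj(5)] sympl_q_ne[OF n adj(5)] sympl_commute[of "p m"] sympl_commute[of "q m"] by auto
  have ab: "\<alpha>' = \<alpha>" "\<beta>' = \<beta>"
    using arg_cong[OF trans[OF 1(2)[symmetric] 2(2)], of "\<lambda>x. sympl x (q m)"]
      arg_cong[OF trans[OF 1(2)[symmetric] 2(2)], of "\<lambda>x. sympl x (q n)"] Q by simp_all
  have \<open>s * sympl p' (p m) = \<alpha> * \<mu> v n * sympl (p n) (p m)\<close> "s * sympl p' (p n) = \<beta> * \<mu> v m * sympl (p m) (p n)"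
    using arg_cong[OF 1(3), of "\<lambda>x. sympl x (p m)"] arg_cong[OF 1(3), of "\<lambda>x. sympl x (p n)"] by simp_all
  moreover have \<open>s' * sympl p' (p m) = \<alpha> * \<mu> v' n * sympl (p n) (p m)\<close> "s' * sympl p' (p n) = \<beta> * \<mu> v' m * sympl (p m) (p n)"
    using arg_cong[OF 2(3), of "\<lambda>x. sympl x (p m)"] arg_cong[OF 2(3), of "\<lambda>x. sympl x (p n)"] ab by simp_all
  ultimately have "\<alpha> * (s' * \<mu> v n - s * \<mu> v' n) * sympl (p n) (p m) = 0" "\<beta> * (s' * \<mu> v m - s * \<mu> v' m) * sympl (p m) (p n) = 0"
    by algebra+
  then have z: "\<alpha> = 0 \<or> s' * \<mu> v n = s * \<mu> v' n" "\<beta> = 0 \<or> s' * \<mu> v m = s * \<mu> v' m" using P by auto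
  have pr: "\<mu> v n * \<mu> v m = \<mu> v' n * \<mu> v' m" by (rule \<mu>_face[OF vo adj(1,2,3,4,5)])
  have "\<alpha> \<noteq> 0"
  proof
    assume "\<alpha> = 0"
    then have "q' = \<beta> *\<^sub>R q m" using 1(2) by simp
    then have "q' \<in> L (g m)" using frame[OF m] line_scale[OF oriented_g[OF m]] by blast
    then show False using common_point_imp_contact[OF oG oriented_g[OF m] q'(1,2)] nc by (simp add: m_def)
  qed
  have "\<beta> = 0"
  proof (rule ccontr)
    assume "\<beta> \<noteq> 0"
    then have e: "s' * \<mu> v n = s * \<mu> v' n" "s' * \<mu> v m = s * \<mu> v' m" using z \<open>\<alpha> \<noteq> 0\<close> by auto
    have "s' * \<mu> v m * ((\<mu> v n)\<^sup>2 - (\<mu> v' n)\<^sup>2) = 0" using e pr by algebra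
    then show False using 2(1) \<mu>_nonzero[OF vo(1) adj(2)] \<mu>_square_ne[OF vo(1) adj(7,8,6)] by simp
  qed
  have "q' \<in> L (g n)" using 1(2) \<open>\<beta> = 0\<close> frame[OF n] line_scale[OF oriented_g[OF n]] by simp
  have "p' = (1 / s) *\<^sub>R (s *\<^sub>R p')" using 1(1) by simp
  also have "\<dots> = (1 / s * (\<alpha> * \<mu> v n)) *\<^sub>R p n" unfolding 1(3) using \<open>\<beta> = 0\<close> by simp
  finally have "p' \<in> L (g n)" using frame[OF n] line_scale[OF oriented_g[OF n]] by metis
  have "L G = L (g n)"
    using geodesic_line_eq[OF G p'(2) q'(2) p'(1) q'(1) pq']
      geodesic_line_eq[OF geodesic_g[OF n] \<open>p' \<in> L (g n)\<close> \<open>q' \<in> L (g n)\<close> p'(1) q'(1) pq'] by simp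
  then show ?thesis by (rule line_eq_imp_same_circle[OF oG oriented_g[OF n]])
qed

context lie_plucker
begin

lemma geodesics_determined:
  assumes w: "w \<in> A2 (-1)"
    and gc: "geodesic_circle_complex g c" "generic (combine g c)"
    and gc': "geodesic_circle_complex g' c'" "generic (combine g' c')"
    and star: "\<And>n. n \<in> star_region w \<Longrightarrow> same_circle (g' n) (g n)" and n: "even_site n"
  shows "same_circle (g' n) (g n)"
proof -
  obtain p q where "generic_frame \<Phi> g c p q" by (rule generic_frame_exists[OF gc])
  then interpret F: generic_frame \<Phi> g c p q .
  obtain p' q' where "generic_frame \<Phi> g' c' p' q'" by (rule generic_frame_exists[OF gc'])
  then interpret F': generic_frame \<Phi> g' c' p' q' .
  \<comment> \<open>Circles are compared up to reflection only; this suffices, since contact with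
    geodesic circles does not see the reflection.\<close>
  define D where "D = {n. if even_site n then same_circle (g' n) (g n)
    else same_circle (c' n) (c n) \<or> same_circle (c' n) (reflect (c n))}"
  have "n \<in> D"
  proof (rule geodesic_closure[OF w _ _ _ n])
    show "star_region w \<subseteq> D"
    proof
      fix m assume m: "m \<in> star_region w"
      then have "even_site m" using star_region_A2[OF w m] by (simp add: A2_def even_site_def)
      then show "m \<in> D" using star[OF m] by (simp add: D_def)
    qed
  next
    fix v a assume v: "\<not> even_site v" and a: "cube_edges a" and h: "v + a 1 \<in> D" "v + a 2 \<in> D" "v + a 3 \<in> D"
    obtain r s t where rst: "\<bar>r\<bar> = 1" "\<bar>s\<bar> = 1" "\<bar>t\<bar> = 1" "a = sign_edges r s t" using cube_edgesE a by blast
    have adj: "adjacent v (v + a k)" for k using exhaust_3[of k] rst(1-3) by (auto simp: rst(4) adjacent_iff)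
    have "contact (g (v + a k)) (c' v)" for k
    proof -
      have "even_site (v + a k)" using adjacent_parity adj v by blast
      moreover have "v + a k \<in> D" using h exhaust_3[of k] by auto
      ultimately show ?thesis using F'.contact_gc[OF v adj[of k]] contact_same_circle contact_commute unfolding D_def mem_Collect_eq by metis
    qed
    then show "v \<in> D" using F.circle_unique[OF v a F'.oriented_c[OF v]] v by (simp add: D_def)
  next
    fix n a and j k :: 3
    assume n: "even_site n" and a: "cube_edges a" and jk: "j \<noteq> k"
      and h: "n + a j \<in> D" "n + a k \<in> D" "n + a j + a k \<in> D"
    obtain r s t where rst: "\<bar>r\<bar> = 1" "\<bar>s\<bar> = 1" "\<bar>t\<bar> = 1" "a = sign_edges r s t" using cube_edgesE a by blast
    have adj: "adjacent (n + a i) n" "adjacent n (n + a i)" for i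
      using exhaust_3[of i] rst(1-3) by (auto simp: rst(4) adjacent_iff)
    have d: "diagonal n (n + a j + a k)"
      using exhaust_3[of j] exhaust_3[of k] jk rst(1-3) by (auto simp: rst(4) diagonal_def)
    have par: "\<not> even_site (n + a i)" "even_site (n + a j + a k)" for i
      using adjacent_parity adj n diagonal_parity[OF d] by blast+
    have ct: "contact (g' n) (c (n + a i))" if "n + a i \<in> D" for i
      using F'.contact_gc[OF par(1) adj(1), of i] that par(1)[of i] contact_same_circle contact_reflect_geodesic[OF F'.geodesic_g[OF n]]
      by (simp add: D_def) metis
    have "\<not> contact (g' n) (g (n + a j + a k))"
      using F'.generic_g[OF n d] h(3) par(2) contact_same_circle unfolding D_def mem_Collect_eq by metis
    then show "n \<in> D" using F.second_geodesic[OF n a jk F'.geodesic_g[OF n] ct[OF h(1)] ct[OF h(2)]] n by (simp add: D_def)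
  qed
  then show ?thesis using n by (simp add: D_def)
qed

lemma cauchy_data_of_complex:
  assumes w: "w \<in> A2 (-1)" and gc: "geodesic_circle_complex g c" "generic (combine g c)"
  shows "cauchy_data w g"
proof -
  define u where "u = opposite_site w unit_step"
  have w': "w $ 1 + w $ 2 + w $ 3 = -1" using w by (simp add: A2_def)
  have ev: "even_site u" using w' by (simp add: u_def opposite_site_def even_site_def) presburger
  have uo: "\<not> even_site (u - unit_step k)" for k
    using w' exhaust_3[of k] unfolding u_def opposite_site_def even_site_def by (elim disjE) (simp; presburger)+
  have adj: "adjacent u (u - unit_step k)" for k by (auto simp: adjacent_def)
  have A2e: "n \<in> A2 0 \<Longrightarrow> even_site n" for n by (simp add: A2_def even_site_def)
  have "\<not> same_circle (g u) (g (w + unit_step k))" for k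
  proof
    have d: "diagonal u (w + unit_step k)"
      using exhaust_3[of k] by (auto simp: u_def opposite_site_def diagonal_def)
    have e: "even_site (w + unit_step k)" using diagonal_parity[OF d] ev by simp
    assume "same_circle (g u) (g (w + unit_step k))"
    moreover have "contact (g u) (g u)"
      using gc(1) ev by (simp add: geodesic_circle_complex_def geodesic_circle_def oriented_circle_def contact_def)
    ultimately have "contact (g u) (g (w + unit_step k))" using contact_same_circle by blast
    then show False using generic_diagonal[OF gc(2) d] ev e by simp
  qed
  moreover have "geodesic_circle (g n)" if "n \<in> star_region w" for n
    using gc(1) A2e[OF star_region_A2[OF w that]] by (simp add: geodesic_circle_complex_def)
  ultimately show ?thesis
    unfolding cauchy_data_def u_def[symmetric]
    using gc(1) ev uo adj A2e adjacent_commute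
    by (intro conjI exI[of _ "\<lambda>k. c (u - unit_step k)"] exI[of _ "g u"]) (auto simp: geodesic_circle_complex_def)
qed

lemma reflected_complex:
  assumes "geodesic_circle_complex g c"
  shows "geodesic_circle_complex g (\<lambda>v. if v \<in> S then reflect (c v) else c v)"
  using assms contact_reflect_geodesic unfolding geodesic_circle_complex_def by auto

lemma same_or_reflected:
  assumes gc: "geodesic_circle_complex g c" "generic (combine g c)" and c': "geodesic_circle_complex g c'" and v: "\<not> even_site v"
  shows "same_circle (c' v) (c v) \<or> same_circle (c' v) (reflect (c v))"
proof -
  obtain p q where "generic_frame \<Phi> g c p q" by (rule generic_frame_exists[OF gc])
  then have "spinor_frame \<Phi> g c p q" by (simp add: generic_frame_def)
  then show ?thesis using spinor_frame_same_or_reflected spinor_frame_change c' v by metis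
qed

lemma not_same_reflected:
  assumes gc: "geodesic_circle_complex g c" "generic (combine g c)" and v: "\<not> even_site v"
  shows "\<not> same_circle (reflect (c v)) (c v)"
proof -
  obtain p q where "generic_frame \<Phi> g c p q" by (rule generic_frame_exists[OF gc])
  then interpret F: generic_frame \<Phi> g c p q .
  show ?thesis using not_same_circle_reflect F.oriented_c F.c_not_geodesic v by blast
qed

end

section \<open>The choice of the circles\<close>

lemma coplanar_if_span_ne_UNIV: "span S \<noteq> UNIV \<Longrightarrow> coplanar_points S"
  using span_not_UNIV_orthogonal[of S] span_base unfolding coplanar_points_def by blast

text \<open>If some pair is not conjugate, the components of the other two points polar to that pair
  are polar to all four: either one of them gives the plane, or all points lie on a line. If all
  pairs are conjugate, the span is isotropic and cannot be the whole space.\<close>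

lemma coplanar_if_pfaffian_eq_0:
  assumes pf: "pfaffian x1 x2 x3 x4 = 0"
  shows "coplanar_points {x1, x2, x3, x4}"
proof -
  have base: "coplanar_points {a, b, c, d}" if pf: "pfaffian a b c d = 0" and ab: "sympl a b \<noteq> 0" for a b c d
  proof -
    define y where "y = sympl a b *\<^sub>R c + sympl b c *\<^sub>R a - sympl a c *\<^sub>R b"
    define z where "z = sympl a b *\<^sub>R d + sympl b d *\<^sub>R a - sympl a d *\<^sub>R b"
    have s: "sympl b a = - sympl a b" "sympl c a = - sympl a c" "sympl d a = - sympl a d"
      "sympl c b = - sympl b c" "sympl d b = - sympl b d" "sympl d c = - sympl c d" by (simp_all add: sympl_commute[of b a]
        sympl_commute[of c a] sympl_commute[of d a] sympl_commute[of c b] sympl_commute[of d b] sympl_commute[of d c])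
    have y: "sympl y a = 0" "sympl y b = 0" "sympl y c = 0" "sympl y d = 0"
      and z: "sympl z a = 0" "sympl z b = 0" "sympl z c = 0" "sympl z d = 0"
      using pf unfolding pfaffian_def by (simp_all add: y_def z_def s algebra_simps)
    show ?thesis
    proof (cases "y = 0 \<and> z = 0")
      case True
      have "c = (1 / sympl a b) *\<^sub>R (y - sympl b c *\<^sub>R a + sympl a c *\<^sub>R b)"
        "d = (1 / sympl a b) *\<^sub>R (z - sympl b d *\<^sub>R a + sympl a d *\<^sub>R b)"
        using ab by (simp_all add: y_def z_def)
      then have "c \<in> span {a, b}" "d \<in> span {a, b}"
        using True by (metis (no_types, lifting) insertI1 insert_commute span_add span_base span_diff span_scale span_zero)+
      then have "span {a, b, c, d} \<subseteq> span {a, b}" by (intro span_minimal) (auto intro: span_base)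
      moreover have "dim (span {a, b}) \<le> 2"
      proof -
        have "dim {a, b} \<le> card {a, b}" by (rule dim_le_card') simp
        also have "\<dots> \<le> 2" by (simp add: card_insert_if)
        finally show ?thesis by simp
      qed
      ultimately have "dim (span {a, b, c, d}) \<le> 2" using dim_subset order_trans by blast
      then have "span {a, b, c, d} \<noteq> UNIV" by (auto dest: arg_cong[of _ _ dim])
      then show ?thesis by (rule coplanar_if_span_ne_UNIV)
    next
      case False
      then have "\<exists>u. u \<noteq> 0 \<and> (\<forall>v\<in>{a, b, c, d}. sympl u v = 0)" using y z by auto
      then obtain u where u: "u \<noteq> 0" "\<forall>v\<in>{a, b, c, d}. sympl u v = 0" by blast
      show ?thesis unfolding coplanar_points_def
        by (rule exI[of _ "sympl_dual u"]) (use u in \<open>auto simp: inner_commute[of "sympl_dual u"] inner_sympl_dual\<close>)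
    qed
  qed
  have s: "sympl v u = - sympl u v" for u v by (rule sympl_commute)
  consider "sympl x1 x2 \<noteq> 0" | "sympl x1 x3 \<noteq> 0" | "sympl x1 x4 \<noteq> 0" | "sympl x2 x3 \<noteq> 0" | "sympl x2 x4 \<noteq> 0"
    | "sympl x3 x4 \<noteq> 0" | "\<forall>u\<in>{x1, x2, x3, x4}. \<forall>v\<in>{x1, x2, x3, x4}. sympl u v = 0"
    using s[of x1 x2] s[of x1 x3] s[of x1 x4] s[of x2 x3] s[of x2 x4] s[of x3 x4] by auto
  then show ?thesis
  proof cases
    case 7
    show ?thesis
    proof (rule coplanar_if_span_ne_UNIV, rule ccontr)
      let ?S = "{x1, x2, x3, x4}"
      assume "\<not> span ?S \<noteq> UNIV"
      have 1: "sympl u v = 0" if u: "u \<in> ?S" for u v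
      proof -
        have "v \<in> span ?S" using \<open>\<not> span ?S \<noteq> UNIV\<close> by simp
        also have "span ?S \<subseteq> {v. sympl u v = 0}" using 7 u by (intro span_minimal) (auto simp: subspace_def)
        finally show ?thesis by simp
      qed
      then have "x1 = 0" "x2 = 0" "x3 = 0" "x4 = 0" using sympl_nondegenerate by blast+
      then have "axis 0 1 \<in> span {0 :: real^4}" using \<open>\<not> span ?S \<noteq> UNIV\<close> by simp
      then show False by (simp add: axis_eq_0_iff span_singleton)
    qed
  next
    case 1 then show ?thesis using base[of x1 x2 x3 x4] pf by simp
  next
    case 2
    then show ?thesis using base[of x1 x3 x2 x4] pf s[of x2 x3] by (simp add: pfaffian_def insert_commute)
  next
    case 3
    then show ?thesis using base[of x1 x4 x2 x3] pf s[of x2 x4] s[of x3 x4] by (simp add: pfaffian_def insert_commute algebra_simps)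
  next
    case 4
    then show ?thesis using base[of x2 x3 x1 x4] pf s[of x1 x2] s[of x1 x3] by (simp add: pfaffian_def insert_commute algebra_simps)
  next
    case 5
    then show ?thesis using base[of x2 x4 x1 x3] pf s[of x1 x2] s[of x1 x4] s[of x3 x4] by (simp add: pfaffian_def insert_commute algebra_simps)
  next
    case 6
    then show ?thesis using base[of x3 x4 x1 x2] pf s[of x1 x3] s[of x1 x4] s[of x2 x3] s[of x2 x4] by (simp add: pfaffian_def insert_commute algebra_simps)
  qed
qed

lemma (in generic_frame) twisted_imp_fundamental:
  assumes tw: "\<And>v a. \<not> even_site v \<Longrightarrow> cube_edges a \<Longrightarrow> twisted (cube_\<mu> v a)"
  shows "fundamental_circle_complex \<Phi> (combine g c)"
proof -
  define P where "P l n = (if even_site n then X (n + unit_step l) n else X n (n + unit_step l))" for l n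
  have adj: "adjacent n (n + unit_step l)" "adjacent (n + unit_step l) n" for l n by (auto simp: adjacent_def)
  have meets: "meets_in (L (combine g c n)) (L (combine g c (n + unit_step l))) (P l n)" for l n
  proof (cases "even_site n")
    case True
    then have "\<not> even_site (n + unit_step l)" using adjacent_parity adj by blast
    then show ?thesis using meets_X(2)[OF _ adj(2)] True by (simp add: P_def)
  next
    case False
    then have "even_site (n + unit_step l)" using adjacent_parity adj by blast
    then show ?thesis using meets_X(1)[OF False adj(1)] False by (simp add: P_def)
  qed
  have "coplanar_points {P l n, P l (n + unit_step m), P l (n + unit_step m + unit_step k), P l (n + unit_step k)}"
    if lmk: "l \<noteq> m" "m \<noteq> k" "l \<noteq> k" for l m k n
  proof -
    define idx :: "3 \<Rightarrow> nat" where "idx i = (if i = 1 then 1 else if i = 2 then 2 else 3)" for i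
    \<comment> \<open>The cube is seen from the odd end of the edge in direction \<open>l\<close> at
      \<open>n\<close>, so that \<open>tetra_coplanar\<close> applies to the four edges parallel to
      \<open>l\<close>; \<open>idx\<close> turns directions into indices.\<close>
    define v where "v = (if even_site n then n + unit_step l else n)"
    define a where "a = (unit_step(l := (if even_site n then - unit_step l else unit_step l)))"
    have v: "\<not> even_site v" using adjacent_parity[OF adj(1), of n l] by (simp add: v_def)
    have a: "cube_edges a" by (simp add: a_def cube_edges_def)
    have al: "a m = unit_step m" "a k = unit_step k" "a l = (if even_site n then - unit_step l else unit_step l)"
      using lmk by (simp_all add: a_def)
    have gv: "geodesic_vertex v a (idx i) = v + a i" for i
      using exhaust_3[of i] by (auto simp: geodesic_vertex_def idx_def)
    have cv: "circle_vertex v a (idx l) = v + a m + a k" "circle_vertex v a (idx m) = v + a l + a k"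
      "circle_vertex v a (idx k) = v + a l + a m" and g0: "geodesic_vertex v a 0 = v + a l + a m + a k"
      using exhaust_3[of l] exhaust_3[of m] exhaust_3[of k] lmk
      by (auto simp: circle_vertex_def geodesic_vertex_def idx_def ac_simps)
    have c0: "circle_vertex v a 0 = v" by (simp add: circle_vertex_def)
    have d: "idx l \<in> {1, 2, 3}" "idx m \<in> {1, 2, 3}" "idx k \<in> {1, 2, 3}" "distinct [idx l, idx m, idx k]"
      using exhaust_3[of l] exhaust_3[of m] exhaust_3[of k] lmk by (auto simp: idx_def)
    have par: "\<not> even_site (n + unit_step i) \<longleftrightarrow> even_site n" "even_site (n + unit_step i + unit_step j) \<longleftrightarrow> even_site n" for i j
      using adjacent_parity[OF adj(1), of n i] adjacent_parity[OF adj(1), of "n + unit_step i" j] by auto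
    have e: "P l n = X (circle_vertex v a 0) (geodesic_vertex v a (idx l))"
      "P l (n + unit_step m) = X (circle_vertex v a (idx k)) (geodesic_vertex v a (idx m))"
      "P l (n + unit_step m + unit_step k) = X (circle_vertex v a (idx l)) (geodesic_vertex v a 0)"
      "P l (n + unit_step k) = X (circle_vertex v a (idx m)) (geodesic_vertex v a (idx k))"
      unfolding cv g0 c0 gv al using par by (auto simp: P_def v_def ac_simps)
    from tetra_coplanar[OF tetra_cube[OF v a] tw[OF v a, unfolded cube_\<mu>_def[abs_def]] d]
    have "pfaffian (P l n) (P l (n + unit_step m)) (P l (n + unit_step m + unit_step k)) (P l (n + unit_step k)) = 0"
      unfolding e X_def .
    then show ?thesis by (rule coplanar_if_pfaffian_eq_0)
  qed
  moreover have "oriented_circle (combine g c n)" for n using oriented_g oriented_c by (simp add: combine_def)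
  ultimately show ?thesis
    unfolding fundamental_circle_complex_def using meets by (intro conjI exI[of _ P] allI impI) blast+
qed

section \<open>Existence and uniqueness of the correlated choice\<close>

context lie_plucker
begin

text \<open>By \<open>twisted_iff_sign_product\<close>, a potential with product -1 over the circles
  of every cube is needed. Reflecting the circles where the given potential \<open>\<kappa>\<close>
  differs from a solution \<open>S\<close> replaces the one by the other, and the data stay
  untouched.\<close>

lemma correlated_choice_exists:
  assumes w: "w \<in> A2 (-1)" and gc: "geodesic_circle_complex g c0" "generic (combine g c0)"
    and centre: "correlated_in_cube \<Phi> (combine g c0) w unit_step"
  obtains c where "geodesic_circle_complex g c" "\<And>v. v \<in> data_circle_sites w \<Longrightarrow> same_circle (c v) (c0 v)"
    "\<And>v a. \<not> even_site v \<Longrightarrow> cube_edges a \<Longrightarrow> correlated_in_cube \<Phi> (combine g c) v a"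
proof -
  obtain p q where F0: "generic_frame \<Phi> g c0 p q" by (rule generic_frame_exists[OF gc])
  then interpret F: generic_frame \<Phi> g c0 p q .
  obtain \<kappa> where \<kappa>: "F.sign_potential \<kappa>" using F.sign_potential_exists by blast
  have \<kappa>s: "\<kappa> n = 1 \<or> \<kappa> n = -1" for n using \<kappa> by (simp add: F.sign_potential_def)
  have wo: "\<not> even_site w" using w by (simp add: A2_def even_site_def)
  have ue: "cube_edges unit_step" by (simp add: cube_edges_def)
  have "\<kappa> w * \<kappa> (w + unit_step 1 + unit_step 2) * \<kappa> (w + unit_step 2 + unit_step 3) * \<kappa> (w + unit_step 3 + unit_step 1) = -1"
    using centre correlated_in_cube_iff[OF F0 wo ue] F.twisted_iff_sign_product[OF \<kappa> wo ue] by simp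
  then obtain S where S: "\<And>n. S n = 1 \<or> S n = -1" "\<And>v. v \<in> data_circle_sites w \<Longrightarrow> S v = \<kappa> v"
    "\<And>v a. \<not> even_site v \<Longrightarrow> cube_edges a \<Longrightarrow> S v * S (v + a 1 + a 2) * S (v + a 2 + a 3) * S (v + a 3 + a 1) = -1"
    by (rule sign_solution[of w \<kappa>, OF w \<kappa>s]) (rule that, assumption+)
  define c where "c = (\<lambda>v. if v \<in> {v. S v \<noteq> \<kappa> v} then reflect (c0 v) else c0 v)"
  have cc: "geodesic_circle_complex g c" unfolding c_def by (rule reflected_complex[OF gc(1)])
  have F1: "generic_frame \<Phi> g c p q" by (rule generic_frame_change[OF F0 cc])
  then interpret F': generic_frame \<Phi> g c p q .
  have pot: "F'.sign_potential (\<lambda>n. if even_site n then \<kappa> n else S n)"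
    unfolding F'.sign_potential_def
  proof (intro conjI allI impI)
    fix v n assume vn: "\<not> even_site v \<and> adjacent v n"
    then have v: "\<not> even_site v" and n: "even_site n" using adjacent_parity by blast+
    obtain \<tau> where \<tau>: "\<tau> = 1 \<and> same_circle (c v) (c0 v) \<or> \<tau> = -1 \<and> same_circle (c v) (reflect (c0 v))"
      "\<And>n. adjacent v n \<Longrightarrow> F'.\<mu> v n = \<tau> * F.\<mu> v n"
      using spinor_frame_same_or_reflected[OF F.spinor_frame_axioms F'.spinor_frame_axioms v] by blast
    have nr: "\<not> same_circle (reflect (c0 v)) (c0 v)" by (rule not_same_reflected[OF gc v])
    have "\<tau> = \<kappa> v * S v"
    proof (cases "S v = \<kappa> v")
      case True
      then have "c v = c0 v" by (simp add: c_def)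
      then have "\<tau> = 1" using \<tau>(1) nr same_circle_sym by metis
      then show ?thesis using True \<kappa>s[of v] by auto
    next
      case False
      then have "c v = reflect (c0 v)" by (simp add: c_def)
      then have "\<tau> = -1" using \<tau>(1) nr by metis
      then show ?thesis using False \<kappa>s[of v] S(1)[of v] by auto
    qed
    moreover have "sgn (F.\<mu> v n) = \<kappa> v * \<kappa> n" using \<kappa> vn by (simp add: F.sign_potential_def)
    ultimately have "sgn (F'.\<mu> v n) = S v * \<kappa> n"
      using \<tau>(2)[of n] vn \<kappa>s[of v] S(1)[of v] by (auto simp: sgn_mult sgn_minus)
    then show "sgn (F'.\<mu> v n) = (if even_site v then \<kappa> v else S v) * (if even_site n then \<kappa> n else S n)"
      using v n by simp
  qed (use \<kappa>s S(1) in auto)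
  show ?thesis
  proof (rule that[OF cc])
    show "same_circle (c v) (c0 v)" if "v \<in> data_circle_sites w" for v using S(2)[OF that] by (simp add: c_def)
    fix v a assume v: "\<not> even_site v" and a: "cube_edges a"
    note V = cube_vertices(1)[OF a v, of 1 0] cube_vertices(1)[OF a v, of 2 0] cube_vertices(1)[OF a v, of 3 0]
    have "\<not> even_site (v + a 2 + a 3)" "\<not> even_site (v + a 3 + a 1)" "\<not> even_site (v + a 1 + a 2)"
      using V by (simp_all add: circle_vertex_def)
    then show "correlated_in_cube \<Phi> (combine g c) v a"
      using correlated_in_cube_iff[OF F1 v a] F'.twisted_iff_sign_product[OF pot v a] S(3)[OF v a] v by simp
  qed
qed

lemma correlation_extensionI:
  assumes w: "w \<in> A2 (-1)" and c: "geodesic_circle_complex g c" "\<And>v. v \<in> data_circle_sites w \<Longrightarrow> same_circle (c v) (c0 v)"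
    "\<And>v a. \<not> even_site v \<Longrightarrow> cube_edges a \<Longrightarrow> correlated_in_cube \<Phi> (combine g c) v a"
  shows "correlation_extension \<Phi> w g c0 c"
proof -
  have "v \<in> dictated_sites \<Phi> w (combine g c)" if "\<not> even_site v" for v
    by (rule dictated_closure[OF w _ _ that]) (use c(3) in \<open>auto intro: dictated_sites.intros\<close>)
  then show ?thesis using c by (simp add: correlation_extension_def)
qed

text \<open>A derivation in \<open>dictated_sites\<close> provides correlation only in the cubes it
  uses. Along it, \<open>c1\<close> is compared with a choice \<open>c\<close> correlated
  everywhere: when three circles agree, the sign of the fourth enters the condition to the third
  power and must be 1. Correlation in all other cubes is then inherited from
  \<open>c\<close>.\<close>

lemma correlation_extension_unique:
  assumes w: "w \<in> A2 (-1)" and gc: "geodesic_circle_complex g c0" "generic (combine g c0)"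
    and c: "geodesic_circle_complex g c" "\<And>v. v \<in> data_circle_sites w \<Longrightarrow> same_circle (c v) (c0 v)"
    "\<And>v a. \<not> even_site v \<Longrightarrow> cube_edges a \<Longrightarrow> correlated_in_cube \<Phi> (combine g c) v a"
    and c1: "correlation_extension \<Phi> w g c0 c1"
  shows "\<And>v. \<not> even_site v \<Longrightarrow> same_circle (c1 v) (c v)"
    and "\<And>v a. \<not> even_site v \<Longrightarrow> cube_edges a \<Longrightarrow> correlated_in_cube \<Phi> (combine g c1) v a"
proof -
  obtain p q where F0: "generic_frame \<Phi> g c0 p q" by (rule generic_frame_exists[OF gc])
  have c1': "geodesic_circle_complex g c1" using c1 by (simp add: correlation_extension_def)
  have F: "generic_frame \<Phi> g c p q" and F1: "generic_frame \<Phi> g c1 p q" using generic_frame_change[OF F0] c(1) c1' by blast+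
  interpret F: generic_frame \<Phi> g c p q by (rule F)
  interpret F1: generic_frame \<Phi> g c1 p q by (rule F1)
  have "\<exists>\<tau>. (\<tau> = 1 \<and> same_circle (c1 v) (c v) \<or> \<tau> = -1 \<and> \<not> same_circle (c1 v) (c v)) \<and>
    (\<forall>n. adjacent v n \<longrightarrow> F1.\<mu> v n = \<tau> * F.\<mu> v n)" if v: "\<not> even_site v" for v
  proof -
    obtain \<tau> where \<tau>: "\<tau> = 1 \<and> same_circle (c1 v) (c v) \<or> \<tau> = -1 \<and> same_circle (c1 v) (reflect (c v))"
      "\<And>n. adjacent v n \<Longrightarrow> F1.\<mu> v n = \<tau> * F.\<mu> v n"
      using spinor_frame_same_or_reflected[OF F.spinor_frame_axioms F1.spinor_frame_axioms v] by blast
    have "\<not> same_circle (reflect (c v)) (c v)" using not_same_circle_reflect F.oriented_c F.c_not_geodesic v by blast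
    then have "\<not> (same_circle (c1 v) (c v) \<and> same_circle (c1 v) (reflect (c v)))"
      using same_circle_sym same_circle_trans by blast
    then show ?thesis using \<tau> by (intro exI[of _ \<tau>]) blast
  qed
  then obtain \<tau> where \<tau>: "\<And>v. \<not> even_site v \<Longrightarrow> \<tau> v = 1 \<and> same_circle (c1 v) (c v) \<or> \<tau> v = -1 \<and> \<not> same_circle (c1 v) (c v)"
    "\<And>v n. \<not> even_site v \<Longrightarrow> adjacent v n \<Longrightarrow> F1.\<mu> v n = \<tau> v * F.\<mu> v n" by metis
  have mu: "F1.cube_\<mu> v a i k = \<tau> (circle_vertex v a i) * F.cube_\<mu> v a i k"
    if "\<not> even_site v" "cube_edges a" "i \<in> {..<4}" "k \<in> {..<4}" "i \<noteq> k" for v a i k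
    using \<tau>(2)[OF cube_vertices(1,3)[OF that(2,1,3,4,5)]] by (simp add: F1.cube_\<mu>_def F.cube_\<mu>_def)
  have tw: "twisted (F.cube_\<mu> v a)" if "\<not> even_site v" "cube_edges a" for v a
    using c(3)[OF that] correlated_in_cube_iff[OF F that] by blast
  have nz: "F.cube_\<mu> v a 0 1 * F.cube_\<mu> v a 0 2 * F.cube_\<mu> v a 0 3 \<noteq> 0" if v: "\<not> even_site v" and a: "cube_edges a" for v a
    using tetraD(2)[OF F.tetra_cube[OF v a], of 0 1] tetraD(2)[OF F.tetra_cube[OF v a], of 0 2]
      tetraD(2)[OF F.tetra_cube[OF v a], of 0 3] by (simp add: F.cube_\<mu>_def)
  have same: "same_circle (c1 v) (c v)" if v: "v \<in> dictated_sites \<Phi> w (combine g c1)" "\<not> even_site v" for v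
    using v
  proof (induction rule: dictated_sites.induct)
    case (data v)
    then have "same_circle (c1 v) (c0 v)" using c1 by (simp add: correlation_extension_def)
    then show ?case using c(2)[OF data(1)] same_circle_sym same_circle_trans by blast
  next
    case (step v a)
    note v = step.hyps(1) and a = step.hyps(2)
    note V = cube_vertices(1)[OF a v, of 1 0] cube_vertices(1)[OF a v, of 2 0] cube_vertices(1)[OF a v, of 3 0]
    have odd: "\<not> even_site (v + a 2 + a 3)" "\<not> even_site (v + a 3 + a 1)" "\<not> even_site (v + a 1 + a 2)"
      using V by (simp_all add: circle_vertex_def)
    have "\<tau> (v + a 2 + a 3) = 1" "\<tau> (v + a 3 + a 1) = 1" "\<tau> (v + a 1 + a 2) = 1"
      using \<tau>(1) odd step.IH by blast+
    then have t: "\<tau> (circle_vertex v a 1) = 1" "\<tau> (circle_vertex v a 2) = 1" "\<tau> (circle_vertex v a 3) = 1"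
      "\<tau> (circle_vertex v a 0) = \<tau> v" by (simp_all add: circle_vertex_def)
    have "twisted (F1.cube_\<mu> v a)" using step.hyps correlated_in_cube_iff[OF F1 v a] by blast
    then have "F.cube_\<mu> v a 1 2 * F.cube_\<mu> v a 2 3 * F.cube_\<mu> v a 3 1 =
      - (\<tau> v * F.cube_\<mu> v a 0 1 * (\<tau> v * F.cube_\<mu> v a 0 2) * (\<tau> v * F.cube_\<mu> v a 0 3))"
      unfolding twisted_def by (simp add: mu[OF v a] t del: One_nat_def)
    moreover have "F.cube_\<mu> v a 1 2 * F.cube_\<mu> v a 2 3 * F.cube_\<mu> v a 3 1 =
      - (F.cube_\<mu> v a 0 1 * F.cube_\<mu> v a 0 2 * F.cube_\<mu> v a 0 3)" using tw[OF v a] by (simp add: twisted_def)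
    ultimately have "\<tau> v \<noteq> -1" using nz[OF v a] by auto
    then show ?case using \<tau>(1)[OF v] by blast
  qed
  show all: "same_circle (c1 v) (c v)" if "\<not> even_site v" for v
    using same that c1 by (simp add: correlation_extension_def)
  show "correlated_in_cube \<Phi> (combine g c1) v a" if v: "\<not> even_site v" and a: "cube_edges a" for v a
  proof -
    have one: "\<tau> (circle_vertex v a i) = 1" if i: "i \<in> {..<4}" for i
    proof -
      have "\<not> even_site (circle_vertex v a i)" using cube_vertices(1)[OF a v, of i "if i = 0 then 1 else 0"] i by auto
      then show ?thesis using \<tau>(1) all by blast
    qed
    have "twisted (F1.cube_\<mu> v a)" using tw[OF v a] unfolding twisted_def
      by (simp add: mu[OF v a] one del: One_nat_def)
    then show ?thesis using correlated_in_cube_iff[OF F1 v a] by blast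
  qed
qed

end

section \<open>Fundamental circle complexes and the M-system\<close>

text \<open>
  \<open>chart A B C x\<close> says that the point \<open>x\<close> lies on the line with coordinates
  \<open>(1, A * C - B^2, A, C, B)\<close>, whose points are determined by their first two coordinates.
\<close>

definition chart :: "real \<Rightarrow> real \<Rightarrow> real \<Rightarrow> real^4 \<Rightarrow> bool" where
  "chart A B C x \<longleftrightarrow> x $ 2 = A * x $ 1 - B * x $ 0 \<and> x $ 3 = B * x $ 1 - C * x $ 0"

definition bracket :: "real^4 \<Rightarrow> real^4 \<Rightarrow> real" where
  "bracket x y = x $ 0 * y $ 1 - x $ 1 * y $ 0"

lemma bracket_scale [simp]: "bracket (r *\<^sub>R x) y = r * bracket x y" "bracket x (r *\<^sub>R y) = r * bracket x y"
  by (simp_all add: bracket_def algebra_simps)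

lemma chart_scale: "chart A B C x \<Longrightarrow> chart A B C (r *\<^sub>R x)"
  unfolding chart_def vector_scaleR_component real_scaleR_def by (elim conjE, intro conjI; algebra)

text \<open>Between two charted points the form is the difference of the symmetric blocks given by
  \<open>A\<close>, \<open>B\<close>, \<open>C\<close>, evaluated on the top components; each rank
  one step contributes a product of brackets. A negative \<open>k\<close> describes a step
  backwards.\<close>

lemma sympl_chart:
  assumes "chart A B C x" "chart A' B' C' y"
    and "A' = A - (v $ 0)\<^sup>2 / k - (z $ 0)\<^sup>2 / k'" "B' = B - v $ 0 * v $ 1 / k - z $ 0 * z $ 1 / k'"
    "C' = C - (v $ 1)\<^sup>2 / k - (z $ 1)\<^sup>2 / k'"
  shows "sympl x y = bracket x v * bracket y v / k + bracket x z * bracket y z / k'"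
proof -
  have "sympl x y = (x $ 0 * y $ 1 + x $ 1 * y $ 0) * (B' - B) - x $ 0 * y $ 0 * (C' - C) - x $ 1 * y $ 1 * (A' - A)"
    using assms(1,2) unfolding sympl_def chart_def by (elim conjE; algebra)
  also have "\<dots> = bracket x v * bracket y v / k + bracket x z * bracket y z / k'"
    unfolding assms(3-5) bracket_def by (simp add: power2_eq_square algebra_simps add_divide_distrib diff_divide_distrib)
  finally show ?thesis .
qed

lemma bracket_parallel:
  assumes "bracket x y = 0" "bracket y z \<noteq> 0"
  shows "\<exists>\<alpha>. x $ 0 = \<alpha> * y $ 0 \<and> x $ 1 = \<alpha> * y $ 1"
proof (cases "y $ 0 = 0")
  case True
  then have "y $ 1 \<noteq> 0" using assms(2) by (auto simp: bracket_def)
  then show ?thesis using assms(1) True by (intro exI[of _ "x $ 1 / y $ 1"]) (auto simp: bracket_def)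
next
  case False
  then show ?thesis using assms(1) by (intro exI[of _ "x $ 0 / y $ 0"]) (auto simp: bracket_def field_simps)
qed

lemma quadric_coefficients_zero:
  fixes X Y Z :: real
  assumes "u0 * w1 - u1 * w0 \<noteq> 0"
    and "X * u0\<^sup>2 + 2 * Y * (u0 * w0) + Z * w0\<^sup>2 = 0" "X * (u0 * u1) + Y * (u0 * w1 + u1 * w0) + Z * (w0 * w1) = 0"
    "X * u1\<^sup>2 + 2 * Y * (u1 * w1) + Z * w1\<^sup>2 = 0"
  shows "X = 0" "Y = 0" "Z = 0"
proof -
  have "X * (u0 * w1 - u1 * w0)\<^sup>2 = 0" "Y * (u0 * w1 - u1 * w0)\<^sup>2 = 0" "Z * (u0 * w1 - u1 * w0)\<^sup>2 = 0"
    using assms(2-4) by algebra+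
  then show "X = 0" "Y = 0" "Z = 0" using assms(1) by simp_all
qed

text \<open>Both ways around a face lead to the same block of indices 4, 5. The bracket conditions
  make \<open>u'\<close> and \<open>w'\<close> shifts of \<open>u\<close> and \<open>w\<close> along
  each other; comparing coefficients expresses both shifts by one number \<open>s\<close>, the
  future entry indexed by the two directions.\<close>

lemma M_face:
  fixes u w u' w' :: "real^4" and k l k' l' :: real
  assumes nz: "k \<noteq> 0" "l \<noteq> 0" "k' \<noteq> 0" "l' \<noteq> 0" "bracket u w \<noteq> 0"
    and g: "bracket u' w = bracket u w" "bracket w' u = bracket w u"
    and e: "(u $ 0)\<^sup>2 / k + (w' $ 0)\<^sup>2 / l' = (w $ 0)\<^sup>2 / l + (u' $ 0)\<^sup>2 / k'"
    "u $ 0 * u $ 1 / k + w' $ 0 * w' $ 1 / l' = w $ 0 * w $ 1 / l + u' $ 0 * u' $ 1 / k'"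
    "(u $ 1)\<^sup>2 / k + (w' $ 1)\<^sup>2 / l' = (w $ 1)\<^sup>2 / l + (u' $ 1)\<^sup>2 / k'"
  obtains s where "u' $ 0 = u $ 0 - s / l * w $ 0" "u' $ 1 = u $ 1 - s / l * w $ 1"
    "w' $ 0 = w $ 0 - s / k * u $ 0" "w' $ 1 = w $ 1 - s / k * u $ 1" "k' = k - s\<^sup>2 / l" "l' = l - s\<^sup>2 / k"
proof -
  have c: "bracket w u \<noteq> 0" using nz(5) by (simp add: bracket_def algebra_simps)
  have "bracket (u - u') w = 0" "bracket (w - w') u = 0" using g by (simp_all add: bracket_def algebra_simps)
  then obtain \<alpha> \<beta> where "(u - u') $ 0 = \<alpha> * w $ 0 \<and> (u - u') $ 1 = \<alpha> * w $ 1" "(w - w') $ 0 = \<beta> * u $ 0 \<and> (w - w') $ 1 = \<beta> * u $ 1"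
    using bracket_parallel c nz(5) by meson
  then have ab: "u' $ 0 = u $ 0 - \<alpha> * w $ 0" "u' $ 1 = u $ 1 - \<alpha> * w $ 1" "w' $ 0 = w $ 0 - \<beta> * u $ 0" "w' $ 1 = w $ 1 - \<beta> * u $ 1"
    by (auto simp: algebra_simps)
  \<comment> \<open>Coefficients of the difference of the two blocks in the squares and the product
    of \<open>u\<close> and \<open>w\<close>, a basis of the binary quadratic forms.\<close>
  define X Y Z where "X = 1 / k + \<beta>\<^sup>2 / l' - 1 / k'" and "Y = \<alpha> / k' - \<beta> / l'" and "Z = 1 / l' - 1 / l - \<alpha>\<^sup>2 / k'"
  have "X = 0" "Y = 0" "Z = 0"
  proof -
    have "u $ 0 * w $ 1 - u $ 1 * w $ 0 \<noteq> 0" using nz(5) by (simp add: bracket_def)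
    moreover have "X * (u $ 0)\<^sup>2 + 2 * Y * (u $ 0 * w $ 0) + Z * (w $ 0)\<^sup>2 = 0"
      "X * (u $ 0 * u $ 1) + Y * (u $ 0 * w $ 1 + u $ 1 * w $ 0) + Z * (w $ 0 * w $ 1) = 0"
      "X * (u $ 1)\<^sup>2 + 2 * Y * (u $ 1 * w $ 1) + Z * (w $ 1)\<^sup>2 = 0"
      using e unfolding ab X_def Y_def Z_def
      by (simp_all add: power2_eq_square algebra_simps add_divide_distrib diff_divide_distrib)
    ultimately show "X = 0" "Y = 0" "Z = 0" by (rule quadric_coefficients_zero)+
  qed
  then have x: "l' * k' + \<beta>\<^sup>2 * k * k' = k * l'" and y: "\<alpha> * l' = \<beta> * k'" and z: "l * k' = l' * k' + \<alpha>\<^sup>2 * l' * l"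
    using nz by (simp_all add: X_def Y_def Z_def field_simps)
  have k': "k' = k * (1 - \<alpha> * \<beta>)"
  proof -
    have "l' * (k' - k * (1 - \<alpha> * \<beta>)) = 0" using x y by algebra
    then show ?thesis using nz by simp
  qed
  have l': "l' = l * (1 - \<alpha> * \<beta>)"
  proof -
    have "k' * (l' - l * (1 - \<alpha> * \<beta>)) = 0" using z y by algebra
    then show ?thesis using nz by simp
  qed
  have "\<alpha> * l = \<beta> * k"
  proof -
    have "(1 - \<alpha> * \<beta>) * (\<alpha> * l - \<beta> * k) = 0" using y unfolding k' l' by algebra
    then show ?thesis using nz k' by auto
  qed
  then have "\<alpha> * l / k = \<beta>" using nz by (simp add: field_simps)
  show ?thesis
  proof (rule that[of "\<alpha> * l"])
    show "u' $ 0 = u $ 0 - \<alpha> * l / l * w $ 0" "u' $ 1 = u $ 1 - \<alpha> * l / l * w $ 1" using ab nz by simp_all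
    show "w' $ 0 = w $ 0 - \<alpha> * l / k * u $ 0" "w' $ 1 = w $ 1 - \<alpha> * l / k * u $ 1" unfolding \<open>\<alpha> * l / k = \<beta>\<close> by (rule ab)+
    have e: "(\<alpha> * l)\<^sup>2 / l = \<alpha> * (\<alpha> * l)" "(\<alpha> * l)\<^sup>2 / k = \<alpha> * l * \<beta>"
      unfolding \<open>\<alpha> * l / k = \<beta>\<close>[symmetric] using nz by (simp_all add: power2_eq_square)
    have "k' = k - \<alpha> * (\<alpha> * l)" unfolding k' \<open>\<alpha> * l = \<beta> * k\<close> by (simp add: algebra_simps)
    then show "k' = k - (\<alpha> * l)\<^sup>2 / l" by (simp only: e)
    show "l' = l - (\<alpha> * l)\<^sup>2 / k" unfolding e l' by (simp add: algebra_simps)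
  qed
qed

text \<open>Coplanarity of the four points on parallel edges of a cube determines the remaining scale.\<close>

lemma M_cube:
  fixes u w z um uq umq wq zm :: "real^4" and k l s \<alpha> \<beta> k' l' :: real
  assumes nz: "k \<noteq> 0" "l \<noteq> 0" "k' \<noteq> 0" "l' \<noteq> 0"
    and k': "k' = k - s\<^sup>2 / l" and l': "l' = l - s\<^sup>2 / k"
    and um: "um $ 0 = u $ 0 - \<alpha> / k * w $ 0" "um $ 1 = u $ 1 - \<alpha> / k * w $ 1"
    and uq: "uq $ 0 = u $ 0 - \<beta> / l * z $ 0" "uq $ 1 = u $ 1 - \<beta> / l * z $ 1"
    and zm: "zm $ 0 = z $ 0 - s / k * w $ 0" "zm $ 1 = z $ 1 - s / k * w $ 1"
    and wq: "wq $ 0 = w $ 0 - s / l * z $ 0" "wq $ 1 = w $ 1 - s / l * z $ 1"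
    and g: "bracket umq zm = bracket um zm"
    and b: "bracket u w \<noteq> 0" "bracket u z \<noteq> 0" "bracket w z \<noteq> 0" "bracket um zm \<noteq> 0"
    and S: "sympl u um = bracket u w * bracket um w / k" "sympl u uq = bracket u z * bracket uq z / l"
    "sympl um umq = bracket um zm * bracket umq zm / l'" "sympl umq uq = - (bracket umq wq * bracket uq wq / k')"
    "sympl u umq = bracket u w * bracket umq w / k + bracket u zm * bracket umq zm / l'"
    "sympl um uq = bracket um z * bracket uq z / l - bracket um w * bracket uq w / k"
    and pf: "pfaffian u um umq uq = 0"
  shows "umq $ 0 = u $ 0 - (\<alpha> * l - s * \<beta>) / (k * l - s\<^sup>2) * w $ 0 - (\<beta> * k - s * \<alpha>) / (k * l - s\<^sup>2) * z $ 0"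
    "umq $ 1 = u $ 1 - (\<alpha> * l - s * \<beta>) / (k * l - s\<^sup>2) * w $ 1 - (\<beta> * k - s * \<alpha>) / (k * l - s\<^sup>2) * z $ 1"
proof -
  define D where "D = k * l - s\<^sup>2"
  have kD: "k' = D / l" "l' = D / k" using nz(1,2) unfolding k' l' D_def by (simp_all add: field_simps)
  have D: "D \<noteq> 0" using nz kD by auto
  have zu: "bracket zm um \<noteq> 0" using b(4) by (simp add: bracket_def algebra_simps)
  have "bracket (um - umq) zm = 0" using g by (simp add: bracket_def algebra_simps)
  \<comment> \<open>By \<open>g\<close> a single unknown is left, which coplanarity has to
    determine.\<close>
  then obtain y where "(um - umq) $ 0 = y * zm $ 0 \<and> (um - umq) $ 1 = y * zm $ 1" using bracket_parallel zu by meson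
  then have umq: "umq $ 0 = um $ 0 - y * zm $ 0" "umq $ 1 = um $ 1 - y * zm $ 1" by (auto simp: algebra_simps)
  define a c h where "a = bracket u w" and "c = bracket u z" and "h = bracket w z"
  define H where "H = c - s / k * a - \<alpha> / k * h"
  have B: "bracket u w = a" "bracket u z = c" "bracket um w = a" "bracket uq z = c" "bracket um zm = H" "bracket umq zm = H" "bracket u zm = c - s / k * a"
    "bracket um z = c - \<alpha> / k * h" "bracket umq w = a + y * h" "bracket uq w = a + \<beta> / l * h"
    "bracket umq wq = a + y * h - s / l * (c - \<alpha> / k * h + y * (s / k) * h)" "bracket uq wq = a + \<beta> / l * h - s / l * c"
    unfolding g unfolding bracket_def um uq umq zm wq a_def c_def h_def H_def by (simp_all add: algebra_simps)
  \<comment> \<open>The Pfaffian factors: besides brackets which do not vanish it contains one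
    factor, linear in \<open>y\<close>.\<close>
  have "a * c * h * H * (D * y - (\<beta> * k - s * \<alpha>)) = 0"
  proof -
    define P Q R G where "P = k * l * a + k * l * y * h - s * (c * k - \<alpha> * h + y * s * h)" and "Q = l * a + \<beta> * h - s * c"
      and "R = c * k - s * a" and "G = c * k - s * a - \<alpha> * h"
    have "H = G / k" using nz by (simp add: H_def G_def field_simps)
    have "sympl u um * sympl umq uq = - (a\<^sup>2 * P * Q / (k\<^sup>2 * l * D))"
      unfolding S B kD P_def Q_def using nz D by (simp add: field_simps power2_eq_square)
    moreover have "sympl u umq * sympl um uq = (D * a * (a + y * h) + R * G) * (c * (c * k - \<alpha> * h) - a * (a * l + \<beta> * h)) / (k\<^sup>2 * l * D)"
    proof -
      have "sympl u umq = (D * a * (a + y * h) + R * G) / (k * D)"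
        unfolding S B kD \<open>H = G / k\<close> R_def using nz D by (simp add: field_simps)
      moreover have "sympl um uq = (c * (c * k - \<alpha> * h) - a * (a * l + \<beta> * h)) / (k * l)"
        unfolding S B using nz by (simp add: field_simps)
      ultimately show ?thesis by (simp add: power2_eq_square)
    qed
    moreover have "sympl u uq * sympl um umq = c\<^sup>2 * k * G\<^sup>2 / (k\<^sup>2 * l * D)"
      unfolding S B kD \<open>H = G / k\<close> using nz D by (simp add: power2_eq_square mult_ac)
    ultimately have "(- (a\<^sup>2 * P * Q) - (D * a * (a + y * h) + R * G) * (c * (c * k - \<alpha> * h) - a * (a * l + \<beta> * h))
      + c\<^sup>2 * k * G\<^sup>2) / (k\<^sup>2 * l * D) = 0"
      using pf by (simp add: pfaffian_def diff_divide_distrib add_divide_distrib)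
    then have "- (a\<^sup>2 * P * Q) - (D * a * (a + y * h) + R * G) * (c * (c * k - \<alpha> * h) - a * (a * l + \<beta> * h)) + c\<^sup>2 * k * G\<^sup>2 = 0"
      using nz D by simp
    moreover have "- (a\<^sup>2 * P * Q) - (D * a * (a + y * h) + R * G) * (c * (c * k - \<alpha> * h) - a * (a * l + \<beta> * h)) + c\<^sup>2 * k * G\<^sup>2
      = - (a * c * h * G * (D * y - (\<beta> * k - s * \<alpha>)))"
      unfolding P_def Q_def R_def G_def D_def by algebra
    ultimately show ?thesis using \<open>H = G / k\<close> by simp
  qed
  moreover have "H \<noteq> 0" using b(4) B by simp
  ultimately have "D * y = \<beta> * k - s * \<alpha>" using b by (simp add: a_def c_def h_def)
  then have y: "y = (\<beta> * k - s * \<alpha>) / D" using D by (simp add: field_simps)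
  have "\<alpha> / k - y * (s / k) = (\<alpha> * l - s * \<beta>) / D"
    unfolding y using D nz by (simp add: field_simps) (simp add: D_def algebra_simps power2_eq_square)
  moreover have "umq $ i = u $ i - (\<alpha> / k - y * (s / k)) * w $ i - y * z $ i" if "i = 0 \<or> i = 1" for i
    using that umq um zm by (auto simp: algebra_simps)
  ultimately show "umq $ 0 = u $ 0 - (\<alpha> * l - s * \<beta>) / (k * l - s\<^sup>2) * w $ 0 - (\<beta> * k - s * \<alpha>) / (k * l - s\<^sup>2) * z $ 0"
    "umq $ 1 = u $ 1 - (\<alpha> * l - s * \<beta>) / (k * l - s\<^sup>2) * w $ 1 - (\<beta> * k - s * \<alpha>) / (k * l - s\<^sup>2) * z $ 1"
    using y by (simp_all add: D_def)
qed

lemma sympl_chart_edge: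
  assumes "chart A B C x" "chart A' B' C' y"
    and "A' = A - (v $ 0)\<^sup>2 / k" "B' = B - v $ 0 * v $ 1 / k" "C' = C - (v $ 1)\<^sup>2 / k"
  shows "sympl x y = bracket x v * bracket y v / k"
  using sympl_chart[OF assms(1,2), of v k 0 1] assms(3-5) by (simp add: bracket_def)

lemma rank_one_quadric:
  fixes X Y Z :: real
  assumes "X * v1 = Y * v0" "Y * v1 = Z * v0" "v0 \<noteq> 0 \<or> v1 \<noteq> 0"
  obtains \<kappa> where "X = \<kappa> * v0\<^sup>2" "Y = \<kappa> * (v0 * v1)" "Z = \<kappa> * v1\<^sup>2"
proof (cases "v0 = 0")
  case True
  then show ?thesis using assms by (intro that[of "Z / v1\<^sup>2"]) auto
next
  case False
  show ?thesis
  proof (rule that[of "X / v0\<^sup>2"])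
    show "X = X / v0\<^sup>2 * v0\<^sup>2" using False by simp
    have Y: "Y = X * v1 / v0" and Z: "Z = Y * v1 / v0" using False assms by (simp_all add: field_simps)
    show "Y = X / v0\<^sup>2 * (v0 * v1)" using False by (simp add: Y power2_eq_square)
    show "Z = X / v0\<^sup>2 * v1\<^sup>2" using False by (simp add: Z Y power2_eq_square)
  qed
qed

lemma chart_unique:
  "chart A B C x \<Longrightarrow> chart A B C y \<Longrightarrow> x $ 0 = y $ 0 \<Longrightarrow> x $ 1 = y $ 1 \<Longrightarrow> x = y"
  by (simp add: chart_def vec4_eq_iff)

lemma chart_top_nonzero: "chart A B C x \<Longrightarrow> x \<noteq> 0 \<Longrightarrow> x $ 0 \<noteq> 0 \<or> x $ 1 \<noteq> 0"
  by (auto simp: chart_def vec4_eq_iff)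

locale chart_complex = lie_plucker +
  fixes V :: "site \<Rightarrow> real^5" and p :: "3 \<Rightarrow> site \<Rightarrow> real^4"
  assumes circle: "\<And>n. oriented_circle (V n)" and generic: "generic V"
    and finite_chart: "\<And>n. \<Phi> (V n) $ 1 \<noteq> 0"
    and meets: "\<And>l n. meets_in (L (V n)) (L (V (n + unit_step l))) (p l n)"
    and coplanar: "\<And>l m q n. l \<noteq> m \<Longrightarrow> m \<noteq> q \<Longrightarrow> l \<noteq> q \<Longrightarrow>
      coplanar_points {p l n, p l (n + unit_step m), p l (n + unit_step m + unit_step q), p l (n + unit_step q)}"
begin

definition "m44 n = \<Phi> (V n) $ 3 / \<Phi> (V n) $ 1"
definition "m45 n = \<Phi> (V n) $ 5 / \<Phi> (V n) $ 1"
definition "m55 n = \<Phi> (V n) $ 4 / \<Phi> (V n) $ 1"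

lemma p_on_line: "p l n \<noteq> 0" "p l n \<in> L (V n)" "p l n \<in> L (V (n + unit_step l))"
  using meets_inD[OF meets] by blast+

lemma chart_on_line: assumes "x \<in> L (V n)" shows "chart (m44 n) (m45 n) (m55 n) x"
proof -
  have "T (V n) x $ 0 = 0" "T (V n) x $ 1 = 0" using assms line_of_iff[OF circle] by auto
  then show ?thesis using finite_chart[of n]
    by (simp add: chart_def m44_def m45_def m55_def field_simps)
qed

lemma coords: "\<Phi> (V n) = \<Phi> (V n) $ 1 *\<^sub>R vector [1, m44 n * m55 n - (m45 n)\<^sup>2, m44 n, m55 n, m45 n]"
proof -
  let ?U = "\<Phi> (V n)"
  have "complex_form ?U ?U = 0" using oriented_circleD(4)[OF circle] .
  then have "?U $ 1 * ?U $ 2 = ?U $ 3 * ?U $ 4 - ?U $ 5 * ?U $ 5" by (simp add: complex_form_def)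
  moreover have e: "?U $ 3 = ?U $ 1 * m44 n" "?U $ 4 = ?U $ 1 * m55 n" "?U $ 5 = ?U $ 1 * m45 n"
    using finite_chart[of n] by (simp_all add: m44_def m45_def m55_def)
  ultimately have "?U $ 1 * (?U $ 2 - ?U $ 1 * (m44 n * m55 n - (m45 n)\<^sup>2)) = 0" by algebra
  then have "?U $ 2 = ?U $ 1 * (m44 n * m55 n - (m45 n)\<^sup>2)" using finite_chart[of n] by simp
  then show ?thesis using e by (subst vec5_eq_iff) simp
qed

text \<open>A point of a charted line is determined by its top components. A vanishing bracket would
  thus make \<open>x\<close> and \<open>y\<close> the same point, in which the circles at
  \<open>a\<close> and \<open>b\<close> would touch.\<close>

lemma bracket_ne_0:
  assumes "x \<in> L (V n)" "x \<in> L (V a)" "x \<noteq> 0" "y \<in> L (V n)" "y \<in> L (V b)" "y \<noteq> 0" "\<not> contact (V a) (V b)"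
  shows "bracket x y \<noteq> 0"
proof
  assume z: "bracket x y = 0"
  note ch = chart_on_line[OF assms(1)] chart_on_line[OF assms(4)]
  have "\<exists>t. x $ 0 = t * y $ 0 \<and> x $ 1 = t * y $ 1"
  proof (cases "y $ 0 = 0")
    case True
    then show ?thesis using z chart_top_nonzero[OF ch(2) assms(6)]
      by (intro exI[of _ "x $ 1 / y $ 1"]) (auto simp: bracket_def)
  next
    case False
    then show ?thesis using z by (intro exI[of _ "x $ 0 / y $ 0"]) (auto simp: bracket_def field_simps)
  qed
  then obtain t where t: "x $ 0 = t * y $ 0" "x $ 1 = t * y $ 1" by blast
  have "x = t *\<^sub>R y" by (rule chart_unique[OF ch(1) chart_scale[OF ch(2)]]) (simp_all add: t)
  then have "x \<in> L (V b)" using line_scale[OF circle assms(5)] by simp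
  then show False using common_point_imp_contact[OF circle circle assms(3,2)] assms(7) by blast
qed

lemma not_contact:
  assumes "l \<noteq> m"
  shows "\<not> contact (V (n + unit_step l)) (V (n + unit_step m))" "\<not> contact (V n) (V (n + unit_step l + unit_step m))"
  using assms exhaust_3[of l] exhaust_3[of m]
  by (intro generic_diagonal[OF generic]; auto simp: diagonal_def)+

lemma bracket_p:
  assumes "l \<noteq> m" shows "bracket (p l n) (p m n) \<noteq> 0" "bracket (p l (n + unit_step m)) (p m n) \<noteq> 0"
proof -
  show "bracket (p l n) (p m n) \<noteq> 0"
    by (rule bracket_ne_0[OF p_on_line(2,3,1) p_on_line(2,3,1) not_contact(1)[OF assms]])
  show "bracket (p l (n + unit_step m)) (p m n) \<noteq> 0"
    by (rule bracket_ne_0[OF p_on_line(2,3,1) p_on_line(3,2,1)])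
      (use not_contact(2)[OF assms[symmetric]] contact_commute in blast)
qed

text \<open>The common point satisfies the chart equations of both ends, so the difference of the
  symmetric blocks annihilates a vector built from its top components and has rank at most one. A
  zero difference would make neighbouring circles equal, against genericity.\<close>

lemma edge_exists:
  "\<exists>k. k \<noteq> 0 \<and> m44 (n + unit_step l) = m44 n - (p l n $ 0)\<^sup>2 / k \<and>
     m45 (n + unit_step l) = m45 n - p l n $ 0 * p l n $ 1 / k \<and> m55 (n + unit_step l) = m55 n - (p l n $ 1)\<^sup>2 / k"
proof -
  let ?n = "n + unit_step l"
  note ch = chart_on_line[OF p_on_line(2)[of l n]] chart_on_line[OF p_on_line(3)[of l n]]
  have h: "(m44 n - m44 ?n) * p l n $ 1 = (m45 n - m45 ?n) * p l n $ 0" "(m45 n - m45 ?n) * p l n $ 1 = (m55 n - m55 ?n) * p l n $ 0"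
    using ch unfolding chart_def by algebra+
  obtain \<kappa> where \<kappa>: "m44 n - m44 ?n = \<kappa> * (p l n $ 0)\<^sup>2" "m45 n - m45 ?n = \<kappa> * (p l n $ 0 * p l n $ 1)"
    "m55 n - m55 ?n = \<kappa> * (p l n $ 1)\<^sup>2"
    by (rule rank_one_quadric[OF h chart_top_nonzero[OF ch(1) p_on_line(1)]])
  have "\<kappa> \<noteq> 0"
  proof
    assume "\<kappa> = 0"
    then have "\<Phi> (V ?n) = (\<Phi> (V ?n) $ 1 / \<Phi> (V n) $ 1) *\<^sub>R \<Phi> (V n)"
      using \<kappa> coords[of n] coords[of ?n] finite_chart[of n] by (simp add: vec5_eq_iff)
    then have "same_circle (V ?n) (V n)" unfolding same_circle_iff_\<Phi>
      using finite_chart[of n] finite_chart[of ?n] by (intro exI[of _ "\<Phi> (V ?n) $ 1 / \<Phi> (V n) $ 1"]) simp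
    obtain m where m: "l \<noteq> m" using exists_3[of "\<lambda>m. l \<noteq> m"] exhaust_3[of l] by auto
    have "contact (V (?n + unit_step m)) (V ?n)"
      by (rule common_point_imp_contact[OF circle circle p_on_line(1,3,2)])
    then have "contact (V (?n + unit_step m)) (V n)" using contact_same_circle[OF \<open>same_circle (V ?n) (V n)\<close>] by blast
    then show False using not_contact(2)[OF m] contact_commute by blast
  qed
  then show ?thesis using \<kappa> by (intro exI[of _ "1 / \<kappa>"]) (simp add: algebra_simps)
qed

text \<open>The future diagonal entry of the M-system with index \<open>l\<close>.\<close>

definition K :: "3 \<Rightarrow> site \<Rightarrow> real" where
  "K l n = (SOME k. k \<noteq> 0 \<and> m44 (n + unit_step l) = m44 n - (p l n $ 0)\<^sup>2 / k \<and>
     m45 (n + unit_step l) = m45 n - p l n $ 0 * p l n $ 1 / k \<and> m55 (n + unit_step l) = m55 n - (p l n $ 1)\<^sup>2 / k)"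

lemma K: "K l n \<noteq> 0" "m44 (n + unit_step l) = m44 n - (p l n $ 0)\<^sup>2 / K l n"
  "m45 (n + unit_step l) = m45 n - p l n $ 0 * p l n $ 1 / K l n" "m55 (n + unit_step l) = m55 n - (p l n $ 1)\<^sup>2 / K l n"
  using someI_ex[OF edge_exists[where l = l and n = n]] unfolding K_def by blast+

text \<open>In the M-system row \<open>l\<close> changes by a multiple of row \<open>m\<close>,
  which preserves their bracket; \<open>a\<close> is the factor that enforces this for the given
  representatives of the points.\<close>

definition "a l m n = bracket (p l n) (p m n) / bracket (p l (n + unit_step m)) (p m n)"

lemma a_nonzero: "l \<noteq> m \<Longrightarrow> a l m n \<noteq> 0"
  by (simp add: a_def bracket_p)

lemma bracket_a: "l \<noteq> m \<Longrightarrow> a l m n * bracket (p l (n + unit_step m)) (p m n) = bracket (p l n) (p m n)"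
  by (simp add: a_def bracket_p)

text \<open>The shift of row \<open>l\<close> along row \<open>m\<close>, extracted with a bracket
  and multiplied by \<open>K m n\<close>: the future off-diagonal entry.\<close>

definition "S l m n = K m n * bracket (p l n - a l m n *\<^sub>R p l (n + unit_step m)) (p l n) / bracket (p m n) (p l n)"

lemma face:
  assumes lm: "l \<noteq> m"
  shows "S m l n = S l m n"
    and "a l m n * p l (n + unit_step m) $ 0 = p l n $ 0 - S l m n / K m n * p m n $ 0"
    and "a l m n * p l (n + unit_step m) $ 1 = p l n $ 1 - S l m n / K m n * p m n $ 1"
    and "(a l m n)\<^sup>2 * K l (n + unit_step m) = K l n - (S l m n)\<^sup>2 / K m n"
proof -
  let ?u = "p l n" and ?w = "p m n" and ?u' = "a l m n *\<^sub>R p l (n + unit_step m)" and ?w' = "a m l n *\<^sub>R p m (n + unit_step l)"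
  have sc: "(r * x)\<^sup>2 / (r\<^sup>2 * k) = x\<^sup>2 / k" "r * x * (r * y) / (r\<^sup>2 * k) = x * y / k" if "r \<noteq> 0" for r x y k :: real
    using that by (simp_all add: power2_eq_square)
  note sc = sc[OF a_nonzero[OF lm]] sc[OF a_nonzero[OF lm[symmetric]]]
  have c: "n + unit_step l + unit_step m = n + unit_step m + unit_step l" by (simp add: ac_simps)
  obtain s where s: "?u' $ 0 = ?u $ 0 - s / K m n * ?w $ 0" "?u' $ 1 = ?u $ 1 - s / K m n * ?w $ 1"
    "?w' $ 0 = ?w $ 0 - s / K l n * ?u $ 0" "?w' $ 1 = ?w $ 1 - s / K l n * ?u $ 1"
    "(a l m n)\<^sup>2 * K l (n + unit_step m) = K l n - s\<^sup>2 / K m n"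
  proof (rule M_face[of "K l n" "K m n" "(a l m n)\<^sup>2 * K l (n + unit_step m)" "(a m l n)\<^sup>2 * K m (n + unit_step l)" ?u ?w ?u' ?w'])
    show "bracket ?u' ?w = bracket ?u ?w" "bracket ?w' ?u = bracket ?w ?u" using bracket_a lm by auto
    show "(?u $ 0)\<^sup>2 / K l n + (?w' $ 0)\<^sup>2 / ((a m l n)\<^sup>2 * K m (n + unit_step l)) = (?w $ 0)\<^sup>2 / K m n + (?u' $ 0)\<^sup>2 / ((a l m n)\<^sup>2 * K l (n + unit_step m))"
      using K(2)[of "n + unit_step l" m] K(2)[of "n + unit_step m" l] K(2)[of n l] K(2)[of n m] by (simp add: sc c)
    show "?u $ 0 * ?u $ 1 / K l n + ?w' $ 0 * ?w' $ 1 / ((a m l n)\<^sup>2 * K m (n + unit_step l)) = ?w $ 0 * ?w $ 1 / K m n + ?u' $ 0 * ?u' $ 1 / ((a l m n)\<^sup>2 * K l (n + unit_step m))"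
      using K(3)[of "n + unit_step l" m] K(3)[of "n + unit_step m" l] K(3)[of n l] K(3)[of n m]
      unfolding vector_scaleR_component real_scaleR_def sc c by simp
    show "(?u $ 1)\<^sup>2 / K l n + (?w' $ 1)\<^sup>2 / ((a m l n)\<^sup>2 * K m (n + unit_step l)) = (?w $ 1)\<^sup>2 / K m n + (?u' $ 1)\<^sup>2 / ((a l m n)\<^sup>2 * K l (n + unit_step m))"
      using K(4)[of "n + unit_step l" m] K(4)[of "n + unit_step m" l] K(4)[of n l] K(4)[of n m] by (simp add: sc c)
  qed (use lm K(1) a_nonzero bracket_p in auto)
  have "bracket (?u - ?u') ?u = s / K m n * bracket ?w ?u" "bracket (?w - ?w') ?w = s / K l n * bracket ?u ?w"
    unfolding bracket_def vector_minus_component s(1-4) by algebra+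
  then have S: "S l m n = s" "S m l n = s"
    unfolding S_def using K(1)[of l n] K(1)[of m n] bracket_p(1)[of l m n] bracket_p(1)[of m l n] lm by auto
  then show "S m l n = S l m n" "a l m n * p l (n + unit_step m) $ 0 = p l n $ 0 - S l m n / K m n * p m n $ 0"
    "a l m n * p l (n + unit_step m) $ 1 = p l n $ 1 - S l m n / K m n * p m n $ 1"
    "(a l m n)\<^sup>2 * K l (n + unit_step m) = K l n - (S l m n)\<^sup>2 / K m n"
    using s by simp_all
qed

definition "det2 m q n = K m n * K q n - (S m q n)\<^sup>2"

lemma cube:
  assumes d: "l \<noteq> m" "m \<noteq> q" "l \<noteq> q" and i: "i = 0 \<or> i = 1"
  shows "a l m n * a l q (n + unit_step m) * p l (n + unit_step m + unit_step q) $ i =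
    p l n $ i - (S l m n * K q n - S m q n * S l q n) / det2 m q n * p m n $ i
      - (S l q n * K m n - S m q n * S l m n) / det2 m q n * p q n $ i"
proof -
  let ?M = "n + unit_step m" and ?Q = "n + unit_step q" and ?N = "n + unit_step m + unit_step q"
  let ?u = "p l n" and ?w = "p m n" and ?z = "p q n"
  let ?um = "a l m n *\<^sub>R p l ?M" and ?uq = "a l q n *\<^sub>R p l ?Q" and ?wq = "a m q n *\<^sub>R p m ?Q" and ?zm = "a q m n *\<^sub>R p q ?M"
  let ?umq = "(a l m n * a l q ?M) *\<^sub>R p l ?N"
  let ?k = "K m n" and ?l = "K q n" and ?k' = "(a m q n)\<^sup>2 * K m ?Q" and ?l' = "(a q m n)\<^sup>2 * K q ?M"
  have QM: "?Q + unit_step m = ?N" by (simp add: ac_simps)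
  have an: "a l m n \<noteq> 0" "a l q n \<noteq> 0" "a m q n \<noteq> 0" "a q m n \<noteq> 0" "a l q ?M \<noteq> 0" using a_nonzero d by auto
  have sc: "(r * x)\<^sup>2 / (r\<^sup>2 * k) = x\<^sup>2 / k" "r * x * (r * y) / (r\<^sup>2 * k) = x * y / k" if "r \<noteq> 0" for r x y k :: real
    using that by (simp_all add: power2_eq_square)
  note sc = sc[OF an(3)] sc[OF an(4)]
  have on: "?u \<in> L (V n)" "?um \<in> L (V ?M)" "?uq \<in> L (V ?Q)" "?umq \<in> L (V ?N)"
    using p_on_line(2) line_scale[OF circle] by auto
  note ch = on[THEN chart_on_line]
  have step: "m44 ?M = m44 n - (?w $ 0)\<^sup>2 / ?k" "m45 ?M = m45 n - ?w $ 0 * ?w $ 1 / ?k" "m55 ?M = m55 n - (?w $ 1)\<^sup>2 / ?k"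
    "m44 ?Q = m44 n - (?z $ 0)\<^sup>2 / ?l" "m45 ?Q = m45 n - ?z $ 0 * ?z $ 1 / ?l" "m55 ?Q = m55 n - (?z $ 1)\<^sup>2 / ?l"
    "m44 ?N = m44 ?M - (?zm $ 0)\<^sup>2 / ?l'" "m45 ?N = m45 ?M - ?zm $ 0 * ?zm $ 1 / ?l'" "m55 ?N = m55 ?M - (?zm $ 1)\<^sup>2 / ?l'"
    "m44 ?N = m44 ?Q - (?wq $ 0)\<^sup>2 / ?k'" "m45 ?N = m45 ?Q - ?wq $ 0 * ?wq $ 1 / ?k'" "m55 ?N = m55 ?Q - (?wq $ 1)\<^sup>2 / ?k'"
    unfolding vector_scaleR_component real_scaleR_def sc
    using K(2-4)[of n m] K(2-4)[of n q] K(2-4)[of ?M q] K(2-4)[of ?Q m] unfolding QM by blast+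
  obtain y where "y \<noteq> 0" "y \<bullet> p l n = 0" "y \<bullet> p l ?M = 0" "y \<bullet> p l ?N = 0" "y \<bullet> p l ?Q = 0"
    using coplanar[OF d, of n] by (auto simp: coplanar_points_def)
  then have pf: "pfaffian ?u ?um ?umq ?uq = 0" by (intro pfaffian_eq_0_if_orthogonal[of y]) simp_all
  note F = face[OF d(1), of n] face[OF d(3), of n] face[OF d(2), of n] face[OF d(2)[symmetric], of n]
  have "?umq $ 0 = ?u $ 0 - (S l m n * ?l - S m q n * S l q n) / (?k * ?l - (S m q n)\<^sup>2) * ?w $ 0 - (S l q n * ?k - S m q n * S l m n) / (?k * ?l - (S m q n)\<^sup>2) * ?z $ 0
    \<and> ?umq $ 1 = ?u $ 1 - (S l m n * ?l - S m q n * S l q n) / (?k * ?l - (S m q n)\<^sup>2) * ?w $ 1 - (S l q n * ?k - S m q n * S l m n) / (?k * ?l - (S m q n)\<^sup>2) * ?z $ 1"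
  proof -
    have h1: "bracket ?umq ?zm = bracket ?um ?zm" using bracket_a[OF d(3), of ?M] by (simp add: mult.assoc)
    have h2: "sympl ?u ?um = bracket ?u ?w * bracket ?um ?w / ?k" by (rule sympl_chart_edge[OF ch(1,2)]) (rule step)+
    have h3: "sympl ?u ?uq = bracket ?u ?z * bracket ?uq ?z / ?l" by (rule sympl_chart_edge[OF ch(1,3)]) (rule step)+
    have h4: "sympl ?um ?umq = bracket ?um ?zm * bracket ?umq ?zm / ?l'" by (rule sympl_chart_edge[OF ch(2,4)]) (rule step)+
    have "sympl ?uq ?umq = bracket ?uq ?wq * bracket ?umq ?wq / ?k'" by (rule sympl_chart_edge[OF ch(3,4)]) (rule step)+
    then have h5: "sympl ?umq ?uq = - (bracket ?umq ?wq * bracket ?uq ?wq / ?k')" using sympl_commute[of ?umq ?uq] by simp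
    have h6: "sympl ?u ?umq = bracket ?u ?w * bracket ?umq ?w / ?k + bracket ?u ?zm * bracket ?umq ?zm / ?l'"
      by (rule sympl_chart[OF ch(1,4)]) (simp_all only: step(7-9) step(1-3))
    have "sympl ?um ?uq = bracket ?um ?z * bracket ?uq ?z / ?l + bracket ?um ?w * bracket ?uq ?w / (- ?k)"
      by (rule sympl_chart[OF ch(2,3)]) (simp_all add: step(1-6))
    then have h7: "sympl ?um ?uq = bracket ?um ?z * bracket ?uq ?z / ?l - bracket ?um ?w * bracket ?uq ?w / ?k" by simp
    have h8: "?k \<noteq> 0" "?l \<noteq> 0" "?k' \<noteq> 0" "?l' \<noteq> 0" using K(1) an by simp_all
    have h9: "bracket ?u ?w \<noteq> 0" "bracket ?u ?z \<noteq> 0" "bracket ?w ?z \<noteq> 0" using bracket_p(1) d by blast+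
    have h10: "bracket ?um ?zm \<noteq> 0" using bracket_p(1)[OF d(3)] an by simp
    have h11: "pfaffian ?u ?um ?umq ?uq = 0" by (rule pf)
    have h12: "?k' = ?k - (S m q n)\<^sup>2 / ?l" "?l' = ?l - (S m q n)\<^sup>2 / ?k" using F(12,16) F(9) by simp_all
    have h13: "?um $ 0 = ?u $ 0 - S l m n / ?k * ?w $ 0" "?um $ 1 = ?u $ 1 - S l m n / ?k * ?w $ 1"
      "?uq $ 0 = ?u $ 0 - S l q n / ?l * ?z $ 0" "?uq $ 1 = ?u $ 1 - S l q n / ?l * ?z $ 1"
      using F(2,3,6,7) by simp_all
    have h14: "?zm $ 0 = ?z $ 0 - S m q n / ?k * ?w $ 0" "?zm $ 1 = ?z $ 1 - S m q n / ?k * ?w $ 1"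
      "?wq $ 0 = ?w $ 0 - S m q n / ?l * ?z $ 0" "?wq $ 1 = ?w $ 1 - S m q n / ?l * ?z $ 1"
      using F(10,11,14,15) F(9) by simp_all
    show ?thesis
      by (rule conjI; rule M_cube[of ?k ?l ?k' ?l' "S m q n" ?um ?u "S l m n" ?w ?uq "S l q n" ?z ?zm ?wq ?umq]; fact h1 h2 h3 h4 h5 h6 h7 h8 h9 h10 h11 h12 h13 h14)
  qed
  then show ?thesis using i unfolding det2_def by auto
qed

text \<open>The right-hand side of \<open>cube\<close> is symmetric in \<open>m\<close> and
  \<open>q\<close>, so both orders multiply the same top components, which are not both
  zero.\<close>

lemma a_flat:
  assumes "l \<noteq> m" "l \<noteq> q"
  shows "a l m n * a l q (n + unit_step m) = a l q n * a l m (n + unit_step q)"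
proof (cases "m = q")
  case False
  let ?N = "n + unit_step m + unit_step q"
  have QM: "n + unit_step q + unit_step m = ?N" by (simp add: ac_simps)
  have c: "S q m n = S m q n" "det2 q m n = det2 m q n" using face(1)[OF False, of n] by (simp_all add: det2_def mult.commute)
  have "a l m n * a l q (n + unit_step m) * p l ?N $ i = a l q n * a l m (n + unit_step q) * p l ?N $ i" if "i = 0 \<or> i = 1" for i
    using cube[OF assms(1) False assms(2) that, of n] cube[OF assms(2) False[symmetric] assms(1) that, of n]
    unfolding QM c by linarith
  moreover have "p l ?N $ 0 \<noteq> 0 \<or> p l ?N $ 1 \<noteq> 0" by (rule chart_top_nonzero[OF chart_on_line[OF p_on_line(2)] p_on_line(1)])
  ultimately show ?thesis by auto
qed simp

lemma normalizing_scale: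
  obtains \<theta> where "\<forall>l n. \<theta> l n \<noteq> 0" "\<forall>l m n. l \<noteq> m \<longrightarrow> \<theta> l (n + unit_step m) = a l m n * \<theta> l n"
proof -
  \<comment> \<open>Only the directions other than \<open>l\<close> are constrained; the scale along
    \<open>l\<close> stays free.\<close>
  have "\<exists>\<theta>. (\<forall>n. \<theta> n \<noteq> 0) \<and> (\<forall>m\<in>UNIV - {l}. \<forall>n. \<theta> (n + unit_step m) = a l m n * \<theta> n)" for l
    by (rule flat_connection_potential) (use a_nonzero a_flat in auto)
  then obtain \<theta> where "\<And>l. (\<forall>n. \<theta> l n \<noteq> 0) \<and> (\<forall>m\<in>UNIV - {l}. \<forall>n. \<theta> l (n + unit_step m) = a l m n * \<theta> l n)" by metis
  then show ?thesis by (intro that[of \<theta>]) auto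
qed

lemma rescale:
  assumes "\<And>l n. \<theta> l n \<noteq> 0" shows "chart_complex \<Phi> V (\<lambda>l n. \<theta> l n *\<^sub>R p l n)"
proof unfold_locales
  show "meets_in (L (V n)) (L (V (n + unit_step l))) (\<theta> l n *\<^sub>R p l n)" for l n
  proof -
    have "(1 / \<theta> l n) *\<^sub>R (\<theta> l n *\<^sub>R p l n) \<in> span {\<theta> l n *\<^sub>R p l n}" by (intro span_scale span_base) simp
    then have "span {\<theta> l n *\<^sub>R p l n} = span {p l n}" unfolding span_eq
      using assms[of l n] by (simp add: span_scale span_base)
    then show ?thesis using meets[of n l] assms[of l n] by (simp add: meets_in_def)
  qed
  show "coplanar_points {\<theta> l n *\<^sub>R p l n, \<theta> l (n + unit_step m) *\<^sub>R p l (n + unit_step m),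
    \<theta> l (n + unit_step m + unit_step q) *\<^sub>R p l (n + unit_step m + unit_step q), \<theta> l (n + unit_step q) *\<^sub>R p l (n + unit_step q)}"
    if "l \<noteq> m" "m \<noteq> q" "l \<noteq> q" for l m q n
    using coplanar[OF that, of n] unfolding coplanar_points_def by auto
qed (use circle generic finite_chart in auto)

end

definition emb :: "3 \<Rightarrow> 5" where "emb l = (if l = 1 then 1 else if l = 2 then 2 else 3)"

lemma emb_simps: "emb 1 = 1" "emb 2 = 2" "emb 3 = 3"
  by (simp_all add: emb_def)

lemma emb_eq_iff: "emb l = emb m \<longleftrightarrow> l = m" "emb l \<noteq> 4" "emb l \<noteq> 5" "4 \<noteq> emb l" "5 \<noteq> emb l"
  using exhaust_3[of l] exhaust_3[of m] by (auto simp: emb_def)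

lemma emb_cases: obtains l where "i = emb l" | "i = 4" | "i = 5"
  using exhaust_5[of i] emb_simps by metis

definition unemb :: "5 \<Rightarrow> 3" where "unemb i = (if i = 1 then 1 else if i = 2 then 2 else 3)"

lemma unemb_emb [simp]: "unemb (emb l) = l"
  using exhaust_3[of l] by (auto simp: emb_def unemb_def)

locale normalized_chart_complex = chart_complex +
  assumes normalized: "\<And>l m n. l \<noteq> m \<Longrightarrow> a l m n = 1"
begin

definition M :: "site \<Rightarrow> real^5^5" where
  "M n = (\<chi> i j. if i \<noteq> 4 \<and> i \<noteq> 5 \<and> j \<noteq> 4 \<and> j \<noteq> 5 then
       if i = j then K (unemb i) n else S (unemb i) (unemb j) n
     else if j \<noteq> 4 \<and> j \<noteq> 5 then p (unemb j) n $ (if i = 4 then 0 else 1)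
     else if i \<noteq> 4 \<and> i \<noteq> 5 then p (unemb i) n $ (if j = 4 then 0 else 1)
     else if i = j then if i = 4 then m44 n else m55 n else m45 n)"

lemma M_nth:
  "M n $ emb l $ emb m = (if l = m then K l n else S l m n)"
  "M n $ emb l $ 4 = p l n $ 0" "M n $ emb l $ 5 = p l n $ 1" "M n $ 4 $ emb l = p l n $ 0" "M n $ 5 $ emb l = p l n $ 1"
  "M n $ 4 $ 4 = m44 n" "M n $ 4 $ 5 = m45 n" "M n $ 5 $ 4 = m45 n" "M n $ 5 $ 5 = m55 n"
  by (simp_all add: M_def emb_eq_iff)

lemma M_symmetric: "M n $ i $ j = M n $ j $ i"
  by (cases i rule: emb_cases; cases j rule: emb_cases) (simp_all add: M_nth face(1))

lemma p_shift:
  assumes "l \<noteq> m"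
  shows "p l (n + unit_step m) $ 0 = p l n $ 0 - S l m n / K m n * p m n $ 0"
    "p l (n + unit_step m) $ 1 = p l n $ 1 - S l m n / K m n * p m n $ 1"
    "K l (n + unit_step m) = K l n - (S l m n)\<^sup>2 / K m n"
  using face(2-4)[OF assms, of n] normalized[OF assms] by simp_all

text \<open>The two-step formula for row \<open>l\<close> is compared with two single steps; the
  bracket with row \<open>m\<close> isolates the coefficient of row \<open>q\<close>.\<close>

lemma S_shift:
  assumes d: "l \<noteq> m" "m \<noteq> q" "l \<noteq> q"
  shows "S l q (n + unit_step m) = S l q n - S l m n * S m q n / K m n"
proof -
  let ?M = "n + unit_step m" and ?D = "det2 m q n"
  define \<sigma> where "\<sigma> = S l q ?M / K q ?M"
  define X Y where "X = (S l m n * K q n - S m q n * S l q n) / ?D" and "Y = (S l q n * K m n - S m q n * S l m n) / ?D"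
  have KD: "K q ?M = ?D / K m n"
    using p_shift(3)[OF d(2)[symmetric], of n] face(1)[OF d(2), of n] K(1)[of m n] by (simp add: det2_def field_simps)
  then have D: "?D \<noteq> 0" using K(1)[of q ?M] by auto
  have "p l n $ i - S l m n / K m n * p m n $ i - \<sigma> * (p q n $ i - S m q n / K m n * p m n $ i) = p l n $ i - X * p m n $ i - Y * p q n $ i"
    if "i = 0 \<or> i = 1" for i
  proof -
    have "p l (?M + unit_step q) $ i = p l n $ i - X * p m n $ i - Y * p q n $ i"
      using cube[OF d that, of n] normalized d by (simp add: X_def Y_def)
    moreover have "p l (?M + unit_step q) $ i = p l ?M $ i - \<sigma> * p q ?M $ i"
      using that p_shift(1,2)[OF d(3), of ?M] by (auto simp: \<sigma>_def)
    moreover have "p l ?M $ i = p l n $ i - S l m n / K m n * p m n $ i" "p q ?M $ i = p q n $ i - S m q n / K m n * p m n $ i"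
      using that p_shift(1,2)[OF d(1), of n] p_shift(1,2)[OF d(2)[symmetric], of n] face(1)[OF d(2), of n] by auto
    ultimately show ?thesis by simp
  qed
  from this[of 0] this[of 1] have "(Y - \<sigma>) * bracket (p q n) (p m n) = 0" unfolding bracket_def by simp algebra
  then have "S l q ?M = Y * K q ?M" using bracket_p(1)[of q m n] d K(1)[of q ?M] by (simp add: \<sigma>_def field_simps)
  also have "\<dots> = S l q n - S l m n * S m q n / K m n" using D K(1)[of m n] by (simp add: KD Y_def field_simps)
  finally show ?thesis .
qed

lemma M_shift:
  assumes "i \<noteq> emb l" "j \<noteq> emb l"
  shows "M (n + unit_step l) $ i $ j = M n $ i $ j - M n $ i $ emb l * M n $ emb l $ j / M n $ emb l $ emb l"
proof -
  have s: "S l m n = S m l n" if "m \<noteq> l" for m using face(1)[OF that] .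
  show ?thesis using assms
    by (cases i rule: emb_cases; cases j rule: emb_cases)
      (auto simp: M_nth emb_eq_iff p_shift S_shift K s power2_eq_square)
qed

lemma M_system: "symmetric_M_system M"
  unfolding symmetric_M_system_def
proof (intro conjI allI)
  show "transpose (M n) = M n" for n by (simp add: vec_eq_iff transpose_def M_symmetric)
  have *: "M n $ emb l $ emb l \<noteq> 0 \<and> (\<forall>i k. i \<noteq> emb l \<and> k \<noteq> emb l \<longrightarrow>
    M (n + unit_step l) $ i $ k = M n $ i $ k - M n $ i $ emb l * M n $ emb l $ k / M n $ emb l $ emb l)" for n l
    using M_shift K(1) by (auto simp: M_nth(1))
  show "\<forall>(l, e)\<in>{(1, unit_step 1), (2, unit_step 2), (3, unit_step 3)}. M n $ l $ l \<noteq> 0 \<and>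
    (\<forall>i k. i \<noteq> l \<and> k \<noteq> l \<longrightarrow> M (n + e) $ i $ k = M n $ i $ k - M n $ i $ l * M n $ l $ k / M n $ l $ l)" for n
  proof (intro ballI)
    fix z assume "z \<in> {(1 :: 5, unit_step 1), (2, unit_step 2), (3, unit_step 3)}"
    then have "z = (emb 1, unit_step 1) \<or> z = (emb 2, unit_step 2) \<or> z = (emb 3, unit_step 3)" by (simp add: emb_simps)
    then obtain l where "z = (emb l, unit_step l)" by blast
    then show "case z of (l, e) \<Rightarrow> M n $ l $ l \<noteq> 0 \<and>
      (\<forall>i k. i \<noteq> l \<and> k \<noteq> l \<longrightarrow> M (n + e) $ i $ k = M n $ i $ k - M n $ i $ l * M n $ l $ k / M n $ l $ l)"
      using *[of n l] by simp
  qed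
qed

lemma M_governs: "governed_by \<Phi> M V"
  unfolding governed_by_def
  using coords finite_chart by (auto simp: M_line_coords_def M_nth)

end

section \<open>Translation between circle complexes and solutions of the M-system\<close>

context lie_plucker
begin

lemma M_system_of_fundamental_complex:
  assumes "fundamental_circle_complex \<Phi> V" "generic V" "\<And>n. \<Phi> (V n) $ 1 \<noteq> 0"
  shows "\<exists>M. symmetric_M_system M \<and> governed_by \<Phi> M V"
proof -
  obtain p where *: "\<forall>l n. meets_in (L (V n)) (L (V (n + unit_step l))) (p l n)"
    "\<forall>l m q n. l \<noteq> m \<and> m \<noteq> q \<and> l \<noteq> q \<longrightarrow> coplanar_points {p l n, p l (n + unit_step m),
      p l (n + unit_step m + unit_step q), p l (n + unit_step q)}"
    using assms(1) unfolding fundamental_circle_complex_def by (elim conjE exE) (rule that; assumption)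
  have p: "meets_in (L (V n)) (L (V (n + unit_step l))) (p l n)"
    "l \<noteq> m \<Longrightarrow> m \<noteq> q \<Longrightarrow> l \<noteq> q \<Longrightarrow> coplanar_points {p l n, p l (n + unit_step m),
      p l (n + unit_step m + unit_step q), p l (n + unit_step q)}" for l m q n
    using * by simp_all
  have circ: "oriented_circle (V n)" for n using assms(1) by (simp add: fundamental_circle_complex_def)
  interpret C: chart_complex \<Phi> V p
    by (unfold_locales; fact circ assms(2,3) p)
  obtain \<theta> where *: "\<forall>l n. \<theta> l n \<noteq> 0" "\<forall>l m n. l \<noteq> m \<longrightarrow> \<theta> l (n + unit_step m) = C.a l m n * \<theta> l n"
    by (rule C.normalizing_scale)
  then have \<theta>: "\<theta> l n \<noteq> 0" "l \<noteq> m \<Longrightarrow> \<theta> l (n + unit_step m) = C.a l m n * \<theta> l n" for l m n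
    by blast+
  interpret N: chart_complex \<Phi> V "\<lambda>l n. \<theta> l n *\<^sub>R p l n" by (rule C.rescale[OF \<theta>(1)])
  interpret N: normalized_chart_complex \<Phi> V "\<lambda>l n. \<theta> l n *\<^sub>R p l n"
  proof unfold_locales
    fix l m :: 3 and n assume lm: "l \<noteq> m"
    \<comment> \<open>The scale \<open>\<theta> l\<close> changes along \<open>m\<close> by exactly
      the old factor, so the new one is 1.\<close>
    show "N.a l m n = 1" using C.bracket_p[OF lm, of n] \<theta>(1)[of l n] \<theta>(1)[of m n]
      by (simp add: N.a_def \<theta>(2)[OF lm]) (simp add: C.a_def)
  qed
  show ?thesis using N.M_system N.M_governs by blast
qed

lemma governed_reduced:
  assumes "symmetric_M_system M" "governed_by \<Phi> M V" "\<And>n. even_site n \<Longrightarrow> V n $ 2 = 0"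
  shows "reduced_M_system \<Phi> M"
  unfolding reduced_M_system_def
proof (intro conjI allI impI assms(1))
  fix n X assume n: "even_site n \<and> \<Phi> X = M_line_coords (M n)"
  obtain s where s: "s \<noteq> 0" "\<Phi> (V n) = s *\<^sub>R M_line_coords (M n)" using assms(2) by (auto simp: governed_by_def)
  then have "\<Phi> (V n) = \<Phi> (s *\<^sub>R X)" using n by (simp add: linear_scale[OF linear_\<Phi>])
  then have "V n = s *\<^sub>R X" using inj_\<Phi> by (simp add: inj_eq)
  then show "X $ 2 = 0" using assms(3)[of n] n s(1) by simp
qed

lemma M_line_coords_isotropic: "complex_form (M_line_coords A) (M_line_coords A) = 0"
  by (simp add: complex_form_def M_line_coords_def power2_eq_square algebra_simps)

text \<open>On two such coordinate vectors the form is the determinant of the difference of the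
  symmetric 2x2 blocks, and a step changes the block by a matrix of rank at most one.\<close>

lemma M_line_coords_contact:
  assumes "symmetric_M_system M"
  shows "complex_form (M_line_coords (M n)) (M_line_coords (M (n + unit_step l))) = 0"
proof -
  have "transpose (M n) = M n" using assms by (simp add: symmetric_M_system_def)
  from arg_cong[OF this, of "\<lambda>A. A $ j $ i" for i j]
  have sym: "M n $ i $ j = M n $ j $ i" for i j by (simp add: transpose_def)
  have "\<exists>i::5. i \<noteq> 4 \<and> i \<noteq> 5 \<and> (\<forall>j k. j \<noteq> i \<and> k \<noteq> i \<longrightarrow> M (n + unit_step l) $ j $ k = M n $ j $ k - M n $ j $ i * M n $ i $ k / M n $ i $ i)"
  proof -
    have *: "\<forall>j k. j \<noteq> i \<and> k \<noteq> i \<longrightarrow> M (n + e) $ j $ k = M n $ j $ k - M n $ j $ i * M n $ i $ k / M n $ i $ i"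
      if "(i, e) \<in> {(1, unit_step 1), (2, unit_step 2), (3, unit_step 3)}" for i e
      using assms that unfolding symmetric_M_system_def by fast
    show ?thesis
      using exhaust_3[of l] *[of 1 "unit_step 1"] *[of 2 "unit_step 2"] *[of 3 "unit_step 3"]
      by (elim disjE) (rule exI[of _ 1], simp, rule exI[of _ 2], simp, rule exI[of _ 3], simp)
  qed
  then obtain i where i: "\<And>j k. j \<noteq> i \<Longrightarrow> k \<noteq> i \<Longrightarrow> M (n + unit_step l) $ j $ k = M n $ j $ k - M n $ j $ i * M n $ i $ k / M n $ i $ i"
    "4 \<noteq> i" "5 \<noteq> i" by auto
  then have e: "M (n + unit_step l) $ 4 $ 4 = M n $ 4 $ 4 - M n $ i $ 4 * M n $ i $ 4 * inverse (M n $ i $ i)"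
    "M (n + unit_step l) $ 4 $ 5 = M n $ 4 $ 5 - M n $ i $ 4 * M n $ i $ 5 * inverse (M n $ i $ i)"
    "M (n + unit_step l) $ 5 $ 5 = M n $ 5 $ 5 - M n $ i $ 5 * M n $ i $ 5 * inverse (M n $ i $ i)"
    by (simp_all add: divide_inverse sym[of 4 i] sym[of 5 i])
  show ?thesis unfolding complex_form_def M_line_coords_def vector_5 e by algebra
qed

lemma complex_of_reduced_M_system:
  assumes "reduced_M_system \<Phi> M"
  shows "\<exists>g c. geodesic_circle_complex g c \<and> governed_by \<Phi> M (combine g c)"
proof -
  define V where "V n = inv \<Phi> (M_line_coords (M n))" for n
  have V: "\<Phi> (V n) = M_line_coords (M n)" for n by (simp add: V_def surj_f_inv_f[OF surj_\<Phi>])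
  have M: "symmetric_M_system M" and geo: "even_site n \<Longrightarrow> V n $ 2 = 0" for n
    using assms V by (auto simp: reduced_M_system_def)
  have "M_line_coords (M n) \<noteq> 0" for n
  proof
    assume "M_line_coords (M n) = 0"
    then have "M_line_coords (M n) $ 1 = 0" by simp
    then show False by (simp add: M_line_coords_def)
  qed
  then have circ: "oriented_circle (V n)" for n
    using M_line_coords_isotropic[of "M n"] complex_form_\<Phi>[of "V n" "V n"] \<Phi>_eq_0_iff[of "V n"] by (simp add: oriented_circle_def V)
  have edge: "contact (V n) (V (n + unit_step l))" for n l
    using M_line_coords_contact[OF M, of n l] complex_form_\<Phi>[of "V n" "V (n + unit_step l)"] by (simp add: contact_def V)
  then have "contact (V n) (V v)" if "adjacent n v" for n v
    using that contact_commute unfolding adjacent_def by metis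
  then have "geodesic_circle_complex V V" using circ geo by (simp add: geodesic_circle_complex_def geodesic_circle_def)
  moreover have "governed_by \<Phi> M (combine V V)"
    unfolding governed_by_def by (auto simp: combine_def V intro: exI[of _ 1])
  ultimately show ?thesis by blast
qed

end

theorem theorem6p3:
  fixes \<Phi> :: "real^5 \<Rightarrow> real^5" and w :: site
  assumes "lie_plucker_isometry \<Phi>" and "w \<in> A2 (- 1)"
  shows
    \<comment> \<open>the geodesic circles are determined by the Cauchy data\<close>
    "(\<forall>g c. geodesic_circle_complex g c \<and> generic (combine g c) \<longrightarrow>
        cauchy_data w g \<and>
        (\<forall>g' c'. geodesic_circle_complex g' c' \<and> generic (combine g' c') \<and>
           (\<forall>n\<in>star_region w. same_circle (g' n) (g n)) \<longrightarrow>
           (\<forall>n. even_site n \<longrightarrow> same_circle (g' n) (g n))))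
     \<and>
     \<comment> \<open>the circles come in pairs related by reflection\<close>
     (\<forall>g c. geodesic_circle_complex g c \<longrightarrow>
        (\<forall>S. geodesic_circle_complex g (\<lambda>v. if v \<in> S then reflect (c v) else c v)) \<and>
        (generic (combine g c) \<longrightarrow>
           (\<forall>v. \<not> even_site v \<longrightarrow> \<not> same_circle (reflect (c v)) (c v)) \<and>
           (\<forall>c'. geodesic_circle_complex g c' \<longrightarrow>
              (\<forall>v. \<not> even_site v \<longrightarrow>
                 same_circle (c' v) (c v) \<or> same_circle (c' v) (reflect (c v))))))
     \<and>
     \<comment> \<open>\<open>c0\<close> fixes the circles associated with the data. All four circles of the central cube are
        among them, whence the compatibility condition on that cube; all others are dictated.\<close>
     (\<forall>g c0. geodesic_circle_complex g c0 \<and> generic (combine g c0) \<and>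
        correlated_in_cube \<Phi> (combine g c0) w unit_step \<longrightarrow>
        (\<exists>c. correlation_extension \<Phi> w g c0 c) \<and>
        (\<forall>c c'. correlation_extension \<Phi> w g c0 c \<and> correlation_extension \<Phi> w g c0 c' \<longrightarrow>
           (\<forall>v. \<not> even_site v \<longrightarrow> same_circle (c' v) (c v))) \<and>
        (\<forall>c. correlation_extension \<Phi> w g c0 c \<longrightarrow>
           fundamental_circle_complex \<Phi> (combine g c) \<and>
           ((\<forall>n. \<Phi> (combine g c n) $ 1 \<noteq> 0) \<longrightarrow>
              (\<exists>M. reduced_M_system \<Phi> M \<and> governed_by \<Phi> M (combine g c)))))
     \<and>
     \<comment> \<open>conversely, every solution of the reduction encodes a geodesic-circle complex\<close>
     (\<forall>M. reduced_M_system \<Phi> M \<longrightarrow>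
        (\<exists>g c. geodesic_circle_complex g c \<and> governed_by \<Phi> M (combine g c)))"
proof -
  interpret lie_plucker \<Phi> by unfold_locales (rule assms(1))
  note w = assms(2)
  show ?thesis
  proof (intro conjI allI impI; (elim conjE)?)
    fix g c assume "geodesic_circle_complex g c" "generic (combine g c)"
    then show "cauchy_data w g" by (rule cauchy_data_of_complex[OF w])
  next
    fix g c g' c' n assume "geodesic_circle_complex g c" "generic (combine g c)" "geodesic_circle_complex g' c'"
      "generic (combine g' c')" "\<forall>n\<in>star_region w. same_circle (g' n) (g n)" "even_site n"
    then show "same_circle (g' n) (g n)" using geodesics_determined[OF w] by blast
  next
    fix g c S assume "geodesic_circle_complex g c"
    then show "geodesic_circle_complex g (\<lambda>v. if v \<in> S then reflect (c v) else c v)" by (rule reflected_complex)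
  next
    fix g c v assume "geodesic_circle_complex g c" "generic (combine g c)" "\<not> even_site v"
    then show "\<not> same_circle (reflect (c v)) (c v)" by (rule not_same_reflected)
  next
    fix g c c' v assume "geodesic_circle_complex g c" "generic (combine g c)" "geodesic_circle_complex g c'" "\<not> even_site v"
    then show "same_circle (c' v) (c v) \<or> same_circle (c' v) (reflect (c v))" by (rule same_or_reflected)
  next
    fix g c0 assume gc: "geodesic_circle_complex g c0" "generic (combine g c0)"
      and centre: "correlated_in_cube \<Phi> (combine g c0) w unit_step"
    \<comment> \<open>A choice correlated in every cube, with which all extensions are
      compared.\<close>
    obtain c where c: "geodesic_circle_complex g c" "\<And>v. v \<in> data_circle_sites w \<Longrightarrow> same_circle (c v) (c0 v)"
      "\<And>v a. \<not> even_site v \<Longrightarrow> cube_edges a \<Longrightarrow> correlated_in_cube \<Phi> (combine g c) v a"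
      using correlated_choice_exists[OF w gc centre] by blast
    have "correlation_extension \<Phi> w g c0 c" by (rule correlation_extensionI[OF w c(1)]) (erule c(2), erule (1) c(3))
    then show "\<exists>c. correlation_extension \<Phi> w g c0 c" by blast
    have unique: "\<not> even_site v \<Longrightarrow> same_circle (c1 v) (c v)"
      "\<not> even_site v \<Longrightarrow> cube_edges a \<Longrightarrow> correlated_in_cube \<Phi> (combine g c1) v a"
      if "correlation_extension \<Phi> w g c0 c1" for c1 v a
      by (rule correlation_extension_unique[OF w gc c(1) _ _ that]; (erule (1) c(3) | erule c(2) | assumption))+
    show "same_circle (c2 v) (c1 v)" if "correlation_extension \<Phi> w g c0 c1" "correlation_extension \<Phi> w g c0 c2" "\<not> even_site v" for c1 c2 v
      using unique(1)[OF that(1) that(3)] unique(1)[OF that(2) that(3)] same_circle_sym same_circle_trans by blast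
    fix c1 assume c1: "correlation_extension \<Phi> w g c0 c1"
    obtain p q where F0: "generic_frame \<Phi> g c0 p q" by (rule generic_frame_exists[OF gc])
    have cc1: "geodesic_circle_complex g c1" using c1 by (simp add: correlation_extension_def)
    have F: "generic_frame \<Phi> g c1 p q" by (rule generic_frame_change[OF F0 cc1])
    interpret F: generic_frame \<Phi> g c1 p q by (rule F)
    show fund: "fundamental_circle_complex \<Phi> (combine g c1)"
      using F.twisted_imp_fundamental unique(2)[OF c1] correlated_in_cube_iff[OF F] by blast
    assume "\<forall>n. \<Phi> (combine g c1 n) $ 1 \<noteq> 0"
    then obtain M where M: "symmetric_M_system M" "governed_by \<Phi> M (combine g c1)"
      using M_system_of_fundamental_complex[OF fund F.generic] by blast
    have "reduced_M_system \<Phi> M"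
      by (rule governed_reduced[OF M]) (use cc1 in \<open>auto simp: geodesic_circle_complex_def geodesic_circle_def combine_def\<close>)
    then show "\<exists>M. reduced_M_system \<Phi> M \<and> governed_by \<Phi> M (combine g c1)" using M by blast
  next
    fix M assume "reduced_M_system \<Phi> M"
    then show "\<exists>g c. geodesic_circle_complex g c \<and> governed_by \<Phi> M (combine g c)" by (rule complex_of_reduced_M_system)
  qed
qed

end
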